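(* Let $k$ be a field, $m\ge1$, $R=k[t_1,\dots,t_m]$, and $\sigma_i=[m]\setminus\{i\}$ for $i\in[m]$. The rank invariant of a finitely generated $R$-module $M$ determines the modules $M_{\sigma_i}=R_{\sigma_i}\otimes_RM$ (for all $i\in[m]$) and $M_{[m]}=R_{[m]}\otimes_RM$ up to isomorphism: if $M$ and $N$ are finitely generated $R$-modules with $\mathrm{rk}_M=\mathrm{rk}_N$, then $M_{\sigma_i}\cong N_{\sigma_i}$ as $R_{\sigma_i}$-modules for all $i\in[m]$ and $M_{[m]}\cong N_{[m]}$ as $R_{[m]}$-modules.
   Context: $R$ is $\mathbb{N}^m$-graded ($0\in\mathbb{N}$) with $|t_i|=\vec e_i$; $R$-modules are $\mathbb{N}^m$-graded and all morphisms preserve multidegree. For $\sigma\subseteq[m]=\{1,\dots,m\}$, $R_\sigma=R[t_i^{-1}\mid i\in\sigma]$, and $R_\sigma$-modules are graded by $\sigma^{-1}\mathbb{N}^m=\{\vec d\in\mathbb{Z}^m : d_i\ge 0 \text{ for } i\notin\sigma\}$. The modules $M_{\sigma_i}$ and $M_{[m]}$ are the constituents of the localization of $M$ in the category $\mathcal{L}(K_m)$ of $K_m$-localized persistence modules, where $K_m=\{\sigma\subseteq[m]:\#\sigma\le m-2\}$. The rank invariant of $M$ is the function assigning to each pair $\vec a\le\vec b$ in $\mathbb{N}^m$ (componentwise order) the integer $\mathrm{rk}_M(\vec a,\vec b)=\mathrm{rank}\big(t^{\vec b-\vec a}\colon M(\vec a)\to M(\vec b)\big)$, where $M(\vec d)$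 is the part of $M$ in multidegree $\vec d$. *)

theory Defs
  imports
    "HOL-Analysis.Finite_Cartesian_Product"
    "HOL-Algebra.Free_Abelian_Groups"
    "Jordan_Normal_Form.Missing_VectorSpace"
begin

text \<open>
  The index set $[m]$ is a finite type \<open>'m\<close> (so $m = \mathrm{CARD}('m) \ge 1$) and multidegrees are
  elements of \<open>int ^ 'm\<close> with the componentwise order.  Laurent polynomials over \<open>'k\<close> are finitely
  supported functions on \<open>int ^ 'm\<close> with the convolution product of \<^theory>\<open>HOL-Library.Poly_Mapping\<close>;
  \<open>Poly_Mapping.single d c\<close> is the monomial $c\,t^d$.
\<close>

type_synonym ('k, 'm) laurent = "(int ^ 'm) \<Rightarrow>\<^sub>0 'k"

text \<open>$\sigma^{-1}\mathbb{N}^m$\<close>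

definition degs :: "'m set \<Rightarrow> (int ^ 'm::finite) set"
  where "degs \<sigma> = {d. \<forall>i. i \<notin> \<sigma> \<longrightarrow> 0 \<le> d $ i}"

text \<open>
  $R_\sigma = k[t_1,\dots,t_m][t_i^{-1} \mid i\in\sigma]$, realised inside the ring of Laurent
  polynomials; the polynomial ring $R$ itself is \<open>loc_ring {}\<close>.
\<close>

definition loc_ring :: "'m::finite set \<Rightarrow> ('k::field, 'm) laurent ring"
  where "loc_ring \<sigma> =
    \<lparr>carrier = {p. Poly_Mapping.keys p \<subseteq> degs \<sigma>}, mult = (*), one = 1, zero = 0, add = (+)\<rparr>"

record ('d, 'r, 'a) graded_module = "('r, 'a) module" +
  component :: "'d \<Rightarrow> 'a set"

text \<open>
  A $\sigma^{-1}\mathbb{N}^m$-graded $R_\sigma$-module: $M$ is the internal direct sum of the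
  homogeneous components $M(d)$, $d\in\sigma^{-1}\mathbb{N}^m$.  As degrees are taken from all of
  $\mathbb{Z}^m$, the components outside $\sigma^{-1}\mathbb{N}^m$ are required to vanish.
\<close>

locale graded_loc_module = Module.module "loc_ring \<sigma>" M
  for \<sigma> :: "'m::finite set"
    and M :: "(int ^ 'm, ('k::field, 'm) laurent, 'a) graded_module" (structure) +
  assumes component_subgroup: "d \<in> degs \<sigma> \<Longrightarrow> subgroup (component M d) (add_monoid M)"
    and component_outside: "d \<notin> degs \<sigma> \<Longrightarrow> component M d = {\<zero>\<^bsub>M\<^esub>}"
    and decomposition: "x \<in> carrier M \<Longrightarrow>
      \<exists>!f. (\<forall>d. f d \<in> component M d) \<and> finite {d. f d \<noteq> \<zero>\<^bsub>M\<^esub>} \<and>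
           x = finsum M f {d. f d \<noteq> \<zero>\<^bsub>M\<^esub>}"
    and monomial_smult: "e \<in> degs \<sigma> \<Longrightarrow> x \<in> component M d \<Longrightarrow>
      Poly_Mapping.single e c \<odot>\<^bsub>M\<^esub> x \<in> component M (d + e)"

definition finitely_generated ::
  "'m::finite set \<Rightarrow> (int ^ 'm, ('k::field, 'm) laurent, 'a) graded_module \<Rightarrow> bool"
  where "finitely_generated \<sigma> M \<longleftrightarrow>
    (\<exists>A. finite A \<and> A \<subseteq> carrier M \<and> module.span (loc_ring \<sigma>) M A = carrier M)"

text \<open>Isomorphisms of graded modules preserve multidegrees.\<close>

definition graded_iso ::
  "'m::finite set \<Rightarrow> (int ^ 'm, ('k::field, 'm) laurent, 'a) graded_module
    \<Rightarrow> (int ^ 'm, ('k, 'm) laurent, 'b) graded_module \<Rightarrow> bool"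
  where "graded_iso \<sigma> M N \<longleftrightarrow>
    (\<exists>\<phi> \<in> module_hom (loc_ring \<sigma>) M N. bij_betw \<phi> (carrier M) (carrier N) \<and>
      (\<forall>d. \<phi> ` component M d = component N d))"

definition base_field :: "'k::field ring"
  where "base_field = \<lparr>carrier = UNIV, mult = (*), one = 1, zero = 0, add = (+)\<rparr>"

text \<open>The $k$-vector space $M(d)$, with $k$ acting through the constant polynomials.  The
  multiplicative fields of a module record carry no meaning.\<close>

definition component_space ::
  "(int ^ 'm::finite, ('k::field, 'm) laurent, 'a) graded_module \<Rightarrow> int ^ 'm \<Rightarrow> ('k, 'a) module"
  where "component_space M d =
    \<lparr>carrier = component M d, mult = mult M, one = one M, zero = zero M, add = add M,
     smult = (\<lambda>c x. Poly_Mapping.single 0 c \<odot>\<^bsub>M\<^esub> x)\<rparr>"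

text \<open>$\mathrm{rk}_M(a,b) = \dim_k t^{b-a}M(a)$, the image being a subspace of $M(b)$; only meaningful
  for $0 \le a \le b$.\<close>

definition rk ::
  "(int ^ 'm::finite, ('k::field, 'm) laurent, 'a) graded_module \<Rightarrow> int ^ 'm \<Rightarrow> int ^ 'm \<Rightarrow> nat"
  where "rk M a b = vectorspace.dim base_field
    ((component_space M b)
      \<lparr>carrier := (\<lambda>x. Poly_Mapping.single (b - a) 1 \<odot>\<^bsub>M\<^esub> x) ` component M a\<rparr>)"

text \<open>
  The tensor product $R_\sigma\otimes_R M$: the free abelian group on \<open>R\<^sub>\<sigma> \<times> M\<close> modulo the
  subgroup generated by the relations of bilinearity and $R$-balancedness.
\<close>

abbreviation tensor_free ::
  "'m::finite set \<Rightarrow> (int ^ 'm, ('k::field, 'm) laurent, 'a) graded_module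
    \<Rightarrow> (('k, 'm) laurent \<times> 'a \<Rightarrow>\<^sub>0 int) monoid"
  where "tensor_free \<sigma> M \<equiv> free_Abelian_group (carrier (loc_ring \<sigma>) \<times> carrier M)"

definition tensor_relators ::
  "'m::finite set \<Rightarrow> (int ^ 'm, ('k::field, 'm) laurent, 'a) graded_module
    \<Rightarrow> (('k, 'm) laurent \<times> 'a \<Rightarrow>\<^sub>0 int) set"
  where "tensor_relators \<sigma> M =
    {frag_of (s + s', x) - frag_of (s, x) - frag_of (s', x) | s s' x.
       s \<in> carrier (loc_ring \<sigma>) \<and> s' \<in> carrier (loc_ring \<sigma>) \<and> x \<in> carrier M} \<union>
    {frag_of (s, x \<oplus>\<^bsub>M\<^esub> x') - frag_of (s, x) - frag_of (s, x') | s x x'.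
       s \<in> carrier (loc_ring \<sigma>) \<and> x \<in> carrier M \<and> x' \<in> carrier M} \<union>
    {frag_of (s * r, x) - frag_of (s, r \<odot>\<^bsub>M\<^esub> x) | s r x.
       s \<in> carrier (loc_ring \<sigma>) \<and> r \<in> carrier (loc_ring {}) \<and> x \<in> carrier M}"

definition tensor_kernel ::
  "'m::finite set \<Rightarrow> (int ^ 'm, ('k::field, 'm) laurent, 'a) graded_module
    \<Rightarrow> (('k, 'm) laurent \<times> 'a \<Rightarrow>\<^sub>0 int) set"
  where "tensor_kernel \<sigma> M = generate (tensor_free \<sigma> M) (tensor_relators \<sigma> M)"

definition tensor_class ::
  "'m::finite set \<Rightarrow> (int ^ 'm, ('k::field, 'm) laurent, 'a) graded_module
    \<Rightarrow> (('k, 'm) laurent \<times> 'a \<Rightarrow>\<^sub>0 int) \<Rightarrow> (('k, 'm) laurent \<times> 'a \<Rightarrow>\<^sub>0 int) set"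
  where "tensor_class \<sigma> M c = tensor_kernel \<sigma> M #>\<^bsub>tensor_free \<sigma> M\<^esub> c"

definition tensor_act ::
  "('k::field, 'm::finite) laurent \<Rightarrow> (('k, 'm) laurent \<times> 'a \<Rightarrow>\<^sub>0 int) \<Rightarrow> (('k, 'm) laurent \<times> 'a \<Rightarrow>\<^sub>0 int)"
  where "tensor_act s = frag_extend (\<lambda>(s', x). frag_of (s * s', x))"

text \<open>
  $M_\sigma = R_\sigma\otimes_R M$.  The action is $s\cdot(s'\otimes x) = ss'\otimes x$, extended
  additively to the free group and passed to cosets; the component of degree $d$ is generated by
  the tensors $s\otimes x$ of homogeneous $s$, $x$ with $|s| + |x| = d$.
\<close>

definition localization ::
  "'m::finite set \<Rightarrow> (int ^ 'm, ('k::field, 'm) laurent, 'a) graded_module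
    \<Rightarrow> (int ^ 'm, ('k, 'm) laurent, (('k, 'm) laurent \<times> 'a \<Rightarrow>\<^sub>0 int) set) graded_module"
  where "localization \<sigma> M = (let T = tensor_free \<sigma> M Mod tensor_kernel \<sigma> M in
    \<lparr>carrier = carrier T, mult = undefined, one = undefined,
     zero = \<one>\<^bsub>T\<^esub>, add = monoid.mult T,
     smult = (\<lambda>s C. \<Union>c\<in>C. tensor_class \<sigma> M (tensor_act s c)),
     component = (\<lambda>d. generate T
       {tensor_class \<sigma> M (frag_of (Poly_Mapping.single e c, x)) | e c x d'.
          e \<in> degs \<sigma> \<and> x \<in> component M d' \<and> e + d' = d})\<rparr>)"

text \<open>The action on cosets is well defined and makes $M_\sigma$ an $R_\sigma$-module.\<close>

lemma degs_add: "a \<in> degs \<sigma> \<Longrightarrow> b \<in> degs \<sigma> \<Longrightarrow> a + b \<in> degs \<sigma>"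
  by (auto simp: degs_def)

lemma loc_ring_mult: "s \<in> carrier (loc_ring \<sigma>) \<Longrightarrow> s' \<in> carrier (loc_ring \<sigma>) \<Longrightarrow> s * s' \<in> carrier (loc_ring \<sigma>)"
  using keys_mult[of s s'] by (fastforce simp: loc_ring_def intro: degs_add)

lemma loc_ring_add: "s \<in> carrier (loc_ring \<sigma>) \<Longrightarrow> s' \<in> carrier (loc_ring \<sigma>) \<Longrightarrow> s + s' \<in> carrier (loc_ring \<sigma>)"
  using Poly_Mapping.keys_add[of s s'] by (fastforce simp: loc_ring_def)

lemma zero_degs: "0 \<in> degs \<sigma>" by (auto simp: degs_def)

lemma cring_loc_ring: "cring (loc_ring \<sigma> :: ('k::field,'m::finite) laurent ring)"
proof (rule cringI)
  show "abelian_group (loc_ring \<sigma> :: ('k,'m) laurent ring)"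
  proof (rule abelian_groupI)
    fix x :: "('k,'m) laurent" assume "x \<in> carrier (loc_ring \<sigma>)"
    then show "\<exists>y\<in>carrier (loc_ring \<sigma>). y \<oplus>\<^bsub>loc_ring \<sigma>\<^esub> x = \<zero>\<^bsub>loc_ring \<sigma>\<^esub>"
      by (intro bexI[of _ "-x"]) (auto simp: loc_ring_def)
  qed (use loc_ring_add in \<open>auto simp: loc_ring_def add_ac dest!: subsetD[OF Poly_Mapping.keys_add]\<close>)
  show "Group.comm_monoid (loc_ring \<sigma> :: ('k,'m) laurent ring)"
  proof (rule comm_monoidI)
    fix x y :: "('k,'m) laurent" assume "x \<in> carrier (loc_ring \<sigma>)" "y \<in> carrier (loc_ring \<sigma>)"
    from loc_ring_mult[OF this] show "x \<otimes>\<^bsub>loc_ring \<sigma>\<^esub> y \<in> carrier (loc_ring \<sigma>)"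
      by (simp add: loc_ring_def)
  qed (simp_all add: loc_ring_def zero_degs mult_ac)
qed (auto simp: loc_ring_def algebra_simps)

lemma degs_mono: "degs {} \<subseteq> degs \<sigma>" by (auto simp: degs_def)

lemma tensor_relators_subset: assumes "graded_loc_module {} M"
  shows "tensor_relators \<sigma> M \<subseteq> carrier (tensor_free \<sigma> M)"
proof -
  interpret graded_loc_module "{}" M by fact
  have "carrier (loc_ring {}) \<subseteq> (carrier (loc_ring \<sigma>))" using degs_mono[of \<sigma>] by (auto simp: loc_ring_def)
  then show ?thesis
  by (auto simp: tensor_relators_def loc_ring_mult loc_ring_add subset_iff split: if_splits
      dest!: subsetD[OF keys_diff] )
qed

lemma tensor_act_kernel: assumes M: "graded_loc_module {} M" and s: "s \<in> carrier (loc_ring \<sigma>)" and c: "c \<in> tensor_kernel \<sigma> M"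
  shows "tensor_act s c \<in> tensor_kernel \<sigma> M"
  using c unfolding tensor_kernel_def
proof (induction rule: generate.induct)
  case one then show ?case by (auto simp: tensor_act_def intro: generate.one[of "tensor_free \<sigma> M", simplified])
next
  have *: "tensor_act s h \<in> tensor_relators \<sigma> M" if h: "h \<in> tensor_relators \<sigma> M" for h
    using that s unfolding tensor_relators_def
    apply (elim UnE)
      apply (clarsimp simp: tensor_act_def frag_extend_diff distrib_left)
      apply (metis (mono_tags, lifting) loc_ring_mult)
     apply (clarsimp simp: tensor_act_def frag_extend_diff)
     apply (metis (mono_tags, lifting) loc_ring_mult)
    apply (clarsimp simp: tensor_act_def frag_extend_diff mult.assoc[symmetric])
    apply (metis (mono_tags, lifting) loc_ring_mult)
    done
  { case (incl h) show ?case using *[OF incl] by (rule generate.incl)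
  next case (inv h)
    have k: "Poly_Mapping.keys h \<subseteq> carrier (loc_ring \<sigma>) \<times> carrier M" "Poly_Mapping.keys (tensor_act s h) \<subseteq> carrier (loc_ring \<sigma>) \<times> carrier M"
      using subsetD[OF tensor_relators_subset[OF M, of \<sigma>] inv] subsetD[OF tensor_relators_subset[OF M, of \<sigma>] *[OF inv]] by simp_all
    show ?case using generate.inv[OF *[OF inv], of "tensor_free \<sigma> M"] k
      by (simp add: tensor_act_def frag_extend_minus)
  next case (eng h1 h2) then show ?case using generate.eng[of "tensor_act s h1" "tensor_free \<sigma> M"]
     by (simp add: tensor_act_def frag_extend_add) }
qed

lemma tensor_class_image: "tensor_class \<sigma> M c = (\<lambda>n. n + c) ` tensor_kernel \<sigma> M"
  by (auto simp: tensor_class_def r_coset_def)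

lemma zero_in_tensor_kernel: "0 \<in> tensor_kernel \<sigma> M"
  unfolding tensor_kernel_def using generate.one[of "tensor_free \<sigma> M"] by simp

lemma tensor_class_eq: assumes M: "graded_loc_module {} M" and "n \<in> tensor_kernel \<sigma> M"
  shows "tensor_class \<sigma> M (n + c) = tensor_class \<sigma> M c"
proof -
  have g: "subgroup (tensor_kernel \<sigma> M) (tensor_free \<sigma> M)"
    unfolding tensor_kernel_def by (rule group.generate_is_subgroup[OF group_free_Abelian_group tensor_relators_subset[OF M]])
  have "Poly_Mapping.keys n \<subseteq> carrier (loc_ring \<sigma>) \<times> carrier M"
    using subsetD[OF subgroup.subset[OF g] assms(2)] by simp
  then have m: "- n \<in> tensor_kernel \<sigma> M"
    using subgroup.m_inv_closed[OF g assms(2)] by simp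
  have p: "a + b \<in> tensor_kernel \<sigma> M" if "a \<in> tensor_kernel \<sigma> M" "b \<in> tensor_kernel \<sigma> M" for a b
    using subgroup.m_closed[OF g that] by simp
  show ?thesis unfolding tensor_class_image
  proof (intro equalityI subsetI; elim imageE; hypsubst)
    fix a assume "a \<in> tensor_kernel \<sigma> M"
    then show "a + (n + c) \<in> (\<lambda>n. n + c) ` tensor_kernel \<sigma> M"
      using p assms(2) by (intro image_eqI[of _ _ "a+n"]) (auto simp: add_ac)
  next
    fix a assume "a \<in> tensor_kernel \<sigma> M"
    then show "a + c \<in> (\<lambda>na. na + (n + c)) ` tensor_kernel \<sigma> M"
      using p[OF _ m] by (intro image_eqI[of _ _ "a+(-n)"]) (simp add: algebra_simps, blast)
  qed
qed

lemma localization_smult: assumes M: "graded_loc_module {} M" and s: "s \<in> carrier (loc_ring \<sigma>)"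
  shows "s \<odot>\<^bsub>localization \<sigma> M\<^esub> tensor_class \<sigma> M c = tensor_class \<sigma> M (tensor_act s c)"
proof -
  have "tensor_class \<sigma> M (tensor_act s (n + c)) = tensor_class \<sigma> M (tensor_act s c)" if "n \<in> tensor_kernel \<sigma> M" for n
    using tensor_class_eq[OF M tensor_act_kernel[OF M s that]] by (simp add: tensor_act_def frag_extend_add)
  then show ?thesis
    unfolding localization_def Let_def using zero_in_tensor_kernel[of \<sigma> M] by (auto simp: tensor_class_image[of _ _ c])
qed

lemma tensor_act_mult: "tensor_act s (tensor_act s' c) = tensor_act (s * s') c"
  unfolding tensor_act_def by (induction c rule: frag_induction[OF subset_UNIV])
    (auto simp: frag_extend_diff mult.assoc)


lemma tensor_act_add: "tensor_act (s+s') c - tensor_act s c - tensor_act s' c \<in> tensor_kernel \<sigma> M"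
  if M: "graded_loc_module {} M" and s: "s \<in> carrier (loc_ring \<sigma>)" "s' \<in> carrier (loc_ring \<sigma>)" and c: "c \<in> carrier (tensor_free \<sigma> M)"
proof -
  have g: "subgroup (tensor_kernel \<sigma> M) (tensor_free \<sigma> M)"
    unfolding tensor_kernel_def by (rule group.generate_is_subgroup[OF group_free_Abelian_group tensor_relators_subset[OF M]])
  have m: "a - b \<in> tensor_kernel \<sigma> M" if "a \<in> tensor_kernel \<sigma> M" "b \<in> tensor_kernel \<sigma> M" for a b
  proof -
    have "Poly_Mapping.keys b \<subseteq> carrier (loc_ring \<sigma>) \<times> carrier M" using subsetD[OF subgroup.subset[OF g] that(2)] by simp
    then show ?thesis using subgroup.m_closed[OF g that(1) subgroup.m_inv_closed[OF g that(2)]] by simp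
  qed
  have "Poly_Mapping.keys c \<subseteq> carrier (loc_ring \<sigma>) \<times> carrier M" using c by simp
  then show ?thesis
  proof (induction c rule: frag_induction)
    case zero show ?case by (simp add: tensor_act_def zero_in_tensor_kernel)
  next case (one x)
    obtain r y where x: "x = (r, y)" by (cases x)
    have "frag_of (s * r + s' * r, y) - frag_of (s * r, y) - frag_of (s' * r, y) \<in> tensor_relators \<sigma> M"
      unfolding tensor_relators_def using one x s by (intro UnI1 CollectI exI[of _ "s * r"] exI[of _ "s' * r"] exI[of _ y] conjI) (auto intro: loc_ring_mult)
    then show ?case unfolding tensor_kernel_def
      by (intro generate.incl) (simp add: x tensor_act_def distrib_right)
  next case (diff a b)
    from m[OF diff] show ?case by (simp add: tensor_act_def frag_extend_diff algebra_simps)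
  qed
qed

lemma tensor_act_carrier: assumes "s \<in> carrier (loc_ring \<sigma>)" "c \<in> carrier (tensor_free \<sigma> M)"
  shows "tensor_act s c \<in> carrier (tensor_free \<sigma> M)"
proof -
  have "Poly_Mapping.keys c \<subseteq> carrier (loc_ring \<sigma>) \<times> carrier M" using assms by simp
  then show ?thesis
  proof (induction c rule: frag_induction)
    case (one x) then show ?case using assms(1) by (cases x) (auto simp: tensor_act_def loc_ring_mult)
  next case (diff a b) then show ?case using keys_diff[of "tensor_act s a" "tensor_act s b"] by (auto simp: tensor_act_def frag_extend_diff)
  qed (simp add: tensor_act_def)
qed

lemma module_localization: fixes M :: "(int ^ 'm::finite, ('k::field, 'm) laurent, 'a) graded_module" assumes M: "graded_loc_module {} M"
  shows "Module.module (loc_ring \<sigma>) (localization \<sigma> M)"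
proof -
  let ?F = "tensor_free \<sigma> M" let ?K = "tensor_kernel \<sigma> M" let ?L = "localization \<sigma> M"
  have g: "subgroup ?K ?F"
    unfolding tensor_kernel_def by (rule group.generate_is_subgroup[OF group_free_Abelian_group tensor_relators_subset[OF M]])
  interpret F: comm_group ?F by (rule abelian_free_Abelian_group)
  interpret N: normal ?K ?F using F.normal_iff_subgroup g by simp
  interpret Q: comm_group "?F Mod ?K" by (rule F.abelian_FactGroup[OF g])
  have ad: "carrier ?L = carrier (?F Mod ?K)" "add ?L = monoid.mult (?F Mod ?K)" "zero ?L = one (?F Mod ?K)"
    by (simp_all add: localization_def Let_def)
  have ag: "abelian_group ?L"
    by (rule abelian_groupI; unfold ad; intro Q.m_closed Q.one_closed Q.m_assoc Q.m_comm Q.l_one Q.l_inv_ex; assumption)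
  have cL: "carrier ?L = tensor_class \<sigma> M ` carrier ?F"
    by (auto simp: localization_def Let_def carrier_FactGroup tensor_class_def)
  have addc: "tensor_class \<sigma> M c \<oplus>\<^bsub>?L\<^esub> tensor_class \<sigma> M c' = tensor_class \<sigma> M (c + c')"
    if "c \<in> carrier ?F" "c' \<in> carrier ?F" for c c'
    using N.rcos_sum[OF that] by (simp add: localization_def Let_def tensor_class_def)
  have ca: "c + c' \<in> carrier ?F" if "c \<in> carrier ?F" "c' \<in> carrier ?F" for c c'
    using F.m_closed[OF that] by simp
  have eqI: "tensor_class \<sigma> M a = tensor_class \<sigma> M b" if "a - b \<in> ?K" for a b
    using tensor_class_eq[OF M that, of b] by simp
  have one: "tensor_act 1 c = c" for c unfolding tensor_act_def by (induction c rule: frag_induction[OF subset_UNIV]) (auto simp: frag_extend_diff)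
  show ?thesis
  proof (rule moduleI)
    fix a b :: "('k,'m) laurent" and x y assume *: "a \<in> carrier (loc_ring \<sigma>)" "b \<in> carrier (loc_ring \<sigma>)" "x \<in> carrier ?L"
    then obtain c where c: "c \<in> carrier ?F" "x = tensor_class \<sigma> M c" unfolding cL by blast
    have ab: "a + b \<in> carrier (loc_ring \<sigma>)" "a * b \<in> carrier (loc_ring \<sigma>)" using * loc_ring_add loc_ring_mult by blast+
    note ac = tensor_act_carrier[OF *(1) c(1)] tensor_act_carrier[OF *(2) c(1)]
    have 1: "tensor_class \<sigma> M (tensor_act (a + b) c) = tensor_class \<sigma> M (tensor_act a c + tensor_act b c)"
      by (rule eqI) (use tensor_act_add[OF M *(1,2) c(1)] in \<open>simp add: algebra_simps\<close>)
    have p: "a \<oplus>\<^bsub>loc_ring \<sigma>\<^esub> b = a + b" "a \<otimes>\<^bsub>loc_ring \<sigma>\<^esub> b = a * b" by (auto simp: loc_ring_def)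
    show "(a \<oplus>\<^bsub>loc_ring \<sigma>\<^esub> b) \<odot>\<^bsub>?L\<^esub> x = a \<odot>\<^bsub>?L\<^esub> x \<oplus>\<^bsub>?L\<^esub> b \<odot>\<^bsub>?L\<^esub> x"
      unfolding p c(2) localization_smult[OF M *(1)] localization_smult[OF M *(2)] localization_smult[OF M ab(1)] addc[OF ac] by (rule 1)
    show "(a \<otimes>\<^bsub>loc_ring \<sigma>\<^esub> b) \<odot>\<^bsub>?L\<^esub> x = a \<odot>\<^bsub>?L\<^esub> (b \<odot>\<^bsub>?L\<^esub> x)"
      unfolding p c(2) localization_smult[OF M *(1)] localization_smult[OF M *(2)] localization_smult[OF M ab(2)] tensor_act_mult ..
  next
    fix a :: "('k,'m) laurent" and x assume *: "a \<in> carrier (loc_ring \<sigma>)" "x \<in> carrier ?L"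
    then obtain c where c: "c \<in> carrier ?F" "x = tensor_class \<sigma> M c" unfolding cL by blast
    show "a \<odot>\<^bsub>?L\<^esub> x \<in> carrier ?L" unfolding c(2) localization_smult[OF M *(1)] cL
      using tensor_act_carrier[OF *(1) c(1)] by (rule imageI)
  next
    fix a :: "('k,'m) laurent" and x y assume *: "a \<in> carrier (loc_ring \<sigma>)" "x \<in> carrier ?L" "y \<in> carrier ?L"
    then obtain c d where c: "c \<in> carrier ?F" "x = tensor_class \<sigma> M c" "d \<in> carrier ?F" "y = tensor_class \<sigma> M d" unfolding cL by blast
    show "a \<odot>\<^bsub>?L\<^esub> (x \<oplus>\<^bsub>?L\<^esub> y) = a \<odot>\<^bsub>?L\<^esub> x \<oplus>\<^bsub>?L\<^esub> a \<odot>\<^bsub>?L\<^esub> y"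
      unfolding c(2,4) addc[OF c(1,3)] localization_smult[OF M *(1)] addc[OF tensor_act_carrier[OF *(1) c(1)] tensor_act_carrier[OF *(1) c(3)]]
      by (simp add: tensor_act_def frag_extend_add)
  next
    fix x assume *: "x \<in> carrier ?L"
    then obtain c where c: "c \<in> carrier ?F" "x = tensor_class \<sigma> M c" unfolding cL by blast
    have o: "\<one>\<^bsub>loc_ring \<sigma>\<^esub> = 1" "1 \<in> carrier (loc_ring \<sigma>)" by (auto simp: loc_ring_def degs_def)
    show "\<one>\<^bsub>loc_ring \<sigma>\<^esub> \<odot>\<^bsub>?L\<^esub> x = x" unfolding o c(2) localization_smult[OF M o(2)] one ..
  qed (rule cring_loc_ring, rule ag)
qed

end

theory Submission
  imports Defs "HOL-Library.Extended_Nat"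
begin

text \<open>
  Why the rank invariant determines these localizations.  Fix \<open>i\<close>, put \<open>\<sigma> = UNIV - {i}\<close> and let
  $u = \prod_{l\in\sigma} t_l$, so that $M_\sigma$ is the module of fractions $M[u^{-1}]$.  In each
  degree $j$ along the remaining direction $i$, the localization is the colimit of the components of
  $M$ along multiplication by $u$.  As $M$ is finitely generated, this colimit is attained: far out
  in the directions of \<open>\<sigma>\<close> the variables act surjectively on components (no generators are left,
  \<open>eventually_surjective\<close>), and since the components are finite-dimensional, $u$ eventually also acts
  injectively (\<open>eventually_injective\<close>).  Hence there are degrees $a_0\le a_1\le\dots$ whose
  $i$-th coordinate is $j$ at $a_j$ and for which $M(a_0)\to M(a_1)\to\cdots$ represents $M_\sigma$
  as a persistence module over the natural numbers; the ranks of its transition maps are values of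
  $\mathrm{rk}_M$.

  Pointwise finite-dimensional persistence modules over the natural numbers are determined by the
  ranks of their transition maps.  This is proved in \<open>persistence_relations\<close> by extending an
  isomorphism from one degree to the next, without decomposing into intervals: on each space the
  kernels of the outgoing maps form a chain whose dimensions are differences of ranks, and an
  isomorphism between subspaces that respects two such chains can be enlarged one vector at a time
  (\<open>extend_filtered_relation\<close>).

  Throughout, partial isomorphisms are handled as linear relations, that is, as submodules of
  $M\times N$.  The levelwise isomorphisms are spread over all degrees to one relation
  $\Gamma\subseteq M\times N$ which matches the $u$-torsion of $M$ with that of $N$ and reaches
  every homogeneous element up to a power of $u$ (\<open>matching_if_rk_eq\<close>).  An element $u^{-n}\otimes x$
  of $R_\sigma\otimes_R M$ vanishes iff $x$ is $u$-torsion (\<open>frac_zero_iff\<close>), so the pairs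
  $(u^{-n}\otimes x, u^{-n}\otimes y)$ with $(x,y)\in\Gamma$ form the graph of an isomorphism
  (\<open>graded_iso_if_matching\<close>).  Inverting more variables is harmless: the same $\Gamma$ is a matching
  for $[m]$ (\<open>matching_mono\<close>), which yields the last isomorphism.
\<close>

section \<open>Linear relations between modules\<close>

context vectorspace
begin

text \<open>
  A linearly independent subset of the subspace stays independent in the whole space, so its size is
  bounded and a maximal one is a finite basis.  If that basis has full size, it spans everything.
\<close>
lemma subspace_fin_dim:
  assumes fd: "fin_dim" and A: "subspace K A V"
  shows "vectorspace.fin_dim K (vs A)" "vectorspace.dim K (vs A) \<le> dim"
    and "A \<noteq> carrier V \<Longrightarrow> vectorspace.dim K (vs A) < dim"
proof -
  interpret A: vectorspace K "vs A" using A by (rule subspace_is_vs)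
  have sm: "submodule K A V" using A by simp
  have AV: "A \<subseteq> carrier V" using sm by (rule submodule.subset)
  have li_iff: "A.lin_dep S = lin_dep S" if "S \<subseteq> A" for S
    using span_li_not_depend(2)[OF that sm] .
  have bound: "finite S \<and> card S \<le> dim" if "S \<subseteq> carrier (vs A) \<and> A.lin_indpt S" for S
    using that li_le_dim[OF fd, of S] li_iff[of S] AV by auto
  have "\<exists>S. finite S \<and> maximal S (\<lambda>S. S \<subseteq> carrier (vs A) \<and> A.lin_indpt S)"
  proof (rule maximal_exists)
    show "{} \<subseteq> carrier (vs A) \<and> A.lin_indpt {}" by (simp add: A.lin_dep_def)
  qed (rule bound)
  then obtain S where S: "finite S" "maximal S (\<lambda>S. S \<subseteq> carrier (vs A) \<and> A.lin_indpt S)"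
    by blast
  have b: "A.basis S" using S(2) by (rule A.max_li_is_basis)
  have SA: "S \<subseteq> A" "A.lin_indpt S" using S(2) by (auto simp: maximal_def)
  have dA: "A.dim = card S" using A.dim_basis[OF S(1) b] .
  show "A.fin_dim" using b S(1) by (auto simp: A.basis_def A.fin_dim_def)
  show le: "A.dim \<le> dim" using bound[of S] SA dA by simp
  assume ne: "A \<noteq> carrier V"
  show "A.dim < dim"
  proof (rule ccontr)
    assume "\<not> A.dim < dim"
    with dA have "dim \<le> card S" by simp
    then have "basis S" using dim_li_is_basis[OF fd S(1)] SA AV li_iff by auto
    then have "span S = carrier V" by (simp add: basis_def)
    moreover have "span S \<subseteq> A" using SA(1) sm by (rule span_is_subset)
    ultimately show False using ne AV by auto
  qed
qed

lemma subspace_of_subspace: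
  assumes "subspace K A V" "subspace K B V" "A \<subseteq> B"
  shows "subspace K A (vs B)"
  using assms subspace_is_vs[OF assms(2)]
  by (auto simp: subspace_def submodule_def vectorspace_def)

lemma subspace_dim_mono:
  assumes fd: "fin_dim" and A: "subspace K A V" and B: "subspace K B V" and le: "A \<subseteq> B"
  shows "vectorspace.dim K (vs A) \<le> vectorspace.dim K (vs B)"
    and "A \<noteq> B \<Longrightarrow> vectorspace.dim K (vs A) < vectorspace.dim K (vs B)"
proof -
  interpret B: vectorspace K "vs B" using B by (rule subspace_is_vs)
  have "B.fin_dim" using subspace_fin_dim(1)[OF fd B] .
  from B.subspace_fin_dim(2,3)[OF this subspace_of_subspace[OF A B le]]
  show "vectorspace.dim K (vs A) \<le> B.dim" "A \<noteq> B \<Longrightarrow> vectorspace.dim K (vs A) < B.dim"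
    by simp_all
qed

end

text \<open>
  Submodules of a product stand in for partially defined, multivalued homomorphisms.  Compared with
  functions they can be inverted, enlarged by a pair of elements and pushed forward without any
  question of being well defined.
\<close>
definition linear_relation ::
  "('r, 'q) ring_scheme \<Rightarrow> ('r, 'a, 'c) module_scheme \<Rightarrow> ('r, 'b, 'd) module_scheme \<Rightarrow> ('a \<times> 'b) set \<Rightarrow> bool"
  where "linear_relation R V W G \<longleftrightarrow> G \<subseteq> carrier V \<times> carrier W \<and> (\<zero>\<^bsub>V\<^esub>, \<zero>\<^bsub>W\<^esub>) \<in> G \<and>
    (\<forall>v w v' w'. (v, w) \<in> G \<longrightarrow> (v', w') \<in> G \<longrightarrow> (v \<oplus>\<^bsub>V\<^esub> v', w \<oplus>\<^bsub>W\<^esub> w') \<in> G) \<and>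
    (\<forall>r v w. r \<in> carrier R \<longrightarrow> (v, w) \<in> G \<longrightarrow> (r \<odot>\<^bsub>V\<^esub> v, r \<odot>\<^bsub>W\<^esub> w) \<in> G)"

lemma linear_relationD:
  assumes "linear_relation R V W G"
  shows "(v, w) \<in> G \<Longrightarrow> v \<in> carrier V" "(v, w) \<in> G \<Longrightarrow> w \<in> carrier W" "(\<zero>\<^bsub>V\<^esub>, \<zero>\<^bsub>W\<^esub>) \<in> G"
    "(v, w) \<in> G \<Longrightarrow> (v', w') \<in> G \<Longrightarrow> (v \<oplus>\<^bsub>V\<^esub> v', w \<oplus>\<^bsub>W\<^esub> w') \<in> G"
    "r \<in> carrier R \<Longrightarrow> (v, w) \<in> G \<Longrightarrow> (r \<odot>\<^bsub>V\<^esub> v, r \<odot>\<^bsub>W\<^esub> w) \<in> G"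
  using assms by (auto simp: linear_relation_def)

lemma linear_relation_converse: "linear_relation R W V (G\<inverse>) \<longleftrightarrow> linear_relation R V W G"
  unfolding linear_relation_def by (auto; blast)

lemma linear_relation_minus:
  assumes V: "Module.module R V" and W: "Module.module R W" and G: "linear_relation R V W G"
    and "(v, w) \<in> G" "(v', w') \<in> G"
  shows "(v \<ominus>\<^bsub>V\<^esub> v', w \<ominus>\<^bsub>W\<^esub> w') \<in> G"
proof -
  interpret V: Module.module R V by fact
  interpret W: Module.module R W by fact
  note D = linear_relationD[OF G]
  have "(\<ominus>\<^bsub>V\<^esub> v', \<ominus>\<^bsub>W\<^esub> w') \<in> G"
    using D(5)[of "\<ominus>\<^bsub>R\<^esub> \<one>\<^bsub>R\<^esub>", OF _ assms(5)] D(1,2)[OF assms(5)]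
    by (simp add: V.smult_l_minus W.smult_l_minus)
  from D(4)[OF assms(4) this] show ?thesis by (simp add: V.minus_eq W.minus_eq)
qed

text \<open>
  Additive multivaluedness is controlled at zero: two values of the same argument differ by a value
  of zero.
\<close>
lemma linear_relation_function:
  assumes V: "Module.module R V" and W: "Module.module R W" and G: "linear_relation R V W G"
    and total: "Domain G = carrier V" and single: "\<And>w. (\<zero>\<^bsub>V\<^esub>, w) \<in> G \<Longrightarrow> w = \<zero>\<^bsub>W\<^esub>"
  obtains f where "f \<in> module_hom R V W" "G = {(v, f v) | v. v \<in> carrier V}"
proof -
  interpret V: Module.module R V by fact
  interpret W: Module.module R W by fact
  note D = linear_relationD[OF G]
  have uniq: "w = w'" if "(v, w) \<in> G" "(v, w') \<in> G" for v w w'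
  proof -
    have "(v \<ominus>\<^bsub>V\<^esub> v, w \<ominus>\<^bsub>W\<^esub> w') \<in> G" using linear_relation_minus[OF V W G that] .
    then have "w \<ominus>\<^bsub>W\<^esub> w' = \<zero>\<^bsub>W\<^esub>" using single D(1)[OF that(1)] by (simp add: V.r_neg V.minus_eq)
    then show ?thesis using D(2)[OF that(1)] D(2)[OF that(2)]
      by (metis W.add.inv_closed W.add.inv_equality W.minus_eq W.minus_minus)
  qed
  define f where "f v = (SOME w. (v, w) \<in> G)" for v
  have f: "(v, f v) \<in> G" if "v \<in> carrier V" for v
    unfolding f_def by (rule someI_ex) (use that total in auto)
  have f_eq: "f v = w" if "(v, w) \<in> G" for v w
    using uniq[OF f that] D(1)[OF that] by simp
  show thesis
  proof
    show "G = {(v, f v) | v. v \<in> carrier V}" using D(1) f f_eq by auto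
    show "f \<in> module_hom R V W" unfolding module_hom_def
      using D(2)[OF f] f_eq[OF D(4)[OF f f]] f_eq[OF D(5)[OF _ f]] by auto
  qed
qed

lemma linear_relation_iso:
  assumes V: "Module.module R V" and W: "Module.module R W" and G: "linear_relation R V W G"
    and dom: "Domain G = carrier V" and ran: "Range G = carrier W"
    and zero: "\<And>v w. (v, w) \<in> G \<Longrightarrow> v = \<zero>\<^bsub>V\<^esub> \<longleftrightarrow> w = \<zero>\<^bsub>W\<^esub>"
  obtains f where "f \<in> module_hom R V W" "bij_betw f (carrier V) (carrier W)" "G = {(v, f v) | v. v \<in> carrier V}"
proof -
  have single: "w = \<zero>\<^bsub>W\<^esub>" if "(\<zero>\<^bsub>V\<^esub>, w) \<in> G" for w using zero[OF that] by simp
  obtain f where f: "f \<in> module_hom R V W" and Gf: "G = {(v, f v) | v. v \<in> carrier V}"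
    by (rule linear_relation_function[OF V W G dom single])
  have G': "linear_relation R W V (G\<inverse>)" using G by (simp add: linear_relation_converse)
  have dom': "Domain (G\<inverse>) = carrier W" using ran by simp
  have single': "v = \<zero>\<^bsub>V\<^esub>" if "(\<zero>\<^bsub>W\<^esub>, v) \<in> G\<inverse>" for v using zero[of v "\<zero>\<^bsub>W\<^esub>"] that by simp
  obtain g where g: "g \<in> module_hom R W V" and Gg: "G\<inverse> = {(w, g w) | w. w \<in> carrier W}"
    by (rule linear_relation_function[OF W V G' dom' single'])
  have fc: "f v \<in> carrier W" if "v \<in> carrier V" for v using f that by (auto simp: module_hom_def)
  have gc: "g w \<in> carrier V" if "w \<in> carrier W" for w using g that by (auto simp: module_hom_def)
  have gf: "g (f v) = v" if "v \<in> carrier V" for v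
  proof -
    have "(f v, v) \<in> G\<inverse>" using that unfolding Gf by auto
    then show ?thesis unfolding Gg by auto
  qed
  have fg: "f (g w) = w" if "w \<in> carrier W" for w
  proof -
    have "(w, g w) \<in> G\<inverse>" using that unfolding Gg by auto
    then show ?thesis unfolding Gf by auto
  qed
  have "bij_betw f (carrier V) (carrier W)"
    by (rule bij_betw_byWitness[of _ g]) (use fc gc gf fg in auto)
  then show thesis using that f Gf by blast
qed

lemma linear_relation_dim_eq:
  assumes V: "vectorspace K V" and W: "vectorspace K W" and fd: "vectorspace.fin_dim K V"
    and G: "linear_relation K V W G" and dom: "Domain G = carrier V" and ran: "Range G = carrier W"
    and zero: "\<And>v w. (v, w) \<in> G \<Longrightarrow> v = \<zero>\<^bsub>V\<^esub> \<longleftrightarrow> w = \<zero>\<^bsub>W\<^esub>"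
  shows "vectorspace.dim K V = vectorspace.dim K W"
proof -
  interpret V: vectorspace K V by fact
  interpret W: vectorspace K W by fact
  obtain f where f: "f \<in> module_hom K V W" and bij: "bij_betw f (carrier V) (carrier W)"
    by (rule linear_relation_iso[OF V.module_axioms W.module_axioms G dom ran zero])
  interpret f: linear_map K V W f by unfold_locales (rule f)
  show ?thesis using f.dim_eq[OF fd] bij by (simp add: bij_betw_def)
qed

lemma subspace_Domain:
  assumes V: "vectorspace K V" and G: "linear_relation K V W G"
  shows "subspace K (Domain G) V"
proof -
  interpret V: vectorspace K V by fact
  from G show ?thesis unfolding subspace_def submodule_def linear_relation_def
    using V V.module_axioms by (auto; blast)
qed

lemma subspace_Range:
  assumes W: "vectorspace K W" and G: "linear_relation K V W G"
  shows "subspace K (Range G) W"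
  using subspace_Domain[OF W, of V "G\<inverse>"] G by (simp add: linear_relation_converse)

lemma subspace_Int:
  "subspace K A V \<Longrightarrow> subspace K B V \<Longrightarrow> subspace K (A \<inter> B) V"
  unfolding subspace_def submodule_def by auto

text \<open>
  Counting argument behind the extension of partial isomorphisms: if the relation reaches all of
  \<open>L'\<close>, then it restricts to an isomorphism from the part of \<open>L\<close> in its domain onto \<open>L'\<close>; as \<open>L\<close>
  and \<open>L'\<close> have the same dimension, that part is all of \<open>L\<close>.
\<close>
lemma filtered_relation_domain:
  assumes V: "vectorspace K V" and W: "vectorspace K W"
    and fd: "vectorspace.fin_dim K V"
    and L: "subspace K L V" and L': "subspace K L' W"
    and dim: "vectorspace.dim K (V\<lparr>carrier := L\<rparr>) = vectorspace.dim K (W\<lparr>carrier := L'\<rparr>)"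
    and G: "linear_relation K V W G"
    and resp: "\<And>v w. (v, w) \<in> G \<Longrightarrow> v \<in> L \<longleftrightarrow> w \<in> L'"
    and zero: "\<And>v w. (v, w) \<in> G \<Longrightarrow> v = \<zero>\<^bsub>V\<^esub> \<longleftrightarrow> w = \<zero>\<^bsub>W\<^esub>"
    and ran: "L' \<subseteq> Range G"
  shows "L \<subseteq> Domain G"
proof -
  interpret V: vectorspace K V by fact
  interpret W: vectorspace K W by fact
  let ?A = "Domain G \<inter> L"
  have A: "subspace K ?A V" using subspace_Int[OF subspace_Domain[OF V G] L] .
  note D = linear_relationD[OF G]
  interpret A: vectorspace K "V.vs ?A" using A by (rule V.subspace_is_vs)
  interpret L': vectorspace K "W.vs L'" using L' by (rule W.subspace_is_vs)
  interpret sL: submodule K L V using L by simp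
  interpret sL': submodule K L' W using L' by simp
  have lin: "linear_relation K (V.vs ?A) (W.vs L') (G \<inter> L \<times> L')"
    unfolding linear_relation_def using D by auto
  have "vectorspace.dim K (V.vs ?A) = vectorspace.dim K (W.vs L')"
    by (rule linear_relation_dim_eq[OF A.vectorspace_axioms L'.vectorspace_axioms
          V.subspace_fin_dim(1)[OF fd A] lin])
      (use resp ran zero in \<open>auto 0 3\<close>)
  then have "?A = L" using V.subspace_dim_mono(2)[OF fd A L] dim by auto
  then show ?thesis by auto
qed

section \<open>Persistence modules over the natural numbers\<close>

lemma (in module) submodule_add_cancel:
  assumes "submodule R N M" "u \<in> N" "a \<in> carrier M"
  shows "a \<oplus>\<^bsub>M\<^esub> u \<in> N \<longleftrightarrow> a \<in> N"
proof -
  interpret submodule R N M by fact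
  have u: "u \<in> carrier M" using assms(2) subset by auto
  have "\<ominus>\<^bsub>R\<^esub> \<one> \<odot>\<^bsub>M\<^esub> u \<in> N" using assms(2) by (intro smult_closed) auto
  then have "\<ominus>\<^bsub>M\<^esub> u \<in> N" using u by (simp add: smult_l_minus)
  then have "a \<in> N" if "a \<oplus>\<^bsub>M\<^esub> u \<in> N"
    using m_closed[OF that, of "\<ominus>\<^bsub>M\<^esub> u"] assms u by (simp add: M.a_assoc M.r_neg)
  then show ?thesis using assms(2) by auto
qed

lemma (in vectorspace) subspace_smult_cancel:
  assumes "subspace K N V" "c \<in> carrier K" "c \<noteq> \<zero>\<^bsub>K\<^esub>" "x \<in> carrier V" "c \<odot>\<^bsub>V\<^esub> x \<in> N"
  shows "x \<in> N"
proof -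
  interpret submodule K N V using assms(1) by simp
  have "inv\<^bsub>K\<^esub> c \<in> carrier K" using assms(2,3) by (simp add: field_Units)
  from smult_closed[OF this assms(5)] show ?thesis
    using mult_inverse[OF assms(2,4) refl assms(3)] by simp
qed

lemma (in vectorspace) subspace_zero: "subspace K {\<zero>\<^bsub>V\<^esub>} V"
  using vectorspace_axioms module_axioms by (auto simp: subspace_def submodule_def)

text \<open>
  Two filtered spaces with levelwise equal dimensions are isomorphic, and the isomorphism can extend
  a given partial one.  A relation with largest possible domain does it: were some vector missing, the
  least level \<open>l\<close> that is not inside the domain would, by counting, also not be inside the range, and
  any two missing vectors of level \<open>l\<close> on either side could be related to each other.  All smaller
  levels lie in the domain and the range already, so this respects the whole filtration.
\<close>
lemma extend_filtered_relation:
  fixes L :: "'i::wellorder \<Rightarrow> 'a set" and L' :: "'i \<Rightarrow> 'b set"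
  assumes V: "vectorspace K V" and W: "vectorspace K W"
    and fdV: "vectorspace.fin_dim K V" and fdW: "vectorspace.fin_dim K W"
    and L: "\<And>i. subspace K (L i) V" "\<And>i j. i \<le> j \<Longrightarrow> L i \<subseteq> L j"
    and L': "\<And>i. subspace K (L' i) W" "\<And>i j. i \<le> j \<Longrightarrow> L' i \<subseteq> L' j"
    and dim: "\<And>i. vectorspace.dim K (V\<lparr>carrier := L i\<rparr>) = vectorspace.dim K (W\<lparr>carrier := L' i\<rparr>)"
    and bot: "L i\<^sub>0 = {\<zero>\<^bsub>V\<^esub>}" "L' i\<^sub>0 = {\<zero>\<^bsub>W\<^esub>}"
    and top: "L i\<^sub>1 = carrier V" "L' i\<^sub>1 = carrier W"
    and G: "linear_relation K V W G" "\<And>v w i. (v, w) \<in> G \<Longrightarrow> v \<in> L i \<longleftrightarrow> w \<in> L' i"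
  obtains H where "G \<subseteq> H" "linear_relation K V W H" "\<And>v w i. (v, w) \<in> H \<Longrightarrow> v \<in> L i \<longleftrightarrow> w \<in> L' i"
    "Domain H = carrier V" "Range H = carrier W"
proof -
  interpret V: vectorspace K V by fact
  interpret W: vectorspace K W by fact
  define good where "good H \<longleftrightarrow> G \<subseteq> H \<and> linear_relation K V W H \<and>
    (\<forall>v w i. (v, w) \<in> H \<longrightarrow> v \<in> L i \<longleftrightarrow> w \<in> L' i)" for H
  define size where "size H = vectorspace.dim K (V.vs (Domain H))" for H :: "('a \<times> 'b) set"
  have "good G" using G by (auto simp: good_def)
  moreover have "\<forall>H. good H \<longrightarrow> size H < Suc V.dim"
    using V.subspace_fin_dim(2)[OF fdV subspace_Domain[OF V]] by (auto simp: good_def size_def less_Suc_eq_le)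
  ultimately obtain H where H: "good H" and max: "\<And>H'. good H' \<Longrightarrow> size H' \<le> size H"
    using ex_has_greatest_nat[of good G size "Suc V.dim"] by auto
  have lin: "linear_relation K V W H" and resp: "\<And>v w i. (v, w) \<in> H \<Longrightarrow> v \<in> L i \<longleftrightarrow> w \<in> L' i"
    and GH: "G \<subseteq> H" using H by (auto simp: good_def)
  note D = linear_relationD[OF lin]
  have zero: "v = \<zero>\<^bsub>V\<^esub> \<longleftrightarrow> w = \<zero>\<^bsub>W\<^esub>" if "(v, w) \<in> H" for v w
    using resp[OF that, of i\<^sub>0] bot by simp
  have dom_ran: "L i \<subseteq> Domain H" if "L' i \<subseteq> Range H" for i
    using filtered_relation_domain[OF V W fdV L(1) L'(1) dim lin resp zero that] .
  have ran_dom: "L' i \<subseteq> Range H" if "L i \<subseteq> Domain H" for i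
    using filtered_relation_domain[OF W V fdW L'(1) L(1) dim[symmetric], of "H\<inverse>" i] that lin resp zero
    by (simp add: linear_relation_converse)
  have "carrier V \<subseteq> Domain H"
  proof (rule ccontr)
    assume "\<not> carrier V \<subseteq> Domain H"
    with top have ex: "\<not> L i\<^sub>1 \<subseteq> Domain H" by simp
    define l where "l = (LEAST i. \<not> L i \<subseteq> Domain H)"
    have l: "\<not> L l \<subseteq> Domain H" unfolding l_def by (rule LeastI[of _ i\<^sub>1]) (rule ex)
    have less_l: "L i \<subseteq> Domain H" if "i < l" for i
      using not_less_Least[of i "\<lambda>i. \<not> L i \<subseteq> Domain H"] that by (simp add: l_def)
    from l obtain x where x: "x \<in> L l" "x \<notin> Domain H" by auto
    from l dom_ran[of l] obtain y where y: "y \<in> L' l" "y \<notin> Range H" by auto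
    have sub: "submodule K (L i) V" "submodule K (L' i) W" for i
      using L(1) L'(1) by simp_all
    have xV: "x \<in> carrier V" using submodule.subset[OF sub(1)] x by blast
    have yW: "y \<in> carrier W" using submodule.subset[OF sub(2)] y by blast
    define H' where "H' = {(v \<oplus>\<^bsub>V\<^esub> c \<odot>\<^bsub>V\<^esub> x, w \<oplus>\<^bsub>W\<^esub> c \<odot>\<^bsub>W\<^esub> y) | v w c. (v, w) \<in> H \<and> c \<in> carrier K}"
    have HH': "H \<subseteq> H'"
    proof
      fix p assume "p \<in> H"
      then show "p \<in> H'" unfolding H'_def using D(1,2) xV yW
        by (cases p) (auto intro!: exI[of _ "\<zero>\<^bsub>K\<^esub>"] exI[of _ "fst p"] exI[of _ "snd p"])
    qed
    have xy: "(x, y) \<in> H'" unfolding H'_def using D(3) xV yW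
      by (auto intro!: exI[of _ "\<one>\<^bsub>K\<^esub>"] exI[of _ "\<zero>\<^bsub>V\<^esub>"] exI[of _ "\<zero>\<^bsub>W\<^esub>"])
    have lin': "linear_relation K V W H'"
      unfolding linear_relation_def
    proof (intro conjI allI impI)
      show "H' \<subseteq> carrier V \<times> carrier W" unfolding H'_def using D(1,2) xV yW by auto
      show "(\<zero>\<^bsub>V\<^esub>, \<zero>\<^bsub>W\<^esub>) \<in> H'" using HH' D(3) by auto
    next
      fix v w v' w' assume "(v, w) \<in> H'" "(v', w') \<in> H'"
      then obtain a b c a' b' c' where *: "(a, b) \<in> H" "c \<in> carrier K" "(a', b') \<in> H" "c' \<in> carrier K"
        and eq: "v = a \<oplus>\<^bsub>V\<^esub> c \<odot>\<^bsub>V\<^esub> x" "w = b \<oplus>\<^bsub>W\<^esub> c \<odot>\<^bsub>W\<^esub> y"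
          "v' = a' \<oplus>\<^bsub>V\<^esub> c' \<odot>\<^bsub>V\<^esub> x" "w' = b' \<oplus>\<^bsub>W\<^esub> c' \<odot>\<^bsub>W\<^esub> y"
        unfolding H'_def by blast
      have "v \<oplus>\<^bsub>V\<^esub> v' = (a \<oplus>\<^bsub>V\<^esub> a') \<oplus>\<^bsub>V\<^esub> (c \<oplus>\<^bsub>K\<^esub> c') \<odot>\<^bsub>V\<^esub> x"
        unfolding eq using * D(1,2) xV by (simp add: V.smult_l_distr V.a_ac)
      moreover have "w \<oplus>\<^bsub>W\<^esub> w' = (b \<oplus>\<^bsub>W\<^esub> b') \<oplus>\<^bsub>W\<^esub> (c \<oplus>\<^bsub>K\<^esub> c') \<odot>\<^bsub>W\<^esub> y"
        unfolding eq using * D(1,2) yW by (simp add: W.smult_l_distr W.a_ac)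
      moreover have "c \<oplus>\<^bsub>K\<^esub> c' \<in> carrier K" using * by simp
      ultimately show "(v \<oplus>\<^bsub>V\<^esub> v', w \<oplus>\<^bsub>W\<^esub> w') \<in> H'"
        unfolding H'_def using D(4)[OF *(1,3)] by blast
    next
      fix r v w assume r: "r \<in> carrier K" and "(v, w) \<in> H'"
      then obtain a b c where *: "(a, b) \<in> H" "c \<in> carrier K"
        and eq: "v = a \<oplus>\<^bsub>V\<^esub> c \<odot>\<^bsub>V\<^esub> x" "w = b \<oplus>\<^bsub>W\<^esub> c \<odot>\<^bsub>W\<^esub> y"
        unfolding H'_def by blast
      have "r \<odot>\<^bsub>V\<^esub> v = r \<odot>\<^bsub>V\<^esub> a \<oplus>\<^bsub>V\<^esub> (r \<otimes>\<^bsub>K\<^esub> c) \<odot>\<^bsub>V\<^esub> x"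
        unfolding eq using * r D(1,2) xV by (simp add: V.smult_r_distr V.smult_assoc1)
      moreover have "r \<odot>\<^bsub>W\<^esub> w = r \<odot>\<^bsub>W\<^esub> b \<oplus>\<^bsub>W\<^esub> (r \<otimes>\<^bsub>K\<^esub> c) \<odot>\<^bsub>W\<^esub> y"
        unfolding eq using * r D(1,2) yW by (simp add: W.smult_r_distr W.smult_assoc1)
      moreover have "r \<otimes>\<^bsub>K\<^esub> c \<in> carrier K" using * r by simp
      ultimately show "(r \<odot>\<^bsub>V\<^esub> v, r \<odot>\<^bsub>W\<^esub> w) \<in> H'"
        unfolding H'_def using D(5)[OF r *(1)] by blast
    qed
    have resp': "v \<in> L i \<longleftrightarrow> w \<in> L' i" if "(v, w) \<in> H'" for v w i
    proof -
      from that obtain a b c where *: "(a, b) \<in> H" "c \<in> carrier K"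
        and eq: "v = a \<oplus>\<^bsub>V\<^esub> c \<odot>\<^bsub>V\<^esub> x" "w = b \<oplus>\<^bsub>W\<^esub> c \<odot>\<^bsub>W\<^esub> y"
        unfolding H'_def by blast
      note ab = D(1,2)[OF *(1)]
      show ?thesis
      proof (cases "c = \<zero>\<^bsub>K\<^esub> \<or> l \<le> i")
        case True
        have "c \<odot>\<^bsub>V\<^esub> x \<in> L i"
          using True L(2)[of l i] x(1) *(2) xV submodule.smult_closed[OF sub(1)] submodule.zero_closed[OF sub(1)] by auto
        moreover have "c \<odot>\<^bsub>W\<^esub> y \<in> L' i"
          using True L'(2)[of l i] y(1) *(2) yW submodule.smult_closed[OF sub(2)] submodule.zero_closed[OF sub(2)] by auto
        ultimately show ?thesis unfolding eq
          using V.submodule_add_cancel[OF sub(1)] W.submodule_add_cancel[OF sub(2)] ab resp[OF *(1)] by simp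
      next
        case False
        \<comment> \<open>Below level \<open>l\<close> nothing new may appear: \<open>v\<close> and \<open>w\<close> involve the new vectors
          with a nonzero coefficient, hence lie outside the domain and range of \<open>H\<close>.\<close>
        have "v \<notin> Domain H"
        proof
          assume "v \<in> Domain H"
          then have "c \<odot>\<^bsub>V\<^esub> x \<in> Domain H" unfolding eq
            using V.submodule_add_cancel[OF V.is_module[OF subspace_Domain[OF V lin]], of a "c \<odot>\<^bsub>V\<^esub> x"] *
              ab xV by (auto simp: V.a_comm)
          then show False using V.subspace_smult_cancel[OF subspace_Domain[OF V lin] *(2) _ xV] False x(2) by simp
        qed
        moreover have "w \<notin> Range H"
        proof
          assume "w \<in> Range H"
          then have "c \<odot>\<^bsub>W\<^esub> y \<in> Range H" unfolding eq
            using W.submodule_add_cancel[OF W.is_module[OF subspace_Range[OF W lin]], of b "c \<odot>\<^bsub>W\<^esub> y"] *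
              ab yW by (auto simp: W.a_comm)
          then show False using W.subspace_smult_cancel[OF subspace_Range[OF W lin] *(2) _ yW] False y(2) by simp
        qed
        ultimately show ?thesis using less_l[of i] ran_dom[of i] False by (auto simp: not_le)
      qed
    qed
    have "good H'" using GH HH' lin' resp' by (auto simp: good_def)
    from max[OF this] have "size H' \<le> size H" .
    moreover have "size H < size H'" unfolding size_def
      by (rule V.subspace_dim_mono(2)[OF fdV subspace_Domain[OF V lin] subspace_Domain[OF V lin']])
        (use HH' x(2) xy in auto)
    ultimately show False by simp
  qed
  then have dom: "Domain H = carrier V" using D(1) by auto
  moreover from dom ran_dom[of i\<^sub>1] top have "Range H = carrier W" using D(2) by auto
  ultimately show thesis using that[of H] GH lin resp by blast
qed

text \<open>
  The classification of pointwise finite-dimensional persistence modules by their ranks, with the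
  isomorphism given as one relation in each degree and built degree by degree.  The space in degree \<open>j\<close> is filtered by the kernels \<open>L j (enat r)\<close> of the maps into degree
  \<open>j + r\<close>, completed by the whole space at level \<open>\<infinity>\<close>; by rank and nullity the dimensions are
  determined by the ranks.  An isomorphism respecting these filtrations is pushed forward to the image
  in the next degree, where it again respects the kernels, and is then extended to the whole space.
\<close>
lemma persistence_relations:
  fixes V :: "nat \<Rightarrow> ('r, 'a, 'c) module_scheme" and W :: "nat \<Rightarrow> ('r, 'b, 'd) module_scheme"
  assumes V: "\<And>j. vectorspace K (V j)" "\<And>j. vectorspace.fin_dim K (V j)"
    and W: "\<And>j. vectorspace K (W j)" "\<And>j. vectorspace.fin_dim K (W j)"
    and T: "\<And>j l. j \<le> l \<Longrightarrow> T j l \<in> module_hom K (V j) (V l)"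
      "\<And>j v. v \<in> carrier (V j) \<Longrightarrow> T j j v = v"
      "\<And>j l m v. j \<le> l \<Longrightarrow> l \<le> m \<Longrightarrow> v \<in> carrier (V j) \<Longrightarrow> T l m (T j l v) = T j m v"
    and S: "\<And>j l. j \<le> l \<Longrightarrow> S j l \<in> module_hom K (W j) (W l)"
      "\<And>j w. w \<in> carrier (W j) \<Longrightarrow> S j j w = w"
      "\<And>j l m w. j \<le> l \<Longrightarrow> l \<le> m \<Longrightarrow> w \<in> carrier (W j) \<Longrightarrow> S l m (S j l w) = S j m w"
    and rank: "\<And>j l. j \<le> l \<Longrightarrow>
      vectorspace.dim K ((V l)\<lparr>carrier := T j l ` carrier (V j)\<rparr>) =
      vectorspace.dim K ((W l)\<lparr>carrier := S j l ` carrier (W j)\<rparr>)"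
  obtains G where "\<And>j. linear_relation K (V j) (W j) (G j)"
    "\<And>j. Domain (G j) = carrier (V j)" "\<And>j. Range (G j) = carrier (W j)"
    "\<And>j v w. (v, w) \<in> G j \<Longrightarrow> v = \<zero>\<^bsub>V j\<^esub> \<longleftrightarrow> w = \<zero>\<^bsub>W j\<^esub>"
    "\<And>j l v w. j \<le> l \<Longrightarrow> (v, w) \<in> G j \<Longrightarrow> (T j l v, S j l w) \<in> G l"
proof -
  define L where "L j i = (case i of enat r \<Rightarrow> {v \<in> carrier (V j). T j (j + r) v = \<zero>\<^bsub>V (j + r)\<^esub>} | \<infinity> \<Rightarrow> carrier (V j))" for j i
  define L' where "L' j i = (case i of enat r \<Rightarrow> {w \<in> carrier (W j). S j (j + r) w = \<zero>\<^bsub>W (j + r)\<^esub>} | \<infinity> \<Rightarrow> carrier (W j))" for j i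
  have lmT: "linear_map K (V j) (V l) (T j l)" if "j \<le> l" for j l
    using V(1) T(1)[OF that] by (simp add: linear_map_def mod_hom_def mod_hom_axioms_def vectorspace_def)
  have lmS: "linear_map K (W j) (W l) (S j l)" if "j \<le> l" for j l
    using W(1) S(1)[OF that] by (simp add: linear_map_def mod_hom_def mod_hom_axioms_def vectorspace_def)
  have kerT: "L j (enat r) = mod_hom.ker (V j) (V (j + r)) (T j (j + r))" for j r
    using mod_hom.ker_def[OF linear_map.axioms(3)[OF lmT[of j "j + r"]]] by (simp add: L_def)
  have kerS: "L' j (enat r) = mod_hom.ker (W j) (W (j + r)) (S j (j + r))" for j r
    using mod_hom.ker_def[OF linear_map.axioms(3)[OF lmS[of j "j + r"]]] by (simp add: L'_def)
  have self: "subspace K (carrier U) U" if "vectorspace K U" for U :: "('r, 'x, 'y) module_scheme"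
  proof -
    interpret vectorspace K U by fact
    show ?thesis using that module_axioms by (simp add: subspace_def submodule_def)
  qed
  have sub: "subspace K (L j i) (V j)" "subspace K (L' j i) (W j)" for j i
    using linear_map.kerT_is_subspace[OF lmT[of j]] linear_map.kerT_is_subspace[OF lmS[of j]]
      self[OF V(1)] self[OF W(1)] by (cases i; simp add: kerT kerS; simp add: L_def L'_def)+
  have mono: "L j i \<subseteq> L j i'" "L' j i \<subseteq> L' j i'" if "i \<le> i'" for j i i'
  proof -
    have "T j (j + r') v = \<zero>\<^bsub>V (j + r')\<^esub>"
      if "r \<le> r'" "v \<in> carrier (V j)" "T j (j + r) v = \<zero>\<^bsub>V (j + r)\<^esub>" for r r' v
      using T(3)[of j "j + r" "j + r'" v] linear_map.T0_is_0[OF lmT[of "j + r" "j + r'"]] that by simp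
    moreover have "S j (j + r') w = \<zero>\<^bsub>W (j + r')\<^esub>"
      if "r \<le> r'" "w \<in> carrier (W j)" "S j (j + r) w = \<zero>\<^bsub>W (j + r)\<^esub>" for r r' w
      using S(3)[of j "j + r" "j + r'" w] linear_map.T0_is_0[OF lmS[of "j + r" "j + r'"]] that by simp
    ultimately show "L j i \<subseteq> L j i'" "L' j i \<subseteq> L' j i'"
      using that by (cases i; cases i'; auto simp: L_def L'_def)+
  qed
  have idim: "T j j ` carrier (V j) = carrier (V j)" "S j j ` carrier (W j) = carrier (W j)" for j
    using T(2) S(2) by force+
  have dimVW: "vectorspace.dim K (V j) = vectorspace.dim K (W j)" for j
    using rank[of j j] by (simp add: idim)
  have dim: "vectorspace.dim K ((V j)\<lparr>carrier := L j i\<rparr>) = vectorspace.dim K ((W j)\<lparr>carrier := L' j i\<rparr>)" for j i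
  proof (cases i)
    case infinity then show ?thesis using dimVW by (simp add: L_def L'_def)
  next
    case (enat r)
    interpret f: linear_map K "V j" "V (j + r)" "T j (j + r)" by (rule lmT) simp
    interpret g: linear_map K "W j" "W (j + r)" "S j (j + r)" by (rule lmS) simp
    show ?thesis using f.rank_nullity[OF V(2)] g.rank_nullity[OF W(2)] dimVW[of j] rank[of j "j + r"]
      by (simp add: enat kerT kerS f.im_def g.im_def)
  qed
  have bot: "L j (enat 0) = {\<zero>\<^bsub>V j\<^esub>}" "L' j (enat 0) = {\<zero>\<^bsub>W j\<^esub>}" for j
  proof -
    interpret V: vectorspace K "V j" by (rule V)
    interpret W: vectorspace K "W j" by (rule W)
    show "L j (enat 0) = {\<zero>\<^bsub>V j\<^esub>}" "L' j (enat 0) = {\<zero>\<^bsub>W j\<^esub>}"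
      by (auto simp: L_def L'_def T(2) S(2))
  qed
  have top: "L j \<infinity> = carrier (V j)" "L' j \<infinity> = carrier (W j)" for j
    by (simp_all add: L_def L'_def)
  define resp where "resp j G \<longleftrightarrow> linear_relation K (V j) (W j) G \<and>
    (\<forall>v w i. (v, w) \<in> G \<longrightarrow> v \<in> L j i \<longleftrightarrow> w \<in> L' j i)" for j G
  have extend: "\<exists>H. G \<subseteq> H \<and> resp j H \<and> Domain H = carrier (V j) \<and> Range H = carrier (W j)"
    if G: "resp j G" for j G
  proof -
    have G': "linear_relation K (V j) (W j) G" "\<And>v w i. (v, w) \<in> G \<Longrightarrow> v \<in> L j i \<longleftrightarrow> w \<in> L' j i"
      using G by (auto simp: resp_def)
    show ?thesis
    proof (rule extend_filtered_relation[OF V(1) W(1) V(2) W(2) sub(1) mono(1) sub(2) mono(2) dim bot top G'])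
      fix H assume "G \<subseteq> H" "linear_relation K (V j) (W j) H" "Domain H = carrier (V j)" "Range H = carrier (W j)"
        "\<And>v w i. (v, w) \<in> H \<Longrightarrow> v \<in> L j i \<longleftrightarrow> w \<in> L' j i"
      then show ?thesis by (intro exI[of _ H]) (simp add: resp_def)
    qed
  qed
  define P where "P j G \<longleftrightarrow> resp j G \<and> Domain G = carrier (V j) \<and> Range G = carrier (W j)" for j G
  have "\<exists>G. P 0 G"
  proof -
    interpret V: vectorspace K "V 0" by (rule V)
    interpret W: vectorspace K "W 0" by (rule W)
    have z: "\<zero>\<^bsub>V 0\<^esub> \<in> L 0 i" "\<zero>\<^bsub>W 0\<^esub> \<in> L' 0 i" for i
      using mono[of "enat 0" i 0] bot[of 0] by (auto simp: zero_enat_def[symmetric])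
    have "resp 0 {(\<zero>\<^bsub>V 0\<^esub>, \<zero>\<^bsub>W 0\<^esub>)}" using z by (simp add: resp_def linear_relation_def)
    from extend[OF this] show ?thesis by (auto simp: P_def)
  qed
  moreover have "\<exists>H. P (Suc j) H \<and> (\<forall>v w. (v, w) \<in> G \<longrightarrow> (T j (Suc j) v, S j (Suc j) w) \<in> H)"
    if "P j G" for j G
  proof -
    from that have lin: "linear_relation K (V j) (W j) G" and r: "\<And>v w i. (v, w) \<in> G \<Longrightarrow> v \<in> L j i \<longleftrightarrow> w \<in> L' j i"
      by (auto simp: P_def resp_def)
    note D = linear_relationD[OF lin]
    interpret f: linear_map K "V j" "V (Suc j)" "T j (Suc j)" by (rule lmT) simp
    interpret g: linear_map K "W j" "W (Suc j)" "S j (Suc j)" by (rule lmS) simp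
    let ?f = "T j (Suc j)" and ?g = "S j (Suc j)"
    define G' where "G' = {(?f v, ?g w) | v w. (v, w) \<in> G}"
    have G'I: "(?f v, ?g w) \<in> G'" if "(v, w) \<in> G" for v w using that by (auto simp: G'_def)
    have "linear_relation K (V (Suc j)) (W (Suc j)) G'"
      unfolding linear_relation_def
    proof (intro conjI allI impI)
      show "G' \<subseteq> carrier (V (Suc j)) \<times> carrier (W (Suc j))" using D(1,2) by (auto simp: G'_def)
      show "(\<zero>\<^bsub>V (Suc j)\<^esub>, \<zero>\<^bsub>W (Suc j)\<^esub>) \<in> G'" using G'I[OF D(3)] by simp
    next
      fix v w v' w' assume "(v, w) \<in> G'" "(v', w') \<in> G'"
      then obtain a b a' b' where *: "(a, b) \<in> G" "(a', b') \<in> G" "v = ?f a" "w = ?g b" "v' = ?f a'" "w' = ?g b'"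
        by (auto simp: G'_def)
      show "(v \<oplus>\<^bsub>V (Suc j)\<^esub> v', w \<oplus>\<^bsub>W (Suc j)\<^esub> w') \<in> G'"
        using G'I[OF D(4)[OF *(1,2)]] D(1,2)[OF *(1)] D(1,2)[OF *(2)] * by simp
    next
      fix c v w assume c: "c \<in> carrier K" "(v, w) \<in> G'"
      then obtain a b where *: "(a, b) \<in> G" "v = ?f a" "w = ?g b" by (auto simp: G'_def)
      show "(c \<odot>\<^bsub>V (Suc j)\<^esub> v, c \<odot>\<^bsub>W (Suc j)\<^esub> w) \<in> G'"
        using G'I[OF D(5)[OF c(1) *(1)]] D(1,2)[OF *(1)] c * by simp
    qed
    moreover have "T j (Suc j) a \<in> L (Suc j) i \<longleftrightarrow> S j (Suc j) b \<in> L' (Suc j) i" if ab: "(a, b) \<in> G" for a b i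
    proof (cases i)
      case infinity
      then show ?thesis using D(1,2)[OF ab] by (simp add: L_def L'_def)
    next
      case (enat r)
      \<comment> \<open>Level \<open>r\<close> in degree \<open>j + 1\<close> pulls back to level \<open>r + 1\<close> in degree \<open>j\<close>.\<close>
      have "T j (Suc j) a \<in> L (Suc j) i \<longleftrightarrow> a \<in> L j (enat (Suc r))"
        using D(1)[OF ab] T(3)[of j "Suc j" "Suc j + r" a] by (simp add: enat L_def)
      moreover have "S j (Suc j) b \<in> L' (Suc j) i \<longleftrightarrow> b \<in> L' j (enat (Suc r))"
        using D(2)[OF ab] S(3)[of j "Suc j" "Suc j + r" b] by (simp add: enat L'_def)
      ultimately show ?thesis using r[OF ab] by simp
    qed
    ultimately have "resp (Suc j) G'" unfolding resp_def by (auto simp: G'_def)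
    from extend[OF this] obtain H where H: "G' \<subseteq> H" "P (Suc j) H" unfolding P_def by blast
    then show ?thesis using G'I by (intro exI[of _ H]) blast
  qed
  ultimately obtain G where G: "\<And>j. P j (G j)"
    and step: "\<And>j v w. (v, w) \<in> G j \<Longrightarrow> (T j (Suc j) v, S j (Suc j) w) \<in> G (Suc j)"
    using dependent_nat_choice[where P = P and Q = "\<lambda>j G H. \<forall>v w. (v, w) \<in> G \<longrightarrow> (T j (Suc j) v, S j (Suc j) w) \<in> H"]
    by metis
  have lin: "linear_relation K (V j) (W j) (G j)" for j using G[of j] by (simp add: P_def resp_def)
  have "(T j l v, S j l w) \<in> G l" if "j \<le> l" "(v, w) \<in> G j" for j l v w
    using that(1)
  proof (induction l rule: dec_induct)
    case base
    show ?case using that(2) T(2) S(2) linear_relationD(1,2)[OF lin that(2)] by simp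
  next
    case (step n)
    then show ?case using \<open>\<And>j v w. (v, w) \<in> G j \<Longrightarrow> (T j (Suc j) v, S j (Suc j) w) \<in> G (Suc j)\<close>[OF step.IH]
        T(3)[of j n "Suc n" v] S(3)[of j n "Suc n" w] linear_relationD(1,2)[OF lin that(2)] by simp
  qed
  moreover have "v = \<zero>\<^bsub>V j\<^esub> \<longleftrightarrow> w = \<zero>\<^bsub>W j\<^esub>" if "(v, w) \<in> G j" for j v w
  proof -
    have "v \<in> L j (enat 0) \<longleftrightarrow> w \<in> L' j (enat 0)" using G[of j] that unfolding P_def resp_def by blast
    then show ?thesis by (simp add: bot)
  qed
  moreover have "Domain (G j) = carrier (V j)" "Range (G j) = carrier (W j)" for j
    using G[of j] by (simp_all add: P_def)
  ultimately show thesis using that[of G] lin by blast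
qed

section \<open>Homogeneous parts of a graded module\<close>

lemma single_loc_ring: "e \<in> degs \<sigma> \<Longrightarrow> Poly_Mapping.single e c \<in> carrier (loc_ring \<sigma>)"
  by (auto simp: loc_ring_def)

lemma loc_ring_simps [simp]:
  "\<zero>\<^bsub>loc_ring \<sigma>\<^esub> = 0" "\<one>\<^bsub>loc_ring \<sigma>\<^esub> = 1" "r \<oplus>\<^bsub>loc_ring \<sigma>\<^esub> s = r + s" "r \<otimes>\<^bsub>loc_ring \<sigma>\<^esub> s = r * s"
  by (simp_all add: loc_ring_def)

lemma loc_ring_mono: "\<sigma> \<subseteq> \<tau> \<Longrightarrow> carrier (loc_ring \<sigma>) \<subseteq> carrier (loc_ring \<tau>)"
  by (auto simp: loc_ring_def degs_def)

lemma one_loc_ring: "1 \<in> carrier (loc_ring \<sigma>)"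
  using single_loc_ring[OF zero_degs, where c = 1] by simp

lemma loc_ring_induct [consumes 1, case_names zero single add]:
  fixes r :: "('k::field, 'm::finite) laurent"
  assumes r: "r \<in> carrier (loc_ring \<sigma>)" and zero: "P 0"
    and single: "\<And>e c. e \<in> degs \<sigma> \<Longrightarrow> P (Poly_Mapping.single e c)"
    and add: "\<And>r s. r \<in> carrier (loc_ring \<sigma>) \<Longrightarrow> s \<in> carrier (loc_ring \<sigma>) \<Longrightarrow> P r \<Longrightarrow> P s \<Longrightarrow> P (r + s)"
  shows "P r"
proof -
  have "P r" if "finite I" "Poly_Mapping.keys r \<subseteq> I" "I \<subseteq> degs \<sigma>" for I and r :: "('k, 'm) laurent"
    using that
  proof (induction I arbitrary: r rule: finite_induct)
    case empty
    then show ?case using zero by simp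
  next
    case (insert k I)
    let ?s = "r - Poly_Mapping.single k (Poly_Mapping.lookup r k)"
    have keys: "Poly_Mapping.keys ?s \<subseteq> I"
    proof
      fix x assume "x \<in> Poly_Mapping.keys ?s"
      then have "Poly_Mapping.lookup r x \<noteq> (Poly_Mapping.lookup r k when k = x)"
        by (simp add: in_keys_iff lookup_minus lookup_single)
      then have "x \<noteq> k" "x \<in> Poly_Mapping.keys r" by (auto simp: in_keys_iff when_def split: if_splits)
      then show "x \<in> I" using insert.prems by auto
    qed
    have "P (?s + Poly_Mapping.single k (Poly_Mapping.lookup r k))"
      using keys insert by (intro add single insert.IH) (auto simp: loc_ring_def)
    then show ?case by simp
  qed
  from this[OF finite_keys[of r] order_refl] r show ?thesis by (auto simp: loc_ring_def)
qed

abbreviation mon :: "int ^ 'm \<Rightarrow> ('k::field, 'm::finite) laurent"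
  where "mon e \<equiv> Poly_Mapping.single e 1"

definition proj ::
  "(int ^ 'm, ('k::field, 'm::finite) laurent, 'a) graded_module \<Rightarrow> int ^ 'm \<Rightarrow> 'a \<Rightarrow> 'a"
  where "proj M d x = (THE f. (\<forall>d. f d \<in> component M d) \<and> finite {d. f d \<noteq> \<zero>\<^bsub>M\<^esub>} \<and>
    x = finsum M f {d. f d \<noteq> \<zero>\<^bsub>M\<^esub>}) d"

context graded_loc_module
begin

lemma component_subgroup_all: "subgroup (component M d) (add_monoid M)"
proof (cases "d \<in> degs \<sigma>")
  case False
  then show ?thesis using component_outside[OF False] M.add.triv_subgroup by simp
qed (rule component_subgroup)

lemma component_closed: "x \<in> component M d \<Longrightarrow> x \<in> carrier M"
  using subgroup.subset[OF component_subgroup_all] by auto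

lemma component_zero: "\<zero>\<^bsub>M\<^esub> \<in> component M d"
  using subgroup.one_closed[OF component_subgroup_all] by simp

lemma component_add: "x \<in> component M d \<Longrightarrow> y \<in> component M d \<Longrightarrow> x \<oplus>\<^bsub>M\<^esub> y \<in> component M d"
  using subgroup.m_closed[OF component_subgroup_all, of x d y] by simp

lemma component_const: "x \<in> component M d \<Longrightarrow> Poly_Mapping.single 0 c \<odot>\<^bsub>M\<^esub> x \<in> component M d"
  using monomial_smult[OF zero_degs, of x d c] by simp

lemma single_smult_closed:
  "e \<in> degs \<sigma> \<Longrightarrow> x \<in> carrier M \<Longrightarrow> Poly_Mapping.single e c \<odot>\<^bsub>M\<^esub> x \<in> carrier M"
  by (simp add: single_loc_ring)

lemma single_smult_smult:
  assumes "a \<in> degs \<sigma>" "b \<in> degs \<sigma>" "x \<in> carrier M"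
  shows "Poly_Mapping.single a c \<odot>\<^bsub>M\<^esub> (Poly_Mapping.single b d \<odot>\<^bsub>M\<^esub> x) = Poly_Mapping.single (a + b) (c * d) \<odot>\<^bsub>M\<^esub> x"
  using smult_assoc1[OF single_loc_ring[OF assms(1), of c] single_loc_ring[OF assms(2), of d] assms(3)]
  by (simp add: mult_single)

lemma one_smult: "x \<in> carrier M \<Longrightarrow> 1 \<odot>\<^bsub>M\<^esub> x = x"
  using smult_one by simp

lemma add_smult:
  "r \<in> carrier (loc_ring \<sigma>) \<Longrightarrow> s \<in> carrier (loc_ring \<sigma>) \<Longrightarrow> x \<in> carrier M \<Longrightarrow>
    (r + s) \<odot>\<^bsub>M\<^esub> x = r \<odot>\<^bsub>M\<^esub> x \<oplus>\<^bsub>M\<^esub> s \<odot>\<^bsub>M\<^esub> x"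
  using smult_l_distr[of r s x] by simp

lemma mult_smult:
  "r \<in> carrier (loc_ring \<sigma>) \<Longrightarrow> s \<in> carrier (loc_ring \<sigma>) \<Longrightarrow> x \<in> carrier M \<Longrightarrow>
    (r * s) \<odot>\<^bsub>M\<^esub> x = r \<odot>\<^bsub>M\<^esub> (s \<odot>\<^bsub>M\<^esub> x)"
  using smult_assoc1[of r s x] by simp

lemma proj_props:
  assumes "x \<in> carrier M"
  shows "proj M d x \<in> component M d" "finite {d. proj M d x \<noteq> \<zero>\<^bsub>M\<^esub>}"
    "x = finsum M (\<lambda>d. proj M d x) {d. proj M d x \<noteq> \<zero>\<^bsub>M\<^esub>}"
proof -
  from theI'[OF decomposition[OF assms]]
  show "proj M d x \<in> component M d" "finite {d. proj M d x \<noteq> \<zero>\<^bsub>M\<^esub>}"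
    "x = finsum M (\<lambda>d. proj M d x) {d. proj M d x \<noteq> \<zero>\<^bsub>M\<^esub>}"
    unfolding proj_def by blast+
qed

lemma proj_eqI:
  assumes "\<And>d. f d \<in> component M d" "finite D" "\<And>d. d \<notin> D \<Longrightarrow> f d = \<zero>\<^bsub>M\<^esub>" "x = finsum M f D"
  shows "proj M d x = f d"
proof -
  have fc: "f \<in> UNIV \<rightarrow> carrier M" using assms(1) component_closed by auto
  have sub: "{d. f d \<noteq> \<zero>\<^bsub>M\<^esub>} \<subseteq> D" using assms(3) by auto
  have "finsum M f {d. f d \<noteq> \<zero>\<^bsub>M\<^esub>} = finsum M f D"
    by (rule M.add.finprod_mono_neutral_cong_left) (use sub assms(2) fc in auto)
  then have "(\<forall>d. f d \<in> component M d) \<and> finite {d. f d \<noteq> \<zero>\<^bsub>M\<^esub>} \<and> x = finsum M f {d. f d \<noteq> \<zero>\<^bsub>M\<^esub>}"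
    using assms finite_subset[OF sub] by simp
  moreover have "x \<in> carrier M" unfolding assms(4) by (rule M.finsum_closed) (use fc in auto)
  ultimately show ?thesis unfolding proj_def by (subst the1_equality[OF decomposition]) simp_all
qed

lemma proj_homogeneous:
  assumes "x \<in> component M d" shows "proj M d' x = (if d' = d then x else \<zero>\<^bsub>M\<^esub>)"
proof (rule proj_eqI[where D = "{d}"])
  show "x = (\<Oplus>\<^bsub>M\<^esub>d'\<in>{d}. if d' = d then x else \<zero>\<^bsub>M\<^esub>)"
    using component_closed[OF assms] by simp
qed (use assms component_zero in auto)

lemma proj_add:
  assumes "x \<in> carrier M" "y \<in> carrier M"
  shows "proj M d (x \<oplus>\<^bsub>M\<^esub> y) = proj M d x \<oplus>\<^bsub>M\<^esub> proj M d y"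
proof (rule proj_eqI)
  note x = proj_props[OF assms(1)] and y = proj_props[OF assms(2)]
  let ?D = "{d. proj M d x \<noteq> \<zero>\<^bsub>M\<^esub>} \<union> {d. proj M d y \<noteq> \<zero>\<^bsub>M\<^esub>}"
  have c: "(\<lambda>d. proj M d x) \<in> A \<rightarrow> carrier M" "(\<lambda>d. proj M d y) \<in> A \<rightarrow> carrier M" for A
    using x(1) y(1) component_closed by auto
  show "finite ?D" using x(2) y(2) by simp
  have "x = finsum M (\<lambda>d. proj M d x) ?D"
    by (subst x(3), rule M.add.finprod_mono_neutral_cong_left) (use x(2) y(2) c in auto)
  moreover have "y = finsum M (\<lambda>d. proj M d y) ?D"
    by (subst y(3), rule M.add.finprod_mono_neutral_cong_left) (use x(2) y(2) c in auto)
  ultimately show "x \<oplus>\<^bsub>M\<^esub> y = finsum M (\<lambda>d. proj M d x \<oplus>\<^bsub>M\<^esub> proj M d y) ?D"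
    by (subst M.finsum_addf[OF c]) simp
qed (use proj_props assms component_add in auto)

lemma proj_zero: "proj M d \<zero>\<^bsub>M\<^esub> = \<zero>\<^bsub>M\<^esub>"
  using proj_homogeneous[OF component_zero[of d], of d] by simp

lemma homogeneous_induct [consumes 1, case_names homogeneous zero add]:
  assumes x: "x \<in> carrier M" and hom: "\<And>d. P (proj M d x)" and zero: "P \<zero>\<^bsub>M\<^esub>"
    and add: "\<And>y z. y \<in> carrier M \<Longrightarrow> z \<in> carrier M \<Longrightarrow> P y \<Longrightarrow> P z \<Longrightarrow> P (y \<oplus>\<^bsub>M\<^esub> z)"
  shows "P x"
proof -
  have "P (finsum M (\<lambda>d. proj M d x) D)" if "finite D" for D
    using that
  proof (induction D rule: finite_induct)
    case (insert d D)
    have c: "(\<lambda>d. proj M d x) \<in> A \<rightarrow> carrier M" for A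
      using proj_props(1)[OF x] component_closed by auto
    then show ?case using insert hom by (subst M.finsum_insert) (auto intro!: add M.finsum_closed)
  qed (simp add: zero)
  from this[OF proj_props(2)[OF x]] show ?thesis using proj_props(3)[OF x] by simp
qed

lemma proj_single_smult:
  assumes e: "e \<in> degs \<sigma>" and x: "x \<in> carrier M"
  shows "proj M (d + e) (Poly_Mapping.single e c \<odot>\<^bsub>M\<^esub> x) = Poly_Mapping.single e c \<odot>\<^bsub>M\<^esub> proj M d x"
  using x
proof (induction x rule: homogeneous_induct)
  case (homogeneous d')
  have h: "proj M d' x \<in> component M d'" using proj_props(1)[OF x] .
  have "Poly_Mapping.single e c \<odot>\<^bsub>M\<^esub> \<zero>\<^bsub>M\<^esub> = \<zero>\<^bsub>M\<^esub>" using e by (simp add: single_loc_ring)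
  then show ?case using proj_homogeneous[OF h, of d] proj_homogeneous[OF monomial_smult[OF e h, of c], of "d + e"]
    by auto
next
  case zero
  then show ?case using e by (simp add: single_loc_ring proj_zero)
next
  case (add y z)
  have c: "proj M d y \<in> carrier M" "proj M d z \<in> carrier M" using proj_props(1) component_closed add by blast+
  show ?case using add c e by (simp add: proj_add smult_r_distr single_loc_ring)
qed

lemma component_space_simps [simp]:
  "carrier (component_space M d) = component M d" "\<zero>\<^bsub>component_space M d\<^esub> = \<zero>\<^bsub>M\<^esub>"
  "x \<oplus>\<^bsub>component_space M d\<^esub> y = x \<oplus>\<^bsub>M\<^esub> y"
  "c \<odot>\<^bsub>component_space M d\<^esub> x = Poly_Mapping.single 0 c \<odot>\<^bsub>M\<^esub> x"
  by (simp_all add: component_space_def)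

lemma vectorspace_component: "vectorspace base_field (component_space M d)"
proof (rule vs_criteria)
  show "Ring.field (base_field :: 'k ring)"
  proof -
    have "Group.comm_monoid (base_field :: 'k ring)"
      by (rule comm_monoidI) (auto simp: base_field_def)
    moreover have "abelian_group (base_field :: 'k ring)"
      by (rule abelian_groupI) (auto simp: base_field_def add.assoc intro: exI[of _ "- x" for x] add.left_inverse)
    ultimately have "cring (base_field :: 'k ring)"
      by (intro cringI) (auto simp: base_field_def algebra_simps)
    then show ?thesis
      by (intro cring.cring_fieldI2) (auto simp: base_field_def intro: exI[of _ "inverse a" for a] right_inverse)
  qed
  show "\<forall>v\<in>carrier (component_space M d). \<exists>neg_v\<in>carrier (component_space M d).
      v \<oplus>\<^bsub>component_space M d\<^esub> neg_v = \<zero>\<^bsub>component_space M d\<^esub>"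
  proof
    fix v assume v: "v \<in> carrier (component_space M d)"
    then have "\<ominus>\<^bsub>M\<^esub> v \<in> component M d"
      using subgroup.m_inv_closed[OF component_subgroup_all, of v d] by (simp add: a_inv_def)
    then show "\<exists>neg_v\<in>carrier (component_space M d). v \<oplus>\<^bsub>component_space M d\<^esub> neg_v = \<zero>\<^bsub>component_space M d\<^esub>"
      using v component_closed M.r_neg by auto
  qed
qed (use component_zero component_add component_const component_closed[of _ d] in
    \<open>auto simp: single_loc_ring base_field_def M.a_ac single_add add_smult smult_r_distr single_smult_smult
      zero_degs one_smult\<close>)

lemma single_module_hom:
  assumes "e \<in> degs \<sigma>" "d + e = d'"
  shows "(\<lambda>x. mon e \<odot>\<^bsub>M\<^esub> x) \<in> module_hom base_field (component_space M d) (component_space M d')"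
  using assms monomial_smult[OF assms(1)] component_closed[of _ d]
  by (auto simp: single_loc_ring zero_degs module_hom_def smult_r_distr single_smult_smult)

end

section \<open>Finitely generated graded modules in large degrees\<close>

text \<open>
  The last clause says that every element of degree \<open>b\<close> is a sum of monomial multiples, of degree
  \<open>b\<close>, of elements of \<open>B\<close>.  Phrased as an induction principle over sets \<open>S\<close> closed under addition,
  it yields surjectivity of multiplication maps and finite-dimensionality alike.
\<close>
definition homogeneous_generators ::
  "(int ^ 'm::finite, ('k::field, 'm) laurent, 'a) graded_module \<Rightarrow> ((int ^ 'm) \<times> 'a) set \<Rightarrow> bool"
  where "homogeneous_generators M B \<longleftrightarrow> finite B \<and> (\<forall>d g. (d, g) \<in> B \<longrightarrow> g \<in> component M d) \<and>
    (\<forall>b S. \<zero>\<^bsub>M\<^esub> \<in> S \<longrightarrow> (\<forall>x \<in> S. \<forall>y \<in> S. x \<oplus>\<^bsub>M\<^esub> y \<in> S) \<longrightarrow>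
      (\<forall>d g e c. (d, g) \<in> B \<longrightarrow> e \<in> degs {} \<longrightarrow> d + e = b \<longrightarrow> Poly_Mapping.single e c \<odot>\<^bsub>M\<^esub> g \<in> S) \<longrightarrow>
      component M b \<subseteq> S)"

lemma homogeneous_generatorsD:
  assumes "homogeneous_generators M B"
  shows "finite B" "(d, g) \<in> B \<Longrightarrow> g \<in> component M d"
    "\<zero>\<^bsub>M\<^esub> \<in> S \<Longrightarrow> (\<And>x y. x \<in> S \<Longrightarrow> y \<in> S \<Longrightarrow> x \<oplus>\<^bsub>M\<^esub> y \<in> S) \<Longrightarrow>
      (\<And>d g e c. (d, g) \<in> B \<Longrightarrow> e \<in> degs {} \<Longrightarrow> d + e = b \<Longrightarrow> Poly_Mapping.single e c \<odot>\<^bsub>M\<^esub> g \<in> S) \<Longrightarrow>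
      component M b \<subseteq> S"
  using assms unfolding homogeneous_generators_def by simp_all

text \<open>
  The nonzero homogeneous parts of finitely many generators.  The elements all of whose multiples
  have their part of degree \<open>b\<close> in \<open>S\<close> form a submodule, and it contains the generators.
\<close>
lemma homogeneous_generators_exist:
  fixes M :: "(int ^ 'm::finite, ('k::field, 'm) laurent, 'a) graded_module"
  assumes M: "graded_loc_module {} M" and fg: "finitely_generated {} M"
  obtains B where "homogeneous_generators M B"
proof -
  interpret graded_loc_module "{}" M by fact
  obtain A where A: "finite A" "A \<subseteq> carrier M" "span A = carrier M"
    using fg by (auto simp: finitely_generated_def)
  define B where "B = (\<Union>g\<in>A. (\<lambda>d. (d, proj M d g)) ` {d. proj M d g \<noteq> \<zero>\<^bsub>M\<^esub>})"
  have "finite B" unfolding B_def using A proj_props(2) by auto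
  moreover have "g \<in> component M d" if "(d, g) \<in> B" for d g
    using that proj_props(1) A(2) by (auto simp: B_def)
  moreover have "component M b \<subseteq> S"
    if zero: "\<zero>\<^bsub>M\<^esub> \<in> S" and add: "\<And>x y. x \<in> S \<Longrightarrow> y \<in> S \<Longrightarrow> x \<oplus>\<^bsub>M\<^esub> y \<in> S"
      and gen: "\<And>d g e c. (d, g) \<in> B \<Longrightarrow> e \<in> degs {} \<Longrightarrow> d + e = b \<Longrightarrow> Poly_Mapping.single e c \<odot>\<^bsub>M\<^esub> g \<in> S"
    for b S
  proof -
    note plus = add
    define T where "T = {x \<in> carrier M. \<forall>r \<in> carrier (loc_ring {}). proj M b (r \<odot>\<^bsub>M\<^esub> x) \<in> S}"
    have smz: "r \<odot>\<^bsub>M\<^esub> \<zero>\<^bsub>M\<^esub> = \<zero>\<^bsub>M\<^esub>" if "r \<in> carrier (loc_ring {})" for r using that by simp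
    have "submodule (loc_ring {}) T M"
    proof (rule submodule.intro)
      show "\<And>v w. v \<in> T \<Longrightarrow> w \<in> T \<Longrightarrow> v \<oplus>\<^bsub>M\<^esub> w \<in> T"
        by (auto simp: T_def smult_r_distr proj_add add)
      fix c :: "('k, 'm) laurent" and v assume "c \<in> carrier (loc_ring {})" "v \<in> T"
      then show "c \<odot>\<^bsub>M\<^esub> v \<in> T"
        by (auto simp: T_def mult_smult[symmetric] loc_ring_mult)
    qed (use module_axioms in \<open>auto simp: T_def smz proj_zero zero\<close>)
    moreover have "A \<subseteq> T"
    proof
      fix g assume g: "g \<in> A"
      then have gc: "g \<in> carrier M" using A by auto
      have single: "proj M b (Poly_Mapping.single e c \<odot>\<^bsub>M\<^esub> g) \<in> S" if e: "e \<in> degs {}" for e c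
      proof -
        have "proj M b (Poly_Mapping.single e c \<odot>\<^bsub>M\<^esub> g) = Poly_Mapping.single e c \<odot>\<^bsub>M\<^esub> proj M (b - e) g"
          using proj_single_smult[OF e gc, of "b - e" c] by simp
        also have "\<dots> \<in> S"
        proof (cases "proj M (b - e) g = \<zero>\<^bsub>M\<^esub>")
          case True
          then show ?thesis using smz[OF single_loc_ring[OF e]] zero by simp
        next
          case False
          then show ?thesis using g e by (intro gen[of "b - e"]) (auto simp: B_def)
        qed
        finally show ?thesis .
      qed
      have "proj M b (r \<odot>\<^bsub>M\<^esub> g) \<in> S" if "r \<in> carrier (loc_ring {})" for r
        using that
      proof (induction r rule: loc_ring_induct)
        case zero
        have "0 \<odot>\<^bsub>M\<^esub> g = \<zero>\<^bsub>M\<^esub>" using smult_l_null[OF gc] by simp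
        then show ?case using \<open>\<zero>\<^bsub>M\<^esub> \<in> S\<close> by (simp add: proj_zero)
      next
        case (add r s)
        then show ?case using gc by (simp add: add_smult proj_add plus)
      qed (rule single)
      then show "g \<in> T" using gc by (simp add: T_def)
    qed
    ultimately have "carrier M \<subseteq> T" using span_is_subset A(3) by metis
    then have T: "x \<in> T" if "x \<in> component M b" for x using component_closed[OF that] by blast
    show ?thesis
    proof
      fix x assume x: "x \<in> component M b"
      have "proj M b (1 \<odot>\<^bsub>M\<^esub> x) \<in> S" using T[OF x] one_loc_ring[of "{}"] unfolding T_def by blast
      then show "x \<in> S" using proj_homogeneous[OF x, of b] by (simp add: one_smult component_closed[OF x])
    qed
  qed
  ultimately have "homogeneous_generators M B" unfolding homogeneous_generators_def by simp
  then show thesis by (rule that)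
qed

lemma fin_dim_component:
  fixes M :: "(int ^ 'm::finite, ('k::field, 'm) laurent, 'a) graded_module"
  assumes M: "graded_loc_module {} M" and fg: "finitely_generated {} M"
  shows "vectorspace.fin_dim base_field (component_space M b)"
proof -
  interpret graded_loc_module "{}" M by fact
  interpret C: vectorspace base_field "component_space M b" by (rule vectorspace_component)
  obtain B where B: "homogeneous_generators M B" by (rule homogeneous_generators_exist[OF M fg])
  note B = homogeneous_generatorsD[OF B]
  define G where "G = (\<lambda>(d, g). mon (b - d) \<odot>\<^bsub>M\<^esub> g) ` {(d, g) \<in> B. b - d \<in> degs {}}"
  have "finite {(d, g) \<in> B. b - d \<in> degs {}}" using B(1) by (rule rev_finite_subset) auto
  then have "finite G" by (simp add: G_def)
  moreover have "mon (b - d) \<odot>\<^bsub>M\<^esub> g \<in> component M b" if "(d, g) \<in> B" "b - d \<in> degs {}" for d g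
    using monomial_smult[OF that(2) B(2)[OF that(1)], of 1] by simp
  then have "G \<subseteq> carrier (component_space M b)" by (auto simp: G_def)
  ultimately have G: "finite G" "G \<subseteq> carrier (component_space M b)" .
  interpret sp: submodule base_field "C.span G" "component_space M b" by (rule C.span_is_submodule[OF G(2)])
  have "component M b \<subseteq> C.span G"
  proof (rule B(3))
    show "\<zero>\<^bsub>M\<^esub> \<in> C.span G" using sp.zero_closed by simp
    show "x \<oplus>\<^bsub>M\<^esub> y \<in> C.span G" if "x \<in> C.span G" "y \<in> C.span G" for x y
      using sp.m_closed[OF that] by simp
    fix d g e c assume dg: "(d, g) \<in> B" and e: "e \<in> degs {}" "d + e = b"
    then have "mon e \<odot>\<^bsub>M\<^esub> g \<in> G"
      by (auto simp: G_def intro!: image_eqI[of _ _ "(d, g)"])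
    then have "mon e \<odot>\<^bsub>M\<^esub> g \<in> C.span G" using C.in_own_span[OF G(2)] by auto
    from sp.smult_closed[OF _ this, of c] have "Poly_Mapping.single 0 c \<odot>\<^bsub>M\<^esub> (mon e \<odot>\<^bsub>M\<^esub> g) \<in> C.span G"
      by (simp add: base_field_def)
    then show "Poly_Mapping.single e c \<odot>\<^bsub>M\<^esub> g \<in> C.span G"
      using single_smult_smult[OF zero_degs e(1) component_closed[OF B(2)[OF dg]], of c 1] by simp
  qed
  moreover have "C.span G \<subseteq> component M b" using C.span_is_subset2[OF G(2)] by simp
  ultimately show ?thesis using G unfolding C.fin_dim_def by auto
qed

definition surjective_beyond ::
  "(int ^ 'm::finite, ('k::field, 'm) laurent, 'a) graded_module \<Rightarrow> nat \<Rightarrow> bool"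
  where "surjective_beyond M D \<longleftrightarrow> (\<forall>a b. a \<in> degs {} \<longrightarrow> a \<le> b \<longrightarrow> (\<forall>l. a $ l = b $ l \<or> int D \<le> a $ l) \<longrightarrow>
    component M b \<subseteq> (\<lambda>y. mon (b - a) \<odot>\<^bsub>M\<^esub> y) ` component M a)"

lemma surjective_beyond_mono: "surjective_beyond M D \<Longrightarrow> D \<le> D' \<Longrightarrow> surjective_beyond M D'"
  unfolding surjective_beyond_def by (meson of_nat_mono order_trans)

text \<open>
  \<open>D\<close> bounds the degrees of homogeneous generators.  A generator that contributes to degree \<open>b\<close> has
  degree at most \<open>b\<close>; where \<open>a\<close> and \<open>b\<close> differ it has coordinate at most \<open>D\<close>, so its degree is at
  most \<open>a\<close> and its contribution comes from degree \<open>a\<close>.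
\<close>
lemma eventually_surjective:
  fixes M :: "(int ^ 'm::finite, ('k::field, 'm) laurent, 'a) graded_module"
  assumes M: "graded_loc_module {} M" and fg: "finitely_generated {} M"
  obtains D where "surjective_beyond M D"
proof -
  interpret graded_loc_module "{}" M by fact
  obtain B where B: "homogeneous_generators M B" by (rule homogeneous_generators_exist[OF M fg])
  note B = homogeneous_generatorsD[OF B]
  define D where "D = Max (insert 0 ((\<lambda>(p, l). nat (fst p $ l)) ` (B \<times> UNIV)))"
  have D: "d $ l \<le> int D" if "(d, g) \<in> B" for d g l
  proof -
    have "nat (fst (d, g) $ l) \<in> (\<lambda>(p, l). nat (fst p $ l)) ` (B \<times> UNIV)" using that by force
    then have "nat (d $ l) \<le> D" unfolding D_def using B(1) by (intro Max_ge) auto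
    then show ?thesis by simp
  qed
  have "surjective_beyond M D" unfolding surjective_beyond_def
  proof (intro allI impI)
    fix a b :: "int ^ 'm" assume a: "a \<in> degs {}" and ab: "a \<le> b" and or: "\<forall>l. a $ l = b $ l \<or> int D \<le> a $ l"
    have ba: "b - a \<in> degs {}" using ab by (simp add: degs_def less_eq_vec_def)
    let ?S = "(\<lambda>y. mon (b - a) \<odot>\<^bsub>M\<^esub> y) ` component M a"
    show "component M b \<subseteq> ?S"
    proof (rule B(3))
      show "\<zero>\<^bsub>M\<^esub> \<in> ?S" using component_zero[of a]
        by (auto simp: single_loc_ring[OF ba] intro!: image_eqI[of _ _ "\<zero>\<^bsub>M\<^esub>"])
      show "y \<oplus>\<^bsub>M\<^esub> z \<in> ?S" if yz: "y \<in> ?S" "z \<in> ?S" for y z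
      proof -
        from yz obtain y' z' where *: "y' \<in> component M a" "z' \<in> component M a"
          "y = mon (b - a) \<odot>\<^bsub>M\<^esub> y'" "z = mon (b - a) \<odot>\<^bsub>M\<^esub> z'" by auto
        show ?thesis using component_add[OF *(1,2)] smult_r_distr[OF single_loc_ring[OF ba] component_closed[OF *(1)] component_closed[OF *(2)]]
          unfolding *(3,4) by (intro image_eqI[of _ _ "y' \<oplus>\<^bsub>M\<^esub> z'"]) auto
      qed
      fix d g e c assume dg: "(d, g) \<in> B" and e: "e \<in> degs {}" "d + e = b"
      have ad: "a - d \<in> degs {}"
      proof -
        have "d $ l \<le> a $ l" for l
        proof (cases "a $ l = b $ l")
          case True
          then show ?thesis using e by (auto simp: degs_def)
        next
          case False
          then show ?thesis using or[rule_format, of l] D[OF dg, of l] by simp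
        qed
        then show ?thesis by (simp add: degs_def)
      qed
      have "e = (b - a) + (a - d)" using e(2) by (simp add: algebra_simps)
      then have "Poly_Mapping.single e c \<odot>\<^bsub>M\<^esub> g = mon (b - a) \<odot>\<^bsub>M\<^esub> (Poly_Mapping.single (a - d) c \<odot>\<^bsub>M\<^esub> g)"
        using single_smult_smult[OF ba ad component_closed[OF B(2)[OF dg]], of 1 c] by simp
      moreover have "Poly_Mapping.single (a - d) c \<odot>\<^bsub>M\<^esub> g \<in> component M a"
        using monomial_smult[OF ad B(2)[OF dg], of c] by simp
      ultimately show "Poly_Mapping.single e c \<odot>\<^bsub>M\<^esub> g \<in> ?S" by auto
    qed
  qed
  then show thesis by (rule that)
qed

text \<open>
  The degree of the \<open>k\<close>-th power of the product of the variables in \<open>\<sigma>\<close>.  Inverting this single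
  monomial inverts all these variables.
\<close>
definition steps :: "'m set \<Rightarrow> nat \<Rightarrow> int ^ 'm::finite"
  where "steps \<sigma> k = (\<chi> l. if l \<in> \<sigma> then int k else 0)"

lemma steps_nth [simp]: "steps \<sigma> k $ l = (if l \<in> \<sigma> then int k else 0)"
  by (simp add: steps_def)

lemma steps_degs: "steps \<sigma> k \<in> degs \<tau>" "- steps \<sigma> k \<in> degs \<sigma>"
  by (simp_all add: degs_def)

lemma steps_add: "steps \<sigma> (k + l) = steps \<sigma> k + steps \<sigma> l" "steps \<sigma> 0 = 0"
  by (simp_all add: vec_eq_iff)

lemma steps_mono: "k \<le> l \<Longrightarrow> steps \<sigma> k \<le> steps \<sigma> l"
  by (simp add: less_eq_vec_def)

text \<open>
  Along surjections the dimension of the components can only drop.  From where it attains its minimum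
  it is constant, so that the surjections are injective by rank and nullity.
\<close>
lemma eventually_injective:
  fixes M :: "(int ^ 'm::finite, ('k::field, 'm) laurent, 'a) graded_module" and d :: "int ^ 'm"
  assumes M: "graded_loc_module {} M" and fg: "finitely_generated {} M" and d: "d \<in> degs {}"
    and d0: "\<And>l. l \<in> \<sigma> \<Longrightarrow> d $ l = 0"
  shows "\<exists>n\<^sub>0. \<forall>n k x. n\<^sub>0 \<le> n \<longrightarrow> x \<in> component M (d + steps \<sigma> n) \<longrightarrow>
    mon (steps \<sigma> k) \<odot>\<^bsub>M\<^esub> x = \<zero>\<^bsub>M\<^esub> \<longrightarrow> x = \<zero>\<^bsub>M\<^esub>"
proof -
  interpret graded_loc_module "{}" M by fact
  obtain D where D: "surjective_beyond M D" by (rule eventually_surjective[OF M fg])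
  let ?V = "\<lambda>n. component_space M (d + steps \<sigma> n)"
  let ?T = "\<lambda>k x. mon (steps \<sigma> k) \<odot>\<^bsub>M\<^esub> x"
  let ?dim = "\<lambda>n. vectorspace.dim base_field (?V n)"
  have vs: "vectorspace base_field (?V n)" for n by (rule vectorspace_component)
  have fd: "vectorspace.fin_dim base_field (?V n)" for n by (rule fin_dim_component[OF M fg])
  have hom: "linear_map base_field (?V n) (?V (n + k)) (?T k)" for n k
    using vs[of n] vs[of "n + k"] single_module_hom[OF steps_degs(1)[of \<sigma> k], of "d + steps \<sigma> n" "d + steps \<sigma> (n + k)"]
    by (simp add: linear_map_def mod_hom_def mod_hom_axioms_def vectorspace_def steps_add add.assoc)
  have drop: "?dim (n + k) + vectorspace.dim base_field ((?V n)\<lparr>carrier := mod_hom.ker (?V n) (?V (n + k)) (?T k)\<rparr>) = ?dim n"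
    if n: "D \<le> n" for n k
  proof -
    interpret f: linear_map base_field "?V n" "?V (n + k)" "?T k" by (rule hom)
    have "component M (d + steps \<sigma> (n + k)) \<subseteq>
        (\<lambda>y. mon (d + steps \<sigma> (n + k) - (d + steps \<sigma> n)) \<odot>\<^bsub>M\<^esub> y) ` component M (d + steps \<sigma> n)"
      by (rule D[unfolded surjective_beyond_def, rule_format, OF degs_add[OF d steps_degs(1)]])
        (use n d0 in \<open>auto simp: less_eq_vec_def\<close>)
    then have "component M (d + steps \<sigma> (n + k)) \<subseteq> ?T k ` component M (d + steps \<sigma> n)"
      by (simp add: steps_add)
    moreover have "?T k ` component M (d + steps \<sigma> n) \<subseteq> component M (d + steps \<sigma> (n + k))"
      using f.T_im by auto
    ultimately have "f.im = carrier (?V (n + k))" unfolding f.im_def by auto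
    then have "f.W.vs f.im = ?V (n + k)" by (simp del: component_space_simps(1))
    then show ?thesis using f.rank_nullity[OF fd] by simp
  qed
  obtain n\<^sub>0 where n\<^sub>0: "D \<le> n\<^sub>0" "\<And>n. D \<le> n \<Longrightarrow> ?dim n\<^sub>0 \<le> ?dim n"
    using ex_has_least_nat[of "\<lambda>n. D \<le> n" D ?dim] by auto
  show ?thesis
  proof (intro exI[of _ n\<^sub>0] allI impI)
    fix n k x assume n: "n\<^sub>0 \<le> n" and x: "x \<in> component M (d + steps \<sigma> n)" and z: "?T k x = \<zero>\<^bsub>M\<^esub>"
    interpret f: linear_map base_field "?V n" "?V (n + k)" "?T k" by (rule hom)
    have "?dim n \<le> ?dim n\<^sub>0" using drop[OF n\<^sub>0(1), of "n - n\<^sub>0"] n by simp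
    moreover have "?dim n\<^sub>0 \<le> ?dim (n + k)" using n\<^sub>0 n by simp
    ultimately have dim0: "vectorspace.dim base_field (f.V.vs f.ker) = 0"
      using drop[of n k] n n\<^sub>0(1) by simp
    from f.V.subspace_dim_mono(2)[OF fd f.V.subspace_zero f.kerT_is_subspace] have "f.ker = {\<zero>\<^bsub>M\<^esub>}"
      using dim0 linear_map.T0_is_0[OF hom[of n k]] component_zero by (auto simp: f.ker_def)
    moreover have "x \<in> f.ker" using x z by (simp add: f.ker_def)
    ultimately show "x = \<zero>\<^bsub>M\<^esub>" by simp
  qed
qed

section \<open>Matchings of graded modules\<close>

text \<open>These elements are the kernel of \<open>M \<rightarrow> M\<^sub>\<sigma>\<close>, see \<open>frac_zero_iff\<close> below.\<close>
definition torsion ::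
  "(int ^ 'm::finite, ('k::field, 'm) laurent, 'a) graded_module \<Rightarrow> 'm set \<Rightarrow> 'a \<Rightarrow> bool"
  where "torsion M \<sigma> x \<longleftrightarrow> (\<exists>k. mon (steps \<sigma> k) \<odot>\<^bsub>M\<^esub> x = \<zero>\<^bsub>M\<^esub>)"

text \<open>
  A relation on the unlocalized modules that becomes the graph of a graded isomorphism after
  localization: torsion on both sides corresponds, and every homogeneous element has a homogeneous
  partner after multiplication by a power of the inverted monomial.
\<close>
definition matching ::
  "'m::finite set \<Rightarrow> (int ^ 'm, ('k::field, 'm) laurent, 'a) graded_module \<Rightarrow>
    (int ^ 'm, ('k, 'm) laurent, 'b) graded_module \<Rightarrow> ('a \<times> 'b) set \<Rightarrow> bool"
  where "matching \<sigma> M N \<Gamma> \<longleftrightarrow> linear_relation (loc_ring {}) M N \<Gamma> \<and>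
    (\<forall>x y. (x, y) \<in> \<Gamma> \<longrightarrow> torsion M \<sigma> x \<longleftrightarrow> torsion N \<sigma> y) \<and>
    (\<forall>d. \<forall>x \<in> component M d. \<exists>k. \<exists>y \<in> component N (d + steps \<sigma> k). (mon (steps \<sigma> k) \<odot>\<^bsub>M\<^esub> x, y) \<in> \<Gamma>) \<and>
    (\<forall>d. \<forall>y \<in> component N d. \<exists>k. \<exists>x \<in> component M (d + steps \<sigma> k). (x, mon (steps \<sigma> k) \<odot>\<^bsub>N\<^esub> y) \<in> \<Gamma>)"

lemma matching_converse: "matching \<sigma> M N \<Gamma> \<Longrightarrow> matching \<sigma> N M (\<Gamma>\<inverse>)"
  unfolding matching_def by (simp add: linear_relation_converse)

lemma single_smult_zero:
  assumes "graded_loc_module {} M" "e \<in> degs {}"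
  shows "Poly_Mapping.single e c \<odot>\<^bsub>M\<^esub> \<zero>\<^bsub>M\<^esub> = \<zero>\<^bsub>M\<^esub>"
proof -
  interpret graded_loc_module "{}" M by fact
  show ?thesis using single_loc_ring[OF assms(2), of c] by simp
qed

lemma single_smult_zero_mono:
  assumes M: "graded_loc_module {} M" and x: "x \<in> carrier M" and e: "e \<in> degs {}" "e \<le> e'"
    and z: "mon e \<odot>\<^bsub>M\<^esub> x = \<zero>\<^bsub>M\<^esub>"
  shows "mon e' \<odot>\<^bsub>M\<^esub> x = \<zero>\<^bsub>M\<^esub>"
proof -
  interpret graded_loc_module "{}" M by fact
  have "e' - e \<in> degs {}" using e(2) by (simp add: degs_def less_eq_vec_def)
  from single_smult_smult[OF this e(1) x, of 1 1] z single_smult_zero[OF M this, of 1]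
  show ?thesis by simp
qed

lemma torsion_add:
  assumes M: "graded_loc_module {} M" and x: "x \<in> carrier M" "y \<in> carrier M" "torsion M \<sigma> x" "torsion M \<sigma> y"
  shows "torsion M \<sigma> (x \<oplus>\<^bsub>M\<^esub> y)"
proof -
  interpret graded_loc_module "{}" M by fact
  obtain k l where "mon (steps \<sigma> k) \<odot>\<^bsub>M\<^esub> x = \<zero>\<^bsub>M\<^esub>" "mon (steps \<sigma> l) \<odot>\<^bsub>M\<^esub> y = \<zero>\<^bsub>M\<^esub>"
    using x by (auto simp: torsion_def)
  note kl = this
  have "mon (steps \<sigma> (max k l)) \<odot>\<^bsub>M\<^esub> x = \<zero>\<^bsub>M\<^esub>"
    by (rule single_smult_zero_mono[OF M x(1) steps_degs(1) steps_mono kl(1)]) simp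
  moreover have "mon (steps \<sigma> (max k l)) \<odot>\<^bsub>M\<^esub> y = \<zero>\<^bsub>M\<^esub>"
    by (rule single_smult_zero_mono[OF M x(2) steps_degs(1) steps_mono kl(2)]) simp
  ultimately have "mon (steps \<sigma> (max k l)) \<odot>\<^bsub>M\<^esub> (x \<oplus>\<^bsub>M\<^esub> y) = \<zero>\<^bsub>M\<^esub>"
    using x by (simp add: smult_r_distr single_loc_ring steps_degs)
  then show ?thesis unfolding torsion_def by blast
qed

lemma torsion_iff_components:
  assumes M: "graded_loc_module {} M" and x: "x \<in> carrier M"
  shows "torsion M \<sigma> x \<longleftrightarrow> (\<forall>d. torsion M \<sigma> (proj M d x))"
proof -
  interpret graded_loc_module "{}" M by fact
  show ?thesis
  proof (intro iffI allI)
    fix d assume "torsion M \<sigma> x"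
    then obtain k where "mon (steps \<sigma> k) \<odot>\<^bsub>M\<^esub> x = \<zero>\<^bsub>M\<^esub>" by (auto simp: torsion_def)
    then show "torsion M \<sigma> (proj M d x)"
      using proj_single_smult[OF steps_degs(1) x, of d \<sigma> k 1] by (auto simp: torsion_def proj_zero)
  next
    assume t: "\<forall>d. torsion M \<sigma> (proj M d x)"
    from x show "torsion M \<sigma> x"
    proof (induction x rule: homogeneous_induct)
      case zero
      then show ?case using single_smult_zero[OF M steps_degs(1)] by (auto simp: torsion_def)
    qed (use t torsion_add[OF M] in auto)
  qed
qed

text \<open>
  Torsion for more variables is torsion for \<open>\<sigma>\<close> after multiplication by a monomial in the other
  variables, and the relation is stable under that multiplication.
\<close>
lemma torsion_transfer:
  assumes M: "graded_loc_module {} M" and N: "graded_loc_module {} N" and m: "matching \<sigma> M N \<Gamma>" and le: "\<sigma> \<subseteq> \<tau>"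
    and xy: "(x, y) \<in> \<Gamma>" and t: "torsion M \<tau> x"
  shows "torsion N \<tau> y"
proof -
  interpret M: graded_loc_module "{}" M by fact
  interpret N: graded_loc_module "{}" N by fact
  have lin: "linear_relation (loc_ring {}) M N \<Gamma>" using m by (simp add: matching_def)
  note D = linear_relationD[OF lin]
  note c = D(1,2)[OF xy]
  have split: "steps \<tau> k = steps \<sigma> k + steps (\<tau> - \<sigma>) k" for k using le by (auto simp: vec_eq_iff)
  obtain k where k: "mon (steps \<tau> k) \<odot>\<^bsub>M\<^esub> x = \<zero>\<^bsub>M\<^esub>" using t by (auto simp: torsion_def)
  let ?v = "mon (steps (\<tau> - \<sigma>) k)"
  have "mon (steps \<sigma> k) \<odot>\<^bsub>M\<^esub> (?v \<odot>\<^bsub>M\<^esub> x) = \<zero>\<^bsub>M\<^esub>"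
    using k M.single_smult_smult[OF steps_degs(1) steps_degs(1) c(1), of \<sigma> k 1 "\<tau> - \<sigma>" k 1] by (simp add: split)
  then have "torsion M \<sigma> (?v \<odot>\<^bsub>M\<^esub> x)" by (auto simp: torsion_def)
  moreover have "(?v \<odot>\<^bsub>M\<^esub> x, ?v \<odot>\<^bsub>N\<^esub> y) \<in> \<Gamma>" by (rule D(5)[OF single_loc_ring[OF steps_degs(1)] xy])
  ultimately have "torsion N \<sigma> (?v \<odot>\<^bsub>N\<^esub> y)" using m by (auto simp: matching_def)
  then obtain j where "mon (steps \<sigma> j) \<odot>\<^bsub>N\<^esub> (?v \<odot>\<^bsub>N\<^esub> y) = \<zero>\<^bsub>N\<^esub>" by (auto simp: torsion_def)
  then have "mon (steps \<sigma> j + steps (\<tau> - \<sigma>) k) \<odot>\<^bsub>N\<^esub> y = \<zero>\<^bsub>N\<^esub>"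
    using N.single_smult_smult[OF steps_degs(1) steps_degs(1) c(2), of \<sigma> j 1 "\<tau> - \<sigma>" k 1] by simp
  moreover have "steps \<sigma> j + steps (\<tau> - \<sigma>) k \<le> steps \<tau> (j + k)" using le by (auto simp: less_eq_vec_def)
  ultimately have "mon (steps \<tau> (j + k)) \<odot>\<^bsub>N\<^esub> y = \<zero>\<^bsub>N\<^esub>"
    using single_smult_zero_mono[OF N c(2) degs_add[OF steps_degs(1) steps_degs(1)]] by blast
  then show ?thesis unfolding torsion_def by blast
qed

lemma total_transfer:
  assumes M: "graded_loc_module {} M" and N: "graded_loc_module {} N" and m: "matching \<sigma> M N \<Gamma>" and le: "\<sigma> \<subseteq> \<tau>"
    and x: "x \<in> component M d"
  shows "\<exists>k. \<exists>y \<in> component N (d + steps \<tau> k). (mon (steps \<tau> k) \<odot>\<^bsub>M\<^esub> x, y) \<in> \<Gamma>"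
proof -
  interpret M: graded_loc_module "{}" M by fact
  interpret N: graded_loc_module "{}" N by fact
  have lin: "linear_relation (loc_ring {}) M N \<Gamma>" using m by (simp add: matching_def)
  have split: "steps \<tau> k = steps (\<tau> - \<sigma>) k + steps \<sigma> k" for k using le by (auto simp: vec_eq_iff)
  obtain k y where ky: "y \<in> component N (d + steps \<sigma> k)" "(mon (steps \<sigma> k) \<odot>\<^bsub>M\<^esub> x, y) \<in> \<Gamma>"
    using m x unfolding matching_def by blast
  let ?v = "mon (steps (\<tau> - \<sigma>) k)"
  have "(?v \<odot>\<^bsub>M\<^esub> (mon (steps \<sigma> k) \<odot>\<^bsub>M\<^esub> x), ?v \<odot>\<^bsub>N\<^esub> y) \<in> \<Gamma>"
    by (rule linear_relationD(5)[OF lin single_loc_ring[OF steps_degs(1)] ky(2)])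
  moreover have "?v \<odot>\<^bsub>N\<^esub> y \<in> component N (d + steps \<tau> k)"
    using N.monomial_smult[OF steps_degs(1) ky(1), of "\<tau> - \<sigma>" k 1] by (simp add: split add_ac)
  ultimately show ?thesis
    using M.single_smult_smult[OF steps_degs(1) steps_degs(1) M.component_closed[OF x], of "\<tau> - \<sigma>" k 1 \<sigma> k 1]
    by (auto simp: split intro!: exI[of _ k])
qed

lemma matching_mono:
  assumes M: "graded_loc_module {} M" and N: "graded_loc_module {} N" and m: "matching \<sigma> M N \<Gamma>" and le: "\<sigma> \<subseteq> \<tau>"
  shows "matching \<tau> M N \<Gamma>"
proof -
  note c = matching_converse[OF m]
  have "linear_relation (loc_ring {}) M N \<Gamma>" using m by (simp add: matching_def)
  moreover have "torsion M \<tau> x \<longleftrightarrow> torsion N \<tau> y" if "(x, y) \<in> \<Gamma>" for x y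
    using torsion_transfer[OF M N m le that] torsion_transfer[OF N M c le, of y x] that by auto
  moreover have "\<exists>k. \<exists>x \<in> component M (d + steps \<tau> k). (x, mon (steps \<tau> k) \<odot>\<^bsub>N\<^esub> y) \<in> \<Gamma>"
    if "y \<in> component N d" for y d
    using total_transfer[OF N M c le that] by auto
  ultimately show ?thesis unfolding matching_def using total_transfer[OF M N m le] by blast
qed

text \<open>
  If \<open>q\<close> is so large that \<open>M(q)\<close> is torsion-free, then \<open>M(q)\<close> detects torsion: up to powers of the
  inverted monomial, multiplying \<open>x\<close> by the monomial of degree \<open>e\<close> and moving \<open>x\<close> to degree \<open>q\<close> are
  the same, because the coordinates outside \<open>\<sigma>\<close> agree.
\<close>
lemma torsion_iff_transition_zero:
  fixes M :: "(int ^ 'm::finite, ('k::field, 'm) laurent, 'a) graded_module"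
  assumes M: "graded_loc_module {} M"
    and inj: "\<And>k x. x \<in> component M q \<Longrightarrow> mon (steps \<sigma> k) \<odot>\<^bsub>M\<^esub> x = \<zero>\<^bsub>M\<^esub> \<Longrightarrow> x = \<zero>\<^bsub>M\<^esub>"
    and x: "x \<in> component M p" and e: "e \<in> degs {}" and pq: "p \<le> q" and out: "\<And>l. l \<notin> \<sigma> \<Longrightarrow> q $ l = p $ l + e $ l"
  shows "torsion M \<sigma> (mon e \<odot>\<^bsub>M\<^esub> x) \<longleftrightarrow> mon (q - p) \<odot>\<^bsub>M\<^esub> x = \<zero>\<^bsub>M\<^esub>"
proof
  interpret graded_loc_module "{}" M by fact
  note xc = component_closed[OF x]
  have qp: "q - p \<in> degs {}" using pq by (simp add: degs_def less_eq_vec_def)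
  have bound: "f $ l \<le> int (\<Sum>l \<in> UNIV. nat (f $ l))" for f :: "int ^ 'm" and l
  proof -
    have "nat (f $ l) \<le> (\<Sum>l \<in> UNIV. nat (f $ l))" by (rule member_le_sum) auto
    then show ?thesis by linarith
  qed
  {
    assume "torsion M \<sigma> (mon e \<odot>\<^bsub>M\<^esub> x)"
    then obtain k where "mon (steps \<sigma> k) \<odot>\<^bsub>M\<^esub> (mon e \<odot>\<^bsub>M\<^esub> x) = \<zero>\<^bsub>M\<^esub>"
      by (auto simp: torsion_def)
    then have z: "mon (steps \<sigma> k + e) \<odot>\<^bsub>M\<^esub> x = \<zero>\<^bsub>M\<^esub>"
      using single_smult_smult[OF steps_degs(1) e xc, of \<sigma> k 1 1] by simp
    obtain s where s: "\<And>l. e $ l \<le> int s" using bound[of e] by blast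
    define K where "K = k + s"
    have "steps \<sigma> k + e \<le> steps \<sigma> K + (q - p)" unfolding less_eq_vec_def
    proof
      fix l show "(steps \<sigma> k + e) $ l \<le> (steps \<sigma> K + (q - p)) $ l"
        using s[of l] out[of l] pq[unfolded less_eq_vec_def, rule_format, of l] by (auto simp: K_def)
    qed
    from single_smult_zero_mono[OF M xc degs_add[OF steps_degs(1) e] this z]
    have "mon (steps \<sigma> K) \<odot>\<^bsub>M\<^esub> (mon (q - p) \<odot>\<^bsub>M\<^esub> x) = \<zero>\<^bsub>M\<^esub>"
      using single_smult_smult[OF steps_degs(1) qp xc, of \<sigma> K 1 1] by simp
    then show "mon (q - p) \<odot>\<^bsub>M\<^esub> x = \<zero>\<^bsub>M\<^esub>"
      by (rule inj[rotated]) (use monomial_smult[OF qp x, of 1] in simp)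
  }
  {
    assume z: "mon (q - p) \<odot>\<^bsub>M\<^esub> x = \<zero>\<^bsub>M\<^esub>"
    obtain k where k: "\<And>l. (q - p) $ l \<le> int k" using bound[of "q - p"] by blast
    have "q - p \<le> steps \<sigma> k + e" unfolding less_eq_vec_def
    proof
      fix l show "(q - p) $ l \<le> (steps \<sigma> k + e) $ l"
      proof -
        have "0 \<le> e $ l" using e by (simp add: degs_def)
        then show ?thesis using k[of l] out[of l] by auto
      qed
    qed
    from single_smult_zero_mono[OF M xc qp this z]
    have "mon (steps \<sigma> k) \<odot>\<^bsub>M\<^esub> (mon e \<odot>\<^bsub>M\<^esub> x) = \<zero>\<^bsub>M\<^esub>"
      using single_smult_smult[OF steps_degs(1) e xc, of \<sigma> k 1 1] by simp
    then show "torsion M \<sigma> (mon e \<odot>\<^bsub>M\<^esub> x)" by (auto simp: torsion_def)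
  }
qed

text \<open>
  A degree \<open>a\<close> that is large in the directions of \<open>\<sigma>\<close> represents all degrees with the same other
  coordinates: any element moved far enough along \<open>\<sigma>\<close> comes from degree \<open>a\<close>.
\<close>
lemma homogeneous_factorization:
  fixes M :: "(int ^ 'm::finite, ('k::field, 'm) laurent, 'a) graded_module"
  assumes M: "graded_loc_module {} M" and st: "surjective_beyond M D" and x: "x \<in> component M d"
    and d: "d \<in> degs {}" and a: "a \<in> degs {}"
    and large: "\<And>l. l \<in> \<sigma> \<Longrightarrow> int D \<le> a $ l" and eq: "\<And>l. l \<notin> \<sigma> \<Longrightarrow> a $ l = d $ l"
  obtains k f z where "f \<in> degs {}" "a + f = d + steps \<sigma> k" "z \<in> component M a"
    "mon (steps \<sigma> k) \<odot>\<^bsub>M\<^esub> x = mon f \<odot>\<^bsub>M\<^esub> z"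
proof -
  interpret graded_loc_module "{}" M by fact
  define k where "k = nat (\<Sum>l\<in>UNIV. a $ l)"
  have le_k: "a $ l \<le> int k" for l
  proof -
    have "a $ l \<le> (\<Sum>l\<in>UNIV. a $ l)" by (rule member_le_sum) (use a in \<open>auto simp: degs_def\<close>)
    then show ?thesis by (simp add: k_def)
  qed
  have ad: "a \<le> d + steps \<sigma> k" unfolding less_eq_vec_def
  proof
    fix l
    have "0 \<le> d $ l" using d by (simp add: degs_def)
    then show "a $ l \<le> (d + steps \<sigma> k) $ l" using le_k[of l] eq[of l] by auto
  qed
  have "component M (d + steps \<sigma> k) \<subseteq> (\<lambda>z. mon (d + steps \<sigma> k - a) \<odot>\<^bsub>M\<^esub> z) ` component M a"
    by (rule st[unfolded surjective_beyond_def, rule_format, OF a ad]) (use large eq in auto)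
  moreover have "mon (steps \<sigma> k) \<odot>\<^bsub>M\<^esub> x \<in> component M (d + steps \<sigma> k)"
    by (rule monomial_smult[OF steps_degs(1) x])
  ultimately obtain z where "z \<in> component M a"
    "mon (steps \<sigma> k) \<odot>\<^bsub>M\<^esub> x = mon (d + steps \<sigma> k - a) \<odot>\<^bsub>M\<^esub> z"
    by auto
  then show thesis
    by (intro that[of "d + steps \<sigma> k - a" k z]) (use ad in \<open>simp_all add: degs_def less_eq_vec_def\<close>)
qed

text \<open>
  Isomorphisms along one chain of degrees, one degree for each value of the coordinate \<open>i\<close>, suffice
  for a matching.  \<open>H d\<close> collects the monomial multiples of degree \<open>d\<close> of all pairs in the \<open>G j\<close>; it is
  closed under addition because a pair from an earlier degree of the chain can be moved to a later
  one.  The relation \<open>\<Gamma>\<close> consists of the pairs all of whose homogeneous parts lie in \<open>H\<close>.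
\<close>
lemma matching_of_chain:
  fixes M :: "(int ^ 'm::finite, ('k::field, 'm) laurent, 'a) graded_module"
    and N :: "(int ^ 'm, ('k, 'm) laurent, 'b) graded_module"
  assumes M: "graded_loc_module {} M" and N: "graded_loc_module {} N"
    and stM: "surjective_beyond M D" and stN: "surjective_beyond N D"
    and a: "\<And>j. a j $ i = int j" "\<And>j l. l \<noteq> i \<Longrightarrow> int D \<le> a j $ l" "\<And>j l. j \<le> l \<Longrightarrow> a j \<le> a l"
    and injM: "\<And>j k x. x \<in> component M (a j) \<Longrightarrow> mon (steps (UNIV - {i}) k) \<odot>\<^bsub>M\<^esub> x = \<zero>\<^bsub>M\<^esub> \<Longrightarrow> x = \<zero>\<^bsub>M\<^esub>"
    and injN: "\<And>j k y. y \<in> component N (a j) \<Longrightarrow> mon (steps (UNIV - {i}) k) \<odot>\<^bsub>N\<^esub> y = \<zero>\<^bsub>N\<^esub> \<Longrightarrow> y = \<zero>\<^bsub>N\<^esub>"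
    and G: "\<And>j. linear_relation base_field (component_space M (a j)) (component_space N (a j)) (G j)"
      "\<And>j. Domain (G j) = component M (a j)" "\<And>j. Range (G j) = component N (a j)"
      "\<And>j x y. (x, y) \<in> G j \<Longrightarrow> x = \<zero>\<^bsub>M\<^esub> \<longleftrightarrow> y = \<zero>\<^bsub>N\<^esub>"
      "\<And>j l x y. j \<le> l \<Longrightarrow> (x, y) \<in> G j \<Longrightarrow>
        (mon (a l - a j) \<odot>\<^bsub>M\<^esub> x, mon (a l - a j) \<odot>\<^bsub>N\<^esub> y) \<in> G l"
  shows "\<exists>\<Gamma>. matching (UNIV - {i}) M N \<Gamma>"
proof -
  interpret M: graded_loc_module "{}" M by fact
  interpret N: graded_loc_module "{}" N by fact
  let ?\<sigma> = "UNIV - {i}"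
  have a_degs: "a j \<in> degs {}" for j
  proof -
    have "0 \<le> a j $ l" for l using a(1)[of j] a(2)[of l j] by (cases "l = i") auto
    then show ?thesis by (simp add: degs_def)
  qed
  have diff_degs: "a l - a j \<in> degs {}" if "j \<le> l" for j l
    using a(3)[OF that] by (simp add: degs_def less_eq_vec_def)
  have Gc: "x \<in> component M (a j)" "y \<in> component N (a j)" if "(x, y) \<in> G j" for x y j
    using that G(2,3)[of j] by auto
  define H where "H d = insert (\<zero>\<^bsub>M\<^esub>, \<zero>\<^bsub>N\<^esub>) {(mon e \<odot>\<^bsub>M\<^esub> x, mon e \<odot>\<^bsub>N\<^esub> y) | e x y j.
    (x, y) \<in> G j \<and> e \<in> degs {} \<and> a j + e = d}" for d
  have HI: "(mon e \<odot>\<^bsub>M\<^esub> x, mon e \<odot>\<^bsub>N\<^esub> y) \<in> H d"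
    if "(x, y) \<in> G j" "e \<in> degs {}" "a j + e = d" for e x y j d
    using that unfolding H_def by blast
  have HE: thesis if "(x, y) \<in> H d" "x = \<zero>\<^bsub>M\<^esub> \<Longrightarrow> y = \<zero>\<^bsub>N\<^esub> \<Longrightarrow> thesis"
      "\<And>e x' y' j. (x', y') \<in> G j \<Longrightarrow> e \<in> degs {} \<Longrightarrow> a j + e = d \<Longrightarrow>
        x = mon e \<odot>\<^bsub>M\<^esub> x' \<Longrightarrow> y = mon e \<odot>\<^bsub>N\<^esub> y' \<Longrightarrow> thesis" for x y d thesis
    using that unfolding H_def by blast
  have Hc: "x \<in> component M d" "y \<in> component N d" if "(x, y) \<in> H d" for x y d
    using that(1) by (rule HE; use M.component_zero N.component_zero M.monomial_smult N.monomial_smult Gc in force)+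
  have Hadd: "(x \<oplus>\<^bsub>M\<^esub> x', y \<oplus>\<^bsub>N\<^esub> y') \<in> H d" if xy: "(x, y) \<in> H d" and xy': "(x', y') \<in> H d" for x y x' y' d
  proof -
    have aux: "(x \<oplus>\<^bsub>M\<^esub> x', y \<oplus>\<^bsub>N\<^esub> y') \<in> H d"
      if p: "(p, q) \<in> G j" "e \<in> degs {}" "a j + e = d" "x = mon e \<odot>\<^bsub>M\<^esub> p" "y = mon e \<odot>\<^bsub>N\<^esub> q"
        and p': "(p', q') \<in> G j'" "e' \<in> degs {}" "a j' + e' = d" "x' = mon e' \<odot>\<^bsub>M\<^esub> p'" "y' = mon e' \<odot>\<^bsub>N\<^esub> q'"
        and jj: "j \<le> j'" for p q j e p' q' j' e' x y x' y'
    proof -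
      have e: "e = e' + (a j' - a j)" using p(3) p'(3) by (simp add: algebra_simps)
      let ?t = "mon (a j' - a j)"
      note t = G(5)[OF jj p(1)]
      have x: "x = mon e' \<odot>\<^bsub>M\<^esub> (?t \<odot>\<^bsub>M\<^esub> p)"
        using M.single_smult_smult[OF p'(2) diff_degs[OF jj] M.component_closed[OF Gc(1)[OF p(1)]], of 1 1] by (simp add: p(4) e)
      have y: "y = mon e' \<odot>\<^bsub>N\<^esub> (?t \<odot>\<^bsub>N\<^esub> q)"
        using N.single_smult_smult[OF p'(2) diff_degs[OF jj] N.component_closed[OF Gc(2)[OF p(1)]], of 1 1] by (simp add: p(5) e)
      have "(?t \<odot>\<^bsub>M\<^esub> p \<oplus>\<^bsub>M\<^esub> p', ?t \<odot>\<^bsub>N\<^esub> q \<oplus>\<^bsub>N\<^esub> q') \<in> G j'"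
        using linear_relationD(4)[OF G(1) t p'(1)] by simp
      from HI[OF this p'(2,3)] show ?thesis
        unfolding x y p'(4,5) using M.component_closed[OF Gc(1)[OF t]] M.component_closed[OF Gc(1)[OF p'(1)]]
          N.component_closed[OF Gc(2)[OF t]] N.component_closed[OF Gc(2)[OF p'(1)]]
        by (simp add: M.smult_r_distr N.smult_r_distr single_loc_ring[OF p'(2)])
    qed
    have c: "x \<in> carrier M" "x' \<in> carrier M" "y \<in> carrier N" "y' \<in> carrier N"
      using Hc[OF xy] Hc[OF xy'] M.component_closed N.component_closed by blast+
    from xy show ?thesis
    proof (rule HE)
      assume "x = \<zero>\<^bsub>M\<^esub>" "y = \<zero>\<^bsub>N\<^esub>" then show ?thesis using xy' c by simp
    next
      fix e p q j assume p: "(p, q) \<in> G j" "e \<in> degs {}" "a j + e = d" "x = mon e \<odot>\<^bsub>M\<^esub> p" "y = mon e \<odot>\<^bsub>N\<^esub> q"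
      from xy' show ?thesis
      proof (rule HE)
        assume "x' = \<zero>\<^bsub>M\<^esub>" "y' = \<zero>\<^bsub>N\<^esub>" then show ?thesis using xy c by simp
      next
        fix e' p' q' j' assume p': "(p', q') \<in> G j'" "e' \<in> degs {}" "a j' + e' = d" "x' = mon e' \<odot>\<^bsub>M\<^esub> p'" "y' = mon e' \<odot>\<^bsub>N\<^esub> q'"
        show ?thesis
        proof (cases "j \<le> j'")
          case True
          then show ?thesis using aux[OF p p'] by blast
        next
          case False
          then have "(x' \<oplus>\<^bsub>M\<^esub> x, y' \<oplus>\<^bsub>N\<^esub> y) \<in> H d" using aux[OF p' p] by simp
          then show ?thesis using c by (simp add: M.a_comm N.a_comm)
        qed
      qed
    qed
  qed
  have Hsmult: "(Poly_Mapping.single f c \<odot>\<^bsub>M\<^esub> x, Poly_Mapping.single f c \<odot>\<^bsub>N\<^esub> y) \<in> H (d + f)"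
    if xy: "(x, y) \<in> H d" and f: "f \<in> degs {}" for x y d f c
    using xy
  proof (rule HE)
    assume "x = \<zero>\<^bsub>M\<^esub>" "y = \<zero>\<^bsub>N\<^esub>"
    then show ?thesis using single_smult_zero[OF M f] single_smult_zero[OF N f] by (simp add: H_def)
  next
    fix e p q j assume p: "(p, q) \<in> G j" "e \<in> degs {}" "a j + e = d" "x = mon e \<odot>\<^bsub>M\<^esub> p" "y = mon e \<odot>\<^bsub>N\<^esub> q"
    have "(Poly_Mapping.single 0 c \<odot>\<^bsub>M\<^esub> p, Poly_Mapping.single 0 c \<odot>\<^bsub>N\<^esub> q) \<in> G j"
      using linear_relationD(5)[OF G(1) _ p(1), of c] by (simp add: base_field_def)
    from HI[OF this degs_add[OF p(2) f], of "d + f"] p(3)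
    have "(mon (e + f) \<odot>\<^bsub>M\<^esub> (Poly_Mapping.single 0 c \<odot>\<^bsub>M\<^esub> p), mon (e + f) \<odot>\<^bsub>N\<^esub> (Poly_Mapping.single 0 c \<odot>\<^bsub>N\<^esub> q)) \<in> H (d + f)"
      by (simp add: add.assoc[symmetric])
    then show ?thesis
      using M.component_closed[OF Gc(1)[OF p(1)]] N.component_closed[OF Gc(2)[OF p(1)]]
      by (simp add: M.single_smult_smult N.single_smult_smult f p(2,4,5) zero_degs degs_add[OF p(2) f] add.commute)
  qed
  have Htors: "torsion M ?\<sigma> x \<longleftrightarrow> torsion N ?\<sigma> y" if "(x, y) \<in> H d" for x y d
    using that
  proof (rule HE)
    assume "x = \<zero>\<^bsub>M\<^esub>" "y = \<zero>\<^bsub>N\<^esub>"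
    then show ?thesis using single_smult_zero[OF M steps_degs(1)] single_smult_zero[OF N steps_degs(1)] by (simp add: torsion_def)
  next
    fix e p q j assume p: "(p, q) \<in> G j" "e \<in> degs {}" "a j + e = d" "x = mon e \<odot>\<^bsub>M\<^esub> p" "y = mon e \<odot>\<^bsub>N\<^esub> q"
    \<comment> \<open>The chain degree with the same \<open>i\<close>-th coordinate as \<open>d\<close>.\<close>
    define l where "l = j + nat (e $ i)"
    have jl: "j \<le> l" by (simp add: l_def)
    have out: "a l $ l' = a j $ l' + e $ l'" if "l' \<notin> ?\<sigma>" for l'
      using that p(2) a(1) by (simp add: l_def degs_def)
    have "torsion M ?\<sigma> (mon e \<odot>\<^bsub>M\<^esub> p) \<longleftrightarrow> mon (a l - a j) \<odot>\<^bsub>M\<^esub> p = \<zero>\<^bsub>M\<^esub>"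
      by (rule torsion_iff_transition_zero[OF M _ Gc(1)[OF p(1)] p(2) a(3)[OF jl] out]) (rule injM)
    moreover have "torsion N ?\<sigma> (mon e \<odot>\<^bsub>N\<^esub> q) \<longleftrightarrow> mon (a l - a j) \<odot>\<^bsub>N\<^esub> q = \<zero>\<^bsub>N\<^esub>"
      by (rule torsion_iff_transition_zero[OF N _ Gc(2)[OF p(1)] p(2) a(3)[OF jl] out]) (rule injN)
    ultimately show ?thesis using G(4)[OF G(5)[OF jl p(1)]] by (simp add: p(4,5))
  qed
  define \<Gamma> where "\<Gamma> = {(x, y). x \<in> carrier M \<and> y \<in> carrier N \<and> (\<forall>d. (proj M d x, proj N d y) \<in> H d)}"
  have H\<Gamma>: "(x, y) \<in> \<Gamma>" if "(x, y) \<in> H d" for x y d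
    using that M.component_closed[OF Hc(1)[OF that]] N.component_closed[OF Hc(2)[OF that]]
    by (auto simp: \<Gamma>_def M.proj_homogeneous[OF Hc(1)[OF that]] N.proj_homogeneous[OF Hc(2)[OF that]]) (simp add: H_def)
  have \<Gamma>add: "(x \<oplus>\<^bsub>M\<^esub> x', y \<oplus>\<^bsub>N\<^esub> y') \<in> \<Gamma>" if "(x, y) \<in> \<Gamma>" "(x', y') \<in> \<Gamma>" for x y x' y'
    using that by (auto simp: \<Gamma>_def M.proj_add N.proj_add intro: Hadd)
  have \<Gamma>smult: "(r \<odot>\<^bsub>M\<^esub> x, r \<odot>\<^bsub>N\<^esub> y) \<in> \<Gamma>" if r: "r \<in> carrier (loc_ring {})" and xy: "(x, y) \<in> \<Gamma>" for r x y
  proof -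
    have c: "x \<in> carrier M" "y \<in> carrier N" using xy by (auto simp: \<Gamma>_def)
    from r show ?thesis
    proof (induction r rule: loc_ring_induct)
      case zero
      show ?case using M.smult_l_null[OF c(1)] N.smult_l_null[OF c(2)] by (auto intro: H\<Gamma>[of _ _ 0] simp: H_def)
    next
      case (single e s)
      have "(proj M d (Poly_Mapping.single e s \<odot>\<^bsub>M\<^esub> x), proj N d (Poly_Mapping.single e s \<odot>\<^bsub>N\<^esub> y)) \<in> H d" for d
        using M.proj_single_smult[OF single c(1), of "d - e" s] N.proj_single_smult[OF single c(2), of "d - e" s]
          Hsmult[OF _ single, of "proj M (d - e) x" "proj N (d - e) y" "d - e" s] xy by (simp add: \<Gamma>_def)
      then show ?case using c single by (simp add: \<Gamma>_def single_loc_ring)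
    next
      case (add r s)
      then show ?case using \<Gamma>add c by (simp add: M.add_smult N.add_smult)
    qed
  qed
  have "linear_relation (loc_ring {}) M N \<Gamma>"
    unfolding linear_relation_def using \<Gamma>add \<Gamma>smult H\<Gamma>[of "\<zero>\<^bsub>M\<^esub>" "\<zero>\<^bsub>N\<^esub>" 0] by (auto simp: \<Gamma>_def H_def)
  moreover have "torsion M ?\<sigma> x \<longleftrightarrow> torsion N ?\<sigma> y" if "(x, y) \<in> \<Gamma>" for x y
  proof -
    have c: "x \<in> carrier M" "y \<in> carrier N" and h: "(proj M d x, proj N d y) \<in> H d" for d
      using that by (auto simp: \<Gamma>_def)
    show ?thesis using Htors[OF h] by (simp add: torsion_iff_components[OF M c(1)] torsion_iff_components[OF N c(2)])
  qed
  moreover have "\<exists>k. \<exists>y \<in> component N (d + steps ?\<sigma> k). (mon (steps ?\<sigma> k) \<odot>\<^bsub>M\<^esub> x, y) \<in> \<Gamma>"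
    if x: "x \<in> component M d" for x d
  proof (cases "d \<in> degs {}")
    case False
    then have "x = \<zero>\<^bsub>M\<^esub>" using x M.component_outside by simp
    then show ?thesis using H\<Gamma>[of "\<zero>\<^bsub>M\<^esub>" "\<zero>\<^bsub>N\<^esub>" 0] N.component_zero single_smult_zero[OF M steps_degs(1)]
      by (intro exI[of _ 0] bexI[of _ "\<zero>\<^bsub>N\<^esub>"]) (auto simp: H_def)
  next
    case True
    define j where "j = nat (d $ i)"
    have eq: "a j $ l = d $ l" if "l \<notin> ?\<sigma>" for l using that a(1)[of j] True by (simp add: j_def degs_def)
    have large: "int D \<le> a j $ l" if "l \<in> ?\<sigma>" for l using that a(2) by simp
    obtain k f z where z: "f \<in> degs {}" "a j + f = d + steps ?\<sigma> k" "z \<in> component M (a j)"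
      "mon (steps ?\<sigma> k) \<odot>\<^bsub>M\<^esub> x = mon f \<odot>\<^bsub>M\<^esub> z"
      by (rule homogeneous_factorization[OF M stM x True a_degs large eq])
    then obtain w where w: "(z, w) \<in> G j" using G(2)[of j] by auto
    have "(mon (steps ?\<sigma> k) \<odot>\<^bsub>M\<^esub> x, mon f \<odot>\<^bsub>N\<^esub> w) \<in> H (d + steps ?\<sigma> k)"
      unfolding z(4) by (rule HI[OF w z(1,2)])
    then show ?thesis using H\<Gamma> Hc(2) by blast
  qed
  moreover have "\<exists>k. \<exists>x \<in> component M (d + steps ?\<sigma> k). (x, mon (steps ?\<sigma> k) \<odot>\<^bsub>N\<^esub> y) \<in> \<Gamma>"
    if y: "y \<in> component N d" for y d
  proof (cases "d \<in> degs {}")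
    case False
    then have "y = \<zero>\<^bsub>N\<^esub>" using y N.component_outside by simp
    then show ?thesis using H\<Gamma>[of "\<zero>\<^bsub>M\<^esub>" "\<zero>\<^bsub>N\<^esub>" 0] M.component_zero single_smult_zero[OF N steps_degs(1)]
      by (intro exI[of _ 0] bexI[of _ "\<zero>\<^bsub>M\<^esub>"]) (auto simp: H_def)
  next
    case True
    define j where "j = nat (d $ i)"
    have eq: "a j $ l = d $ l" if "l \<notin> ?\<sigma>" for l using that a(1)[of j] True by (simp add: j_def degs_def)
    have large: "int D \<le> a j $ l" if "l \<in> ?\<sigma>" for l using that a(2) by simp
    obtain k f z where z: "f \<in> degs {}" "a j + f = d + steps ?\<sigma> k" "z \<in> component N (a j)"
      "mon (steps ?\<sigma> k) \<odot>\<^bsub>N\<^esub> y = mon f \<odot>\<^bsub>N\<^esub> z"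
      by (rule homogeneous_factorization[OF N stN y True a_degs large eq])
    then obtain w where w: "(w, z) \<in> G j" using G(3)[of j] by auto
    have "(mon f \<odot>\<^bsub>M\<^esub> w, mon (steps ?\<sigma> k) \<odot>\<^bsub>N\<^esub> y) \<in> H (d + steps ?\<sigma> k)"
      unfolding z(4) by (rule HI[OF w z(1,2)])
    then show ?thesis using H\<Gamma> Hc(1) by blast
  qed
  ultimately have "matching ?\<sigma> M N \<Gamma>" unfolding matching_def by blast
  then show ?thesis by blast
qed

text \<open>
  The chain of degrees is chosen so that the coordinates in \<open>\<sigma>\<close> are large enough for \<open>M\<close> and \<open>N\<close> at
  once, both for surjectivity and for injectivity in each degree \<open>j\<close>.  How large they have to be for
  injectivity may depend on \<open>j\<close>; summing the bounds makes the chain increasing.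
\<close>
theorem matching_if_rk_eq:
  fixes M :: "(int ^ 'm::finite, ('k::field, 'm) laurent, 'a) graded_module"
    and N :: "(int ^ 'm, ('k, 'm) laurent, 'b) graded_module"
  assumes M: "graded_loc_module {} M" "finitely_generated {} M"
    and N: "graded_loc_module {} N" "finitely_generated {} N"
    and rk: "\<And>a b. 0 \<le> a \<Longrightarrow> a \<le> b \<Longrightarrow> rk M a b = rk N a b"
  shows "\<exists>\<Gamma>. matching (UNIV - {i}) M N \<Gamma>"
proof -
  interpret M: graded_loc_module "{}" M by fact
  interpret N: graded_loc_module "{}" N by fact
  let ?\<sigma> = "UNIV - {i}"
  obtain D\<^sub>M where DM: "surjective_beyond M D\<^sub>M" by (rule eventually_surjective[OF M])
  obtain D\<^sub>N where DN: "surjective_beyond N D\<^sub>N" by (rule eventually_surjective[OF N])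
  define D where "D = max D\<^sub>M D\<^sub>N"
  have st: "surjective_beyond M D" "surjective_beyond N D"
    using surjective_beyond_mono[OF DM, of D] surjective_beyond_mono[OF DN, of D] by (simp_all add: D_def)
  define base :: "nat \<Rightarrow> int ^ 'm" where "base j = (\<chi> l. if l = i then int j else 0)" for j
  have base: "base j \<in> degs {}" "l \<in> ?\<sigma> \<Longrightarrow> base j $ l = 0" for j l by (auto simp: base_def degs_def)
  have "\<forall>j. \<exists>n\<^sub>0. \<forall>n k x. n\<^sub>0 \<le> n \<longrightarrow> x \<in> component M (base j + steps ?\<sigma> n) \<longrightarrow>
    mon (steps ?\<sigma> k) \<odot>\<^bsub>M\<^esub> x = \<zero>\<^bsub>M\<^esub> \<longrightarrow> x = \<zero>\<^bsub>M\<^esub>"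
    using eventually_injective[OF M base] by blast
  then obtain \<mu> where \<mu>: "\<And>j n k x. \<mu> j \<le> n \<Longrightarrow> x \<in> component M (base j + steps ?\<sigma> n) \<Longrightarrow>
    mon (steps ?\<sigma> k) \<odot>\<^bsub>M\<^esub> x = \<zero>\<^bsub>M\<^esub> \<Longrightarrow> x = \<zero>\<^bsub>M\<^esub>"
    by metis
  have "\<forall>j. \<exists>n\<^sub>0. \<forall>n k x. n\<^sub>0 \<le> n \<longrightarrow> x \<in> component N (base j + steps ?\<sigma> n) \<longrightarrow>
    mon (steps ?\<sigma> k) \<odot>\<^bsub>N\<^esub> x = \<zero>\<^bsub>N\<^esub> \<longrightarrow> x = \<zero>\<^bsub>N\<^esub>"
    using eventually_injective[OF N base] by blast
  then obtain \<nu> where \<nu>: "\<And>j n k x. \<nu> j \<le> n \<Longrightarrow> x \<in> component N (base j + steps ?\<sigma> n) \<Longrightarrow>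
    mon (steps ?\<sigma> k) \<odot>\<^bsub>N\<^esub> x = \<zero>\<^bsub>N\<^esub> \<Longrightarrow> x = \<zero>\<^bsub>N\<^esub>"
    by metis
  define n where "n j = D + (\<Sum>l\<le>j. \<mu> l + \<nu> l)" for j
  have n_ge: "\<mu> j \<le> n j" "\<nu> j \<le> n j" for j
    using member_le_sum[of j "{..j}" "\<lambda>l. \<mu> l + \<nu> l"] by (simp_all add: n_def)
  have n_mono: "n j \<le> n l" if "j \<le> l" for j l
    unfolding n_def using that by (intro add_left_mono sum_mono2) auto
  define a where "a j = base j + steps ?\<sigma> (n j)" for j
  have a: "a j $ i = int j" "l \<noteq> i \<Longrightarrow> int D \<le> a j $ l" for j l
    by (simp_all add: a_def base_def n_def sum_nonneg)
  have a_mono: "a j \<le> a l" if "j \<le> l" for j l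
    using that n_mono[OF that] by (auto simp: a_def base_def less_eq_vec_def)
  have a0: "0 \<le> a j" for j by (simp add: a_def base_def less_eq_vec_def)
  have diff: "a l - a j \<in> degs {}" if "j \<le> l" for j l
    using a_mono[OF that] by (simp add: degs_def less_eq_vec_def)
  have trans: "mon (a m - a l) \<odot>\<^bsub>P\<^esub> (mon (a l - a j) \<odot>\<^bsub>P\<^esub> x) = mon (a m - a j) \<odot>\<^bsub>P\<^esub> x"
    if "graded_loc_module {} P" "j \<le> l" "l \<le> m" "x \<in> component P (a j)"
    for P :: "(int ^ 'm, ('k, 'm) laurent, 'c) graded_module" and j l m x
  proof -
    interpret P: graded_loc_module "{}" P by fact
    show ?thesis
      using P.single_smult_smult[OF diff[OF that(3)] diff[OF that(2)] P.component_closed[OF that(4)], of 1 1] by simp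
  qed
  show ?thesis
  proof (rule persistence_relations[where V = "\<lambda>j. component_space M (a j)" and W = "\<lambda>j. component_space N (a j)"
        and K = base_field and T = "\<lambda>j l x. mon (a l - a j) \<odot>\<^bsub>M\<^esub> x"
        and S = "\<lambda>j l y. mon (a l - a j) \<odot>\<^bsub>N\<^esub> y"])
    fix G
    assume G: "\<And>j. linear_relation base_field (component_space M (a j)) (component_space N (a j)) (G j)"
      "\<And>j. Domain (G j) = carrier (component_space M (a j))" "\<And>j. Range (G j) = carrier (component_space N (a j))"
      "\<And>j x y. (x, y) \<in> G j \<Longrightarrow> x = \<zero>\<^bsub>component_space M (a j)\<^esub> \<longleftrightarrow> y = \<zero>\<^bsub>component_space N (a j)\<^esub>"
      "\<And>j l x y. j \<le> l \<Longrightarrow> (x, y) \<in> G j \<Longrightarrow>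
        (mon (a l - a j) \<odot>\<^bsub>M\<^esub> x, mon (a l - a j) \<odot>\<^bsub>N\<^esub> y) \<in> G l"
    show ?thesis
    proof (rule matching_of_chain[OF M(1) N(1) st a a_mono _ _ G(1)])
      show "x = \<zero>\<^bsub>M\<^esub>" if "x \<in> component M (a j)" "mon (steps ?\<sigma> k) \<odot>\<^bsub>M\<^esub> x = \<zero>\<^bsub>M\<^esub>" for j k x
        using \<mu>[OF n_ge(1)] that by (simp add: a_def)
      show "y = \<zero>\<^bsub>N\<^esub>" if "y \<in> component N (a j)" "mon (steps ?\<sigma> k) \<odot>\<^bsub>N\<^esub> y = \<zero>\<^bsub>N\<^esub>" for j k y
        using \<nu>[OF n_ge(2)] that by (simp add: a_def)
    qed (use G(2-5) in simp_all)
  next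
    fix j l :: nat assume jl: "j \<le> l"
    show "vectorspace.dim base_field ((component_space M (a l))\<lparr>carrier := (\<lambda>x. mon (a l - a j) \<odot>\<^bsub>M\<^esub> x) ` carrier (component_space M (a j))\<rparr>) =
      vectorspace.dim base_field ((component_space N (a l))\<lparr>carrier := (\<lambda>y. mon (a l - a j) \<odot>\<^bsub>N\<^esub> y) ` carrier (component_space N (a j))\<rparr>)"
      using rk[OF a0 a_mono[OF jl]] by (simp add: rk_def)
  qed (use fin_dim_component[OF M] fin_dim_component[OF N] M.vectorspace_component N.vectorspace_component
      M.single_module_hom[OF diff] N.single_module_hom[OF diff] trans[OF M(1)] trans[OF N(1)]
      M.one_smult[OF M.component_closed] N.one_smult[OF N.component_closed] in \<open>simp_all\<close>)
qed

section \<open>Localizations as modules of fractions\<close>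

text \<open>
  Finitely many monomials occur in \<open>s\<close>, and each has negative exponents only at variables of \<open>\<sigma>\<close>.
\<close>
lemma loc_ring_common_denominator:
  fixes s :: "('k::field, 'm::finite) laurent"
  assumes "s \<in> carrier (loc_ring \<sigma>)"
  shows "\<exists>n\<^sub>0. \<forall>n \<ge> n\<^sub>0. mon (steps \<sigma> n) * s \<in> carrier (loc_ring {})"
  using assms
proof (induction s rule: loc_ring_induct)
  case zero
  then show ?case by (simp add: loc_ring_def)
next
  case (single e c)
  define n\<^sub>0 where "n\<^sub>0 = (\<Sum>l\<in>UNIV. nat (- (e $ l)))"
  have "steps \<sigma> n + e \<in> degs {}" if n: "n\<^sub>0 \<le> n" for n
  proof -
    have "0 \<le> (steps \<sigma> n + e) $ l" for l
    proof (cases "l \<in> \<sigma>")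
      case True
      have "nat (- (e $ l)) \<le> n\<^sub>0" unfolding n\<^sub>0_def by (rule member_le_sum) auto
      then show ?thesis using True n by simp
    qed (use single in \<open>auto simp: degs_def\<close>)
    then show ?thesis by (simp add: degs_def)
  qed
  then show ?case by (intro exI[of _ n\<^sub>0]) (auto simp: mult_single intro: single_loc_ring)
next
  case (add r s)
  then obtain n m where "\<forall>k\<ge>n. mon (steps \<sigma> k) * r \<in> carrier (loc_ring {})"
    "\<forall>k\<ge>m. mon (steps \<sigma> k) * s \<in> carrier (loc_ring {})" by blast
  then show ?case by (intro exI[of _ "max n m"]) (auto simp: distrib_left intro: loc_ring_add)
qed

lemma steps_inverse: "mon (steps \<sigma> n) * Poly_Mapping.single (- steps \<sigma> n) (1 :: 'k::field) = 1"
  by (simp add: mult_single)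

lemma loc_ring_fraction:
  fixes s :: "('k::field, 'm::finite) laurent"
  assumes "s \<in> carrier (loc_ring \<sigma>)"
  obtains n r where "r \<in> carrier (loc_ring {})" "s = mon (- steps \<sigma> n) * r"
proof -
  obtain n where "mon (steps \<sigma> n) * s \<in> carrier (loc_ring {})"
    using loc_ring_common_denominator[OF assms] by blast
  moreover have "s = mon (- steps \<sigma> n) * (mon (steps \<sigma> n) * s)"
    using steps_inverse[of \<sigma> n, where 'k = 'k] by (metis mult.assoc mult.commute mult_1)
  ultimately show thesis by (rule that)
qed

text \<open>
  The localization \<open>L\<close> of a graded module \<open>M\<close> together with names for its elementary tensors and for
  the fractions \<open>frac n x\<close>, which are the tensors $u^{-n}\otimes x$ for the product $u$ of the
  variables in \<open>\<sigma>\<close>.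
\<close>
locale localized = graded_loc_module "{}" M
  for M :: "(int ^ 'm::finite, ('k::field, 'm) laurent, 'a) graded_module" (structure) +
  fixes \<sigma> :: "'m set"
begin

lemma graded: "graded_loc_module {} M" by (rule graded_loc_module_axioms)

abbreviation "F \<equiv> tensor_free \<sigma> M"
abbreviation "L \<equiv> localization \<sigma> M"
abbreviation "tensor s x \<equiv> tensor_class \<sigma> M (frag_of (s, x))"

definition frac :: "nat \<Rightarrow> 'a \<Rightarrow> (('k, 'm) laurent \<times> 'a \<Rightarrow>\<^sub>0 int) set"
  where "frac n x = tensor (mon (- steps \<sigma> n)) x"

lemma R_subset: "r \<in> carrier (loc_ring {}) \<Longrightarrow> r \<in> carrier (loc_ring \<sigma>)"
  using loc_ring_mono[of "{}" \<sigma>] by auto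

lemma inv_steps: "Poly_Mapping.single (- steps \<sigma> n) c \<in> carrier (loc_ring \<sigma>)"
  by (rule single_loc_ring[OF steps_degs(2)])

sublocale F: comm_group F by (rule abelian_free_Abelian_group)

lemma kernel_subgroup: "subgroup (tensor_kernel \<sigma> M) F"
  unfolding tensor_kernel_def by (rule group.generate_is_subgroup[OF group_free_Abelian_group tensor_relators_subset[OF graded]])

sublocale L: Module.module "loc_ring \<sigma>" L by (rule module_localization[OF graded])

lemma quotient_ops:
  "X \<otimes>\<^bsub>F Mod tensor_kernel \<sigma> M\<^esub> Y = X \<oplus>\<^bsub>L\<^esub> Y" "\<one>\<^bsub>F Mod tensor_kernel \<sigma> M\<^esub> = \<zero>\<^bsub>L\<^esub>"
  "inv\<^bsub>F Mod tensor_kernel \<sigma> M\<^esub> X = \<ominus>\<^bsub>L\<^esub> X"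
  by (simp_all add: localization_def Let_def a_inv_def m_inv_def)

lemma carrier_L: "carrier L = tensor_class \<sigma> M ` carrier F"
  by (auto simp: localization_def Let_def carrier_FactGroup tensor_class_def)

lemma class_add:
  "c \<in> carrier F \<Longrightarrow> c' \<in> carrier F \<Longrightarrow> tensor_class \<sigma> M (c + c') = tensor_class \<sigma> M c \<oplus>\<^bsub>L\<^esub> tensor_class \<sigma> M c'"
  using normal.rcos_sum[of "tensor_kernel \<sigma> M" F c c'] F.normal_iff_subgroup kernel_subgroup
  by (simp add: localization_def Let_def tensor_class_def)

lemma class_closed: "c \<in> carrier F \<Longrightarrow> tensor_class \<sigma> M c \<in> carrier L"
  by (simp only: carrier_L imageI)

lemma zero_L: "\<zero>\<^bsub>L\<^esub> = tensor_kernel \<sigma> M"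
  by (simp add: localization_def Let_def)

lemma class_zero_iff:
  assumes "c \<in> carrier F"
  shows "tensor_class \<sigma> M c = \<zero>\<^bsub>L\<^esub> \<longleftrightarrow> c \<in> tensor_kernel \<sigma> M"
  using F.coset_join1[OF _ assms kernel_subgroup] F.coset_join2[OF assms kernel_subgroup] subgroup.subset[OF kernel_subgroup]
  by (auto simp: zero_L tensor_class_def)

lemma class_eqI:
  assumes "c - c' \<in> tensor_kernel \<sigma> M"
  shows "tensor_class \<sigma> M c = tensor_class \<sigma> M c'"
  using tensor_class_eq[OF graded assms, of c'] by simp

lemma relator_kernel: "c \<in> tensor_relators \<sigma> M \<Longrightarrow> c \<in> tensor_kernel \<sigma> M"
  unfolding tensor_kernel_def by (rule generate.incl)

lemma frag_carrier: "s \<in> carrier (loc_ring \<sigma>) \<Longrightarrow> x \<in> carrier M \<Longrightarrow> frag_of (s, x) \<in> carrier F"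
  by simp

lemma tensor_closed: "s \<in> carrier (loc_ring \<sigma>) \<Longrightarrow> x \<in> carrier M \<Longrightarrow> tensor s x \<in> carrier L"
  by (rule class_closed[OF frag_carrier])

lemma tensor_add_right:
  assumes "s \<in> carrier (loc_ring \<sigma>)" "x \<in> carrier M" "y \<in> carrier M"
  shows "tensor s (x \<oplus>\<^bsub>M\<^esub> y) = tensor s x \<oplus>\<^bsub>L\<^esub> tensor s y"
proof -
  have "frag_of (s, x \<oplus>\<^bsub>M\<^esub> y) - frag_of (s, x) - frag_of (s, y) \<in> tensor_relators \<sigma> M"
    unfolding tensor_relators_def using assms by blast
  then have "tensor s (x \<oplus>\<^bsub>M\<^esub> y) = tensor_class \<sigma> M (frag_of (s, x) + frag_of (s, y))"
    by (intro class_eqI relator_kernel) (simp add: algebra_simps)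
  then show ?thesis using class_add[OF frag_carrier frag_carrier] assms by simp
qed

lemma tensor_balanced:
  assumes "s \<in> carrier (loc_ring \<sigma>)" "r \<in> carrier (loc_ring {})" "x \<in> carrier M"
  shows "tensor (s * r) x = tensor s (r \<odot>\<^bsub>M\<^esub> x)"
  by (rule class_eqI[OF relator_kernel]) (use assms in \<open>unfold tensor_relators_def, blast\<close>)

lemma smult_tensor:
  assumes "s \<in> carrier (loc_ring \<sigma>)"
  shows "s \<odot>\<^bsub>L\<^esub> tensor s' x = tensor (s * s') x"
  using localization_smult[OF graded assms] by (simp add: tensor_act_def)

lemma frac_closed: "x \<in> carrier M \<Longrightarrow> frac n x \<in> carrier L"
  unfolding frac_def by (rule tensor_closed[OF inv_steps])

lemma frac_add: "x \<in> carrier M \<Longrightarrow> y \<in> carrier M \<Longrightarrow> frac n (x \<oplus>\<^bsub>M\<^esub> y) = frac n x \<oplus>\<^bsub>L\<^esub> frac n y"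
  unfolding frac_def by (rule tensor_add_right[OF inv_steps])

lemma frac_zero: "frac n \<zero>\<^bsub>M\<^esub> = \<zero>\<^bsub>L\<^esub>"
  using frac_add[OF M.zero_closed M.zero_closed, of n] frac_closed[OF M.zero_closed, of n]
  by (metis L.M.add.r_cancel_one' M.l_zero M.zero_closed)

lemma frac_diff:
  assumes "x \<in> carrier M" "y \<in> carrier M"
  shows "frac n (x \<ominus>\<^bsub>M\<^esub> y) = frac n x \<ominus>\<^bsub>L\<^esub> frac n y"
proof -
  have "x = (x \<ominus>\<^bsub>M\<^esub> y) \<oplus>\<^bsub>M\<^esub> y" using assms by (simp add: M.minus_eq M.a_assoc M.l_neg)
  then have "frac n x = frac n (x \<ominus>\<^bsub>M\<^esub> y) \<oplus>\<^bsub>L\<^esub> frac n y"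
    using frac_add[of "x \<ominus>\<^bsub>M\<^esub> y" y n] assms by simp
  then show ?thesis using frac_closed[of "x \<ominus>\<^bsub>M\<^esub> y" n] frac_closed[of y n] assms
    by (simp add: L.M.minus_eq L.M.a_assoc L.M.r_neg)
qed

lemma frac_smult:
  assumes "r \<in> carrier (loc_ring {})" "x \<in> carrier M"
  shows "(mon (- steps \<sigma> k) * r) \<odot>\<^bsub>L\<^esub> frac n x = frac (k + n) (r \<odot>\<^bsub>M\<^esub> x)"
proof -
  have "(mon (- steps \<sigma> k) * r) \<odot>\<^bsub>L\<^esub> frac n x = tensor (mon (- steps \<sigma> k) * r * mon (- steps \<sigma> n)) x"
    unfolding frac_def by (rule smult_tensor[OF loc_ring_mult[OF inv_steps R_subset[OF assms(1)]]])
  also have "mon (- steps \<sigma> k) * r * mon (- steps \<sigma> n) = mon (- steps \<sigma> (k + n)) * r"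
    by (simp add: mult.commute mult.left_commute mult_single steps_add)
  also have "tensor \<dots> x = frac (k + n) (r \<odot>\<^bsub>M\<^esub> x)"
    unfolding frac_def by (rule tensor_balanced[OF inv_steps assms])
  finally show ?thesis .
qed

lemma frac_shift:
  assumes "x \<in> carrier M"
  shows "frac n x = frac (n + k) (mon (steps \<sigma> k) \<odot>\<^bsub>M\<^esub> x)"
  using tensor_balanced[OF inv_steps single_loc_ring[OF steps_degs(1)] assms, of "n + k" 1 \<sigma> k 1]
  by (simp add: frac_def mult_single steps_add)

lemma tensor_frac:
  assumes "s \<in> carrier (loc_ring \<sigma>)" "x \<in> carrier M"
  obtains n y where "y \<in> carrier M" "tensor s x = frac n y"
proof -
  obtain n r where r: "r \<in> carrier (loc_ring {})" "s = mon (- steps \<sigma> n) * r"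
    using loc_ring_fraction[OF assms(1)] .
  show thesis
    by (rule that[of "r \<odot>\<^bsub>M\<^esub> x" n]) (use r assms tensor_balanced[OF inv_steps r(1) assms(2)] in \<open>simp_all add: frac_def\<close>)
qed

text \<open>
  Sums of tensors are brought to a common denominator.
\<close>
lemma frac_exists:
  assumes "X \<in> carrier L"
  obtains n x where "x \<in> carrier M" "X = frac n x"
proof -
  obtain c where c: "c \<in> carrier F" "X = tensor_class \<sigma> M c" using assms carrier_L by auto
  have "Poly_Mapping.keys c \<subseteq> carrier (loc_ring \<sigma>) \<times> carrier M" using c(1) by simp
  then have "c \<in> carrier F \<and> (\<exists>n x. x \<in> carrier M \<and> tensor_class \<sigma> M c = frac n x)"
  proof (induction c rule: frag_induction)
    case zero
    have "tensor_class \<sigma> M 0 = \<zero>\<^bsub>L\<^esub>" using class_zero_iff[of 0] zero_in_tensor_kernel by simp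
    then have "tensor_class \<sigma> M 0 = frac 0 \<zero>\<^bsub>M\<^esub>" by (simp add: frac_zero)
    then show ?case by (auto intro!: exI[of _ "\<zero>\<^bsub>M\<^esub>"])
  next
    case (one p)
    then obtain s x where p: "p = (s, x)" "s \<in> carrier (loc_ring \<sigma>)" "x \<in> carrier M" by auto
    show ?case using frag_carrier[OF p(2,3)] tensor_frac[OF p(2,3)] unfolding p(1) by metis
  next
    case (diff a b)
    then obtain n x m y where *: "x \<in> carrier M" "tensor_class \<sigma> M a = frac n x" "y \<in> carrier M" "tensor_class \<sigma> M b = frac m y" by blast
    have ab: "a - b \<in> carrier F" using diff keys_diff[of a b] by auto
    have "tensor_class \<sigma> M a = tensor_class \<sigma> M (a - b) \<oplus>\<^bsub>L\<^esub> tensor_class \<sigma> M b"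
      using class_add[OF ab, of b] diff by simp
    then have "tensor_class \<sigma> M (a - b) = tensor_class \<sigma> M a \<ominus>\<^bsub>L\<^esub> tensor_class \<sigma> M b"
      using class_closed[OF ab] class_closed[of b] diff by (simp add: L.M.minus_eq L.M.a_assoc L.M.r_neg)
    also have "\<dots> = frac (n + m) (mon (steps \<sigma> m) \<odot>\<^bsub>M\<^esub> x) \<ominus>\<^bsub>L\<^esub> frac (n + m) (mon (steps \<sigma> n) \<odot>\<^bsub>M\<^esub> y)"
      using frac_shift[OF *(1), of n m] frac_shift[OF *(3), of m n] by (simp add: * add.commute)
    also have "\<dots> = frac (n + m) (mon (steps \<sigma> m) \<odot>\<^bsub>M\<^esub> x \<ominus>\<^bsub>M\<^esub> mon (steps \<sigma> n) \<odot>\<^bsub>M\<^esub> y)"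
      using * by (simp add: frac_diff single_smult_closed steps_degs)
    finally have "tensor_class \<sigma> M (a - b) = frac (n + m) (mon (steps \<sigma> m) \<odot>\<^bsub>M\<^esub> x \<ominus>\<^bsub>M\<^esub> mon (steps \<sigma> n) \<odot>\<^bsub>M\<^esub> y)" .
    moreover have "mon (steps \<sigma> m) \<odot>\<^bsub>M\<^esub> x \<ominus>\<^bsub>M\<^esub> mon (steps \<sigma> n) \<odot>\<^bsub>M\<^esub> y \<in> carrier M"
      using * by (intro M.minus_closed single_smult_closed steps_degs(1))
    ultimately show ?case using ab by blast
  qed
  then show thesis using that c(2) by blast
qed

text \<open>
  Multiplication by $u^n$ should send $s\otimes x$ to the element $(u^n s)x$ of $M$, which makes sense
  once $u^n$ clears the denominators of $s$.  For fixed \<open>n\<close> this defines a homomorphism \<open>h n\<close> on the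
  free abelian group, with value zero where $u^n s$ is no polynomial.  Hence \<open>h n\<close> need not
  vanish on all relators, but on each relator it vanishes for large \<open>n\<close>, and this property passes to
  the subgroup that the relators generate.
\<close>
lemma clearing_denominators:
  obtains h where "\<And>n. h n \<in> hom F (add_monoid M)"
    "\<And>n s x. s \<in> carrier (loc_ring \<sigma>) \<Longrightarrow> x \<in> carrier M \<Longrightarrow> mon (steps \<sigma> n) * s \<in> carrier (loc_ring {}) \<Longrightarrow>
      h n (frag_of (s, x)) = (mon (steps \<sigma> n) * s) \<odot>\<^bsub>M\<^esub> x"
    "\<And>c. c \<in> tensor_kernel \<sigma> M \<Longrightarrow> \<exists>n\<^sub>0. \<forall>n \<ge> n\<^sub>0. h n c = \<zero>\<^bsub>M\<^esub>"
proof -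
  let ?u = "\<lambda>n. Poly_Mapping.single (steps \<sigma> n) (1 :: 'k)"
  let ?f = "\<lambda>n (s, x). if ?u n * s \<in> carrier (loc_ring {}) then (?u n * s) \<odot>\<^bsub>M\<^esub> x else \<zero>\<^bsub>M\<^esub>"
  have ex: "\<exists>h. h \<in> hom F (add_monoid M) \<and> (\<forall>p \<in> carrier (loc_ring \<sigma>) \<times> carrier M. h (frag_of p) = ?f n p)" for n
  proof -
    have img: "?f n ` (carrier (loc_ring \<sigma>) \<times> carrier M) \<subseteq> carrier (add_monoid M)" by auto
    show ?thesis
    proof (rule comm_group.free_Abelian_group_universal[OF M.a_comm_group img])
      fix g assume "g \<in> hom F (add_monoid M)" "\<And>p. p \<in> carrier (loc_ring \<sigma>) \<times> carrier M \<Longrightarrow> g (frag_of p) = ?f n p"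
      then show ?thesis by (intro exI[of _ g] conjI ballI)
    qed
  qed
  have "\<exists>h. \<forall>n. h n \<in> hom F (add_monoid M) \<and> (\<forall>p \<in> carrier (loc_ring \<sigma>) \<times> carrier M. h n (frag_of p) = ?f n p)"
    by (rule choice) (intro allI ex)
  then obtain h where H: "\<forall>n. h n \<in> hom F (add_monoid M) \<and> (\<forall>p \<in> carrier (loc_ring \<sigma>) \<times> carrier M. h n (frag_of p) = ?f n p)" ..
  have h: "h n \<in> hom F (add_monoid M)" for n
    by (rule conjunct1[OF spec[OF H]])
  have hf: "h n (frag_of p) = ?f n p" if "p \<in> carrier (loc_ring \<sigma>) \<times> carrier M" for n p
    by (rule bspec[OF conjunct2[OF spec[OF H]] that])
  have gh: "group_hom F (add_monoid M) (h n)" for n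
    using h F.group_axioms M.a_comm_group by (simp add: group_hom_def group_hom_axioms_def comm_group_def)
  have hc: "h n c \<in> carrier M" if "c \<in> carrier F" for n c
    using group_hom.hom_closed[OF gh that] by simp
  have hadd: "h n (a + b) = h n a \<oplus>\<^bsub>M\<^esub> h n b" if "a \<in> carrier F" "b \<in> carrier F" for n a b
    using group_hom.hom_mult[OF gh that] by simp
  have hdiff: "h n (a - b) = h n a \<ominus>\<^bsub>M\<^esub> h n b" if a: "a \<in> carrier F" and b: "b \<in> carrier F" for n a b
  proof -
    have ab: "a - b \<in> carrier F" using that keys_diff[of a b] by auto
    have "h n a = h n (a - b) \<oplus>\<^bsub>M\<^esub> h n b" using hadd[OF ab b, of n] by simp
    then show ?thesis using hc[OF ab] hc[OF b] by (simp add: M.minus_eq M.a_assoc M.r_neg)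
  qed
  have dcl: "a - b \<in> carrier F" if "a \<in> carrier F" "b \<in> carrier F" for a b
    using that keys_diff[of a b] by auto
  have relators: "\<exists>n\<^sub>0. \<forall>n \<ge> n\<^sub>0. h n c = \<zero>\<^bsub>M\<^esub>" if "c \<in> tensor_relators \<sigma> M" for c
    using that unfolding tensor_relators_def
  proof (elim UnE CollectE exE conjE)
    fix s s' x assume c: "c = frag_of (s + s', x) - frag_of (s, x) - frag_of (s', x)"
      and s: "s \<in> carrier (loc_ring \<sigma>)" "s' \<in> carrier (loc_ring \<sigma>)" and x: "x \<in> carrier M"
    obtain k l where kl: "\<forall>n\<ge>k. ?u n * s \<in> carrier (loc_ring {})" "\<forall>n\<ge>l. ?u n * s' \<in> carrier (loc_ring {})"
      using loc_ring_common_denominator[OF s(1)] loc_ring_common_denominator[OF s(2)] by blast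
    have "h n c = \<zero>\<^bsub>M\<^esub>" if "max k l \<le> n" for n
    proof -
      have us: "?u n * s \<in> carrier (loc_ring {})" "?u n * s' \<in> carrier (loc_ring {})" using kl that by auto
      note fr = frag_carrier[OF loc_ring_add[OF s] x] frag_carrier[OF s(1) x] frag_carrier[OF s(2) x]
      have "h n c = h n (frag_of (s + s', x)) \<ominus>\<^bsub>M\<^esub> h n (frag_of (s, x)) \<ominus>\<^bsub>M\<^esub> h n (frag_of (s', x))"
        unfolding c by (simp only: hdiff dcl fr)
      also have "\<dots> = \<zero>\<^bsub>M\<^esub>"
        using us x s by (simp add: hf loc_ring_add distrib_left add_smult M.minus_eq M.a_ac M.minus_add M.r_neg)
      finally show ?thesis .
    qed
    then show ?thesis by blast
  next
    fix s x x' assume c: "c = frag_of (s, x \<oplus>\<^bsub>M\<^esub> x') - frag_of (s, x) - frag_of (s, x')"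
      and s: "s \<in> carrier (loc_ring \<sigma>)" and x: "x \<in> carrier M" "x' \<in> carrier M"
    obtain k where k: "\<forall>n\<ge>k. ?u n * s \<in> carrier (loc_ring {})" using loc_ring_common_denominator[OF s] by blast
    have "h n c = \<zero>\<^bsub>M\<^esub>" if "k \<le> n" for n
    proof -
      have us: "?u n * s \<in> carrier (loc_ring {})" using k that by auto
      note fr = frag_carrier[OF s M.a_closed[OF x]] frag_carrier[OF s x(1)] frag_carrier[OF s x(2)]
      have "h n c = h n (frag_of (s, x \<oplus>\<^bsub>M\<^esub> x')) \<ominus>\<^bsub>M\<^esub> h n (frag_of (s, x)) \<ominus>\<^bsub>M\<^esub> h n (frag_of (s, x'))"
        unfolding c by (simp only: hdiff dcl fr)
      also have "\<dots> = \<zero>\<^bsub>M\<^esub>"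
        using us x s by (simp add: hf smult_r_distr M.minus_eq M.a_ac M.minus_add M.r_neg)
      finally show ?thesis .
    qed
    then show ?thesis by blast
  next
    fix s r x assume c: "c = frag_of (s * r, x) - frag_of (s, r \<odot>\<^bsub>M\<^esub> x)"
      and s: "s \<in> carrier (loc_ring \<sigma>)" and r: "r \<in> carrier (loc_ring {})" and x: "x \<in> carrier M"
    obtain k where k: "\<forall>n\<ge>k. ?u n * s \<in> carrier (loc_ring {})" using loc_ring_common_denominator[OF s] by blast
    have "h n c = \<zero>\<^bsub>M\<^esub>" if "k \<le> n" for n
    proof -
      have us: "?u n * s \<in> carrier (loc_ring {})" using k that by auto
      have usr: "?u n * (s * r) \<in> carrier (loc_ring {})" using loc_ring_mult[OF us r] by (simp add: mult.assoc)
      note sr = loc_ring_mult[OF s R_subset[OF r]]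
      have "h n c = h n (frag_of (s * r, x)) \<ominus>\<^bsub>M\<^esub> h n (frag_of (s, r \<odot>\<^bsub>M\<^esub> x))"
        unfolding c using hdiff[OF frag_carrier[OF sr x] frag_carrier[OF s smult_closed[OF r x]]] .
      also have "\<dots> = \<zero>\<^bsub>M\<^esub>"
        using us usr x s r sr mult_smult[OF us r x] by (simp add: hf M.minus_eq M.r_neg mult.assoc)
      finally show ?thesis .
    qed
    then show ?thesis by blast
  qed
  have "\<exists>n\<^sub>0. \<forall>n \<ge> n\<^sub>0. h n c = \<zero>\<^bsub>M\<^esub>" if "c \<in> tensor_kernel \<sigma> M" for c
    using that unfolding tensor_kernel_def
  proof (induction rule: generate.induct)
    case one
    then show ?case using group_hom.hom_one[OF gh] by simp
  next
    case (incl c)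
    then show ?case by (rule relators)
  next
    case (inv c)
    have cF: "c \<in> carrier F" using inv tensor_relators_subset[OF graded] by blast
    have neg: "h n (inv\<^bsub>F\<^esub> c) = \<ominus>\<^bsub>M\<^esub> h n c" for n
      using group_hom.hom_inv[OF gh cF] unfolding a_inv_def .
    from relators[OF inv] obtain n\<^sub>0 where "\<forall>n \<ge> n\<^sub>0. h n c = \<zero>\<^bsub>M\<^esub>" by blast
    then have "\<forall>n \<ge> n\<^sub>0. h n (inv\<^bsub>F\<^esub> c) = \<zero>\<^bsub>M\<^esub>" unfolding neg by simp
    then show ?case by (rule exI)
  next
    case (eng a b)
    then have c: "a \<in> carrier F" "b \<in> carrier F"
      using F.generate_in_carrier[OF tensor_relators_subset[OF graded]] by blast+
    obtain k l where "\<forall>n \<ge> k. h n a = \<zero>\<^bsub>M\<^esub>" "\<forall>n \<ge> l. h n b = \<zero>\<^bsub>M\<^esub>" using eng.IH by blast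
    then show ?case using hadd[OF c] by (intro exI[of _ "max k l"]) simp
  qed
  then show thesis using that[of h] h hf by auto
qed

text \<open>
  The kernel of localization.  A vanishing fraction lies in the subgroup of relations, so clearing
  its denominator with a large power of $u$ gives zero in $M$ itself.
\<close>
lemma frac_zero_iff:
  assumes x: "x \<in> carrier M"
  shows "frac n x = \<zero>\<^bsub>L\<^esub> \<longleftrightarrow> torsion M \<sigma> x"
proof
  assume "torsion M \<sigma> x"
  then obtain k where "mon (steps \<sigma> k) \<odot>\<^bsub>M\<^esub> x = \<zero>\<^bsub>M\<^esub>" by (auto simp: torsion_def)
  then show "frac n x = \<zero>\<^bsub>L\<^esub>" using frac_shift[OF x, of n k] by (simp add: frac_zero)
next
  assume z: "frac n x = \<zero>\<^bsub>L\<^esub>"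
  show "torsion M \<sigma> x"
  proof (rule clearing_denominators)
    fix h
    assume h: "\<And>n s x. s \<in> carrier (loc_ring \<sigma>) \<Longrightarrow> x \<in> carrier M \<Longrightarrow> mon (steps \<sigma> n) * s \<in> carrier (loc_ring {}) \<Longrightarrow>
        h n (frag_of (s, x)) = (mon (steps \<sigma> n) * s) \<odot>\<^bsub>M\<^esub> x"
      and ker: "\<And>c. c \<in> tensor_kernel \<sigma> M \<Longrightarrow> \<exists>n\<^sub>0. \<forall>n \<ge> n\<^sub>0. h n c = \<zero>\<^bsub>M\<^esub>"
    let ?c = "frag_of (mon (- steps \<sigma> n), x)"
    have "?c \<in> tensor_kernel \<sigma> M"
      using z class_zero_iff[OF frag_carrier[OF inv_steps x], of n 1] by (simp add: frac_def)
    from ker[OF this] obtain n\<^sub>0 where n\<^sub>0: "\<And>m. n\<^sub>0 \<le> m \<Longrightarrow> h m ?c = \<zero>\<^bsub>M\<^esub>" by blast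
    have eq: "mon (steps \<sigma> (n\<^sub>0 + n)) * mon (- steps \<sigma> n) = Poly_Mapping.single (steps \<sigma> n\<^sub>0) (1 :: 'k)"
      by (simp add: mult_single steps_add)
    have "mon (steps \<sigma> n\<^sub>0) \<odot>\<^bsub>M\<^esub> x = \<zero>\<^bsub>M\<^esub>"
      using h[OF inv_steps x, of "n\<^sub>0 + n" n 1] n\<^sub>0[of "n\<^sub>0 + n"] by (simp add: eq single_loc_ring steps_degs)
    then show ?thesis by (auto simp: torsion_def)
  qed
qed

end

text \<open>
  The homogeneous parts of \<open>x\<close> may need different powers of the inverted monomial; the product of
  these powers serves all of them.
\<close>
lemma matching_total:
  assumes M: "graded_loc_module {} M" and N: "graded_loc_module {} N" and m: "matching \<sigma> M N \<Gamma>"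
    and x: "x \<in> carrier M"
  shows "\<exists>k y. (mon (steps \<sigma> k) \<odot>\<^bsub>M\<^esub> x, y) \<in> \<Gamma>"
proof -
  interpret M: graded_loc_module "{}" M by fact
  interpret N: graded_loc_module "{}" N by fact
  have lin: "linear_relation (loc_ring {}) M N \<Gamma>" using m by (simp add: matching_def)
  note D = linear_relationD[OF lin]
  from x show ?thesis
  proof (induction x rule: M.homogeneous_induct)
    case (homogeneous d)
    then show ?case using m M.proj_props(1)[OF x, of d] unfolding matching_def by blast
  next
    case zero
    then show ?case using D(3) single_smult_zero[OF M steps_degs(1)] by metis
  next
    case (add x z)
    then obtain k y l w where *: "(mon (steps \<sigma> k) \<odot>\<^bsub>M\<^esub> x, y) \<in> \<Gamma>" "(mon (steps \<sigma> l) \<odot>\<^bsub>M\<^esub> z, w) \<in> \<Gamma>"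
      by blast
    have "mon (steps \<sigma> (k + l)) \<odot>\<^bsub>M\<^esub> (x \<oplus>\<^bsub>M\<^esub> z) =
      mon (steps \<sigma> l) \<odot>\<^bsub>M\<^esub> (mon (steps \<sigma> k) \<odot>\<^bsub>M\<^esub> x) \<oplus>\<^bsub>M\<^esub>
      mon (steps \<sigma> k) \<odot>\<^bsub>M\<^esub> (mon (steps \<sigma> l) \<odot>\<^bsub>M\<^esub> z)"
      using add by (simp add: M.single_smult_smult steps_degs M.smult_r_distr single_loc_ring steps_add degs_add add.commute)
    then show ?case
      using D(4)[OF D(5)[OF single_loc_ring[OF steps_degs(1)] *(1)] D(5)[OF single_loc_ring[OF steps_degs(1)] *(2)], of \<sigma> l 1 \<sigma> k 1]
      by metis
  qed
qed

definition frac_relation ::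
  "'m::finite set \<Rightarrow> (int ^ 'm, ('k::field, 'm) laurent, 'a) graded_module \<Rightarrow>
    (int ^ 'm, ('k, 'm) laurent, 'b) graded_module \<Rightarrow> ('a \<times> 'b) set \<Rightarrow>
    ((('k, 'm) laurent \<times> 'a \<Rightarrow>\<^sub>0 int) set \<times> (('k, 'm) laurent \<times> 'b \<Rightarrow>\<^sub>0 int) set) set"
  where "frac_relation \<sigma> M N \<Gamma> = {(localized.frac M \<sigma> n x, localized.frac N \<sigma> n y) | n x y. (x, y) \<in> \<Gamma>}"

lemma frac_relation_converse: "(frac_relation \<sigma> M N \<Gamma>)\<inverse> = frac_relation \<sigma> N M (\<Gamma>\<inverse>)"
  unfolding frac_relation_def by blast

context
  fixes M :: "(int ^ 'm::finite, ('k::field, 'm) laurent, 'a) graded_module"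
    and N :: "(int ^ 'm, ('k, 'm) laurent, 'b) graded_module" and \<sigma> \<Gamma>
  assumes M: "graded_loc_module {} M" and N: "graded_loc_module {} N" and m: "matching \<sigma> M N \<Gamma>"
begin

interpretation M: localized M \<sigma> using M by (simp add: localized_def)
interpretation N: localized N \<sigma> using N by (simp add: localized_def)

lemma frac_relationI: "(x, y) \<in> \<Gamma> \<Longrightarrow> (M.frac n x, N.frac n y) \<in> frac_relation \<sigma> M N \<Gamma>"
  unfolding frac_relation_def by blast

lemma frac_relationE:
  assumes "(X, Y) \<in> frac_relation \<sigma> M N \<Gamma>"
  obtains n x y where "(x, y) \<in> \<Gamma>" "X = M.frac n x" "Y = N.frac n y"
  using assms unfolding frac_relation_def by blast

lemma matching_linear: "linear_relation (loc_ring {}) M N \<Gamma>"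
  using m by (simp add: matching_def)

lemma frac_relation_linear: "linear_relation (loc_ring \<sigma>) (localization \<sigma> M) (localization \<sigma> N) (frac_relation \<sigma> M N \<Gamma>)"
  unfolding linear_relation_def
proof (intro conjI allI impI)
  note D = linear_relationD[OF matching_linear]
  show "frac_relation \<sigma> M N \<Gamma> \<subseteq> carrier (localization \<sigma> M) \<times> carrier (localization \<sigma> N)"
    using M.frac_closed[OF D(1)] N.frac_closed[OF D(2)] by (auto elim!: frac_relationE)
  show "(\<zero>\<^bsub>localization \<sigma> M\<^esub>, \<zero>\<^bsub>localization \<sigma> N\<^esub>) \<in> frac_relation \<sigma> M N \<Gamma>"
    using frac_relationI[OF D(3), of 0] by (simp add: M.frac_zero N.frac_zero)
next
  note D = linear_relationD[OF matching_linear]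
  fix X Y X' Y' assume "(X, Y) \<in> frac_relation \<sigma> M N \<Gamma>" "(X', Y') \<in> frac_relation \<sigma> M N \<Gamma>"
  then obtain n x y n' x' y' where xy: "(x, y) \<in> \<Gamma>" "X = M.frac n x" "Y = N.frac n y"
    and xy': "(x', y') \<in> \<Gamma>" "X' = M.frac n' x'" "Y' = N.frac n' y'" by (elim frac_relationE)
  let ?u = "\<lambda>k. mon (steps \<sigma> k)"
  have r: "(?u n' \<odot>\<^bsub>M\<^esub> x, ?u n' \<odot>\<^bsub>N\<^esub> y) \<in> \<Gamma>" "(?u n \<odot>\<^bsub>M\<^esub> x', ?u n \<odot>\<^bsub>N\<^esub> y') \<in> \<Gamma>"
    using D(5)[OF single_loc_ring[OF steps_degs(1)] xy(1)] D(5)[OF single_loc_ring[OF steps_degs(1)] xy'(1)] by auto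
  have "X = M.frac (n + n') (?u n' \<odot>\<^bsub>M\<^esub> x)" "X' = M.frac (n + n') (?u n \<odot>\<^bsub>M\<^esub> x')"
    using M.frac_shift[OF D(1)[OF xy(1)], of n n'] M.frac_shift[OF D(1)[OF xy'(1)], of n' n] by (simp_all add: xy xy' add.commute)
  moreover have "Y = N.frac (n + n') (?u n' \<odot>\<^bsub>N\<^esub> y)" "Y' = N.frac (n + n') (?u n \<odot>\<^bsub>N\<^esub> y')"
    using N.frac_shift[OF D(2)[OF xy(1)], of n n'] N.frac_shift[OF D(2)[OF xy'(1)], of n' n] by (simp_all add: xy xy' add.commute)
  ultimately show "(X \<oplus>\<^bsub>localization \<sigma> M\<^esub> X', Y \<oplus>\<^bsub>localization \<sigma> N\<^esub> Y') \<in> frac_relation \<sigma> M N \<Gamma>"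
    using frac_relationI[OF D(4)[OF r], of "n + n'"] D(1,2)[OF r(1)] D(1,2)[OF r(2)] by (simp add: M.frac_add N.frac_add)
next
  note D = linear_relationD[OF matching_linear]
  fix s :: "('k, 'm) laurent" and X Y assume s: "s \<in> carrier (loc_ring \<sigma>)" and "(X, Y) \<in> frac_relation \<sigma> M N \<Gamma>"
  then obtain n x y where xy: "(x, y) \<in> \<Gamma>" "X = M.frac n x" "Y = N.frac n y" by (elim frac_relationE)
  obtain k r where r: "r \<in> carrier (loc_ring {})" "s = mon (- steps \<sigma> k) * r"
    using loc_ring_fraction[OF s] .
  show "(s \<odot>\<^bsub>localization \<sigma> M\<^esub> X, s \<odot>\<^bsub>localization \<sigma> N\<^esub> Y) \<in> frac_relation \<sigma> M N \<Gamma>"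
    using frac_relationI[OF D(5)[OF r(1) xy(1)], of "k + n"]
    by (simp add: r(2) xy(2,3) M.frac_smult[OF r(1) D(1)[OF xy(1)]] N.frac_smult[OF r(1) D(2)[OF xy(1)]])
qed

lemma frac_relation_total: "carrier (localization \<sigma> M) \<subseteq> Domain (frac_relation \<sigma> M N \<Gamma>)"
proof
  fix X assume "X \<in> carrier (localization \<sigma> M)"
  then obtain n x where x: "x \<in> carrier M" "X = M.frac n x" by (rule M.frac_exists)
  obtain k y where "(mon (steps \<sigma> k) \<odot>\<^bsub>M\<^esub> x, y) \<in> \<Gamma>"
    using matching_total[OF M N m x(1)] by blast
  from frac_relationI[OF this, of "n + k"] show "X \<in> Domain (frac_relation \<sigma> M N \<Gamma>)"
    using M.frac_shift[OF x(1), of n k] x(2) by auto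
qed

lemma frac_relation_zero:
  assumes "(X, Y) \<in> frac_relation \<sigma> M N \<Gamma>"
  shows "X = \<zero>\<^bsub>localization \<sigma> M\<^esub> \<longleftrightarrow> Y = \<zero>\<^bsub>localization \<sigma> N\<^esub>"
proof -
  obtain n x y where xy: "(x, y) \<in> \<Gamma>" "X = M.frac n x" "Y = N.frac n y"
    using assms by (rule frac_relationE)
  have "torsion M \<sigma> x \<longleftrightarrow> torsion N \<sigma> y" using m xy(1) by (simp add: matching_def)
  then show ?thesis
    using linear_relationD(1,2)[OF matching_linear xy(1)] by (simp add: xy(2,3) M.frac_zero_iff N.frac_zero_iff)
qed

text \<open>
  On generators: a tensor $s\otimes x$ of homogeneous elements is also $(u^{-k}s)\otimes(u^k x)$, and
  for suitable \<open>k\<close> the element $u^k x$ is related to a homogeneous \<open>y\<close> of the same degree.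
\<close>
lemma frac_relation_component:
  assumes "X \<in> component (localization \<sigma> M) d"
  shows "\<exists>Y \<in> component (localization \<sigma> N) d. (X, Y) \<in> frac_relation \<sigma> M N \<Gamma>"
proof -
  note E = linear_relationD[OF frac_relation_linear]
  define A where "A = {M.tensor (Poly_Mapping.single e c) x | e c x d'. e \<in> degs \<sigma> \<and> x \<in> component M d' \<and> e + d' = d}"
  define B where "B = {N.tensor (Poly_Mapping.single e c) y | e c y d'. e \<in> degs \<sigma> \<and> y \<in> component N d' \<and> e + d' = d}"
  have comp: "component (localization \<sigma> M) d = generate (M.F Mod tensor_kernel \<sigma> M) A"
    "component (localization \<sigma> N) d = generate (N.F Mod tensor_kernel \<sigma> N) B"
    by (simp_all add: A_def B_def localization_def Let_def)
  have gen: "\<exists>Y \<in> B. (X, Y) \<in> frac_relation \<sigma> M N \<Gamma>" if XA: "X \<in> A" for X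
  proof -
    obtain e c x d' where X: "X = M.tensor (Poly_Mapping.single e c) x" "e \<in> degs \<sigma>" "x \<in> component M d'" "e + d' = d"
      using XA unfolding A_def by (elim CollectE exE conjE) (rule that)
    obtain k y where y: "y \<in> component N (d' + steps \<sigma> k)" "(mon (steps \<sigma> k) \<odot>\<^bsub>M\<^esub> x, y) \<in> \<Gamma>"
      using m X(3) unfolding matching_def by blast
    let ?s = "Poly_Mapping.single (e - steps \<sigma> k) c"
    have e: "e - steps \<sigma> k \<in> degs \<sigma>" using degs_add[OF X(2) steps_degs(2)] by simp
    note s = single_loc_ring[OF e, of c]
    have "X = M.tensor (?s * mon (steps \<sigma> k)) x" by (simp add: X(1) mult_single)
    also have "\<dots> = M.tensor ?s (mon (steps \<sigma> k) \<odot>\<^bsub>M\<^esub> x)"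
      by (rule M.tensor_balanced[OF s single_loc_ring[OF steps_degs(1)] M.component_closed[OF X(3)]])
    also have "\<dots> = ?s \<odot>\<^bsub>localization \<sigma> M\<^esub> M.frac 0 (mon (steps \<sigma> k) \<odot>\<^bsub>M\<^esub> x)"
      unfolding M.frac_def M.smult_tensor[OF s] by (simp add: steps_add)
    finally have X': "X = ?s \<odot>\<^bsub>localization \<sigma> M\<^esub> M.frac 0 (mon (steps \<sigma> k) \<odot>\<^bsub>M\<^esub> x)" .
    have Y': "N.tensor ?s y = ?s \<odot>\<^bsub>localization \<sigma> N\<^esub> N.frac 0 y"
      unfolding N.frac_def N.smult_tensor[OF s] by (simp add: steps_add)
    have "(X, N.tensor ?s y) \<in> frac_relation \<sigma> M N \<Gamma>"
      unfolding X' Y' by (rule E(5)[OF s frac_relationI[OF y(2)]])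
    moreover have "N.tensor ?s y \<in> B"
      unfolding B_def using e y(1) X(4) by (intro CollectI exI[of _ "e - steps \<sigma> k"] exI[of _ c] exI[of _ y] exI[of _ "d' + steps \<sigma> k"]) simp
    ultimately show ?thesis by blast
  qed
  show ?thesis using assms unfolding comp
  proof (induction rule: generate.induct)
    case one
    show ?case using E(3) generate.one[of "N.F Mod tensor_kernel \<sigma> N" B] unfolding M.quotient_ops N.quotient_ops by blast
  next
    case (incl X)
    then show ?case using gen generate.incl by metis
  next
    case (inv X)
    then obtain Y where Y: "Y \<in> B" "(X, Y) \<in> frac_relation \<sigma> M N \<Gamma>" using gen by blast
    have "(\<zero>\<^bsub>localization \<sigma> M\<^esub> \<ominus>\<^bsub>localization \<sigma> M\<^esub> X, \<zero>\<^bsub>localization \<sigma> N\<^esub> \<ominus>\<^bsub>localization \<sigma> N\<^esub> Y) \<in> frac_relation \<sigma> M N \<Gamma>"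
      by (rule linear_relation_minus[OF M.L.module_axioms N.L.module_axioms frac_relation_linear E(3) Y(2)])
    then have "(\<ominus>\<^bsub>localization \<sigma> M\<^esub> X, \<ominus>\<^bsub>localization \<sigma> N\<^esub> Y) \<in> frac_relation \<sigma> M N \<Gamma>"
      using E(1,2)[OF Y(2)] by (simp add: M.L.M.minus_eq N.L.M.minus_eq)
    then show ?case using generate.inv[OF Y(1), of "N.F Mod tensor_kernel \<sigma> N"] unfolding M.quotient_ops N.quotient_ops by blast
  next
    case (eng X X')
    then obtain Y Y' where Y: "Y \<in> generate (N.F Mod tensor_kernel \<sigma> N) B" "(X, Y) \<in> frac_relation \<sigma> M N \<Gamma>"
      "Y' \<in> generate (N.F Mod tensor_kernel \<sigma> N) B" "(X', Y') \<in> frac_relation \<sigma> M N \<Gamma>" by blast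
    show ?case using generate.eng[OF Y(1,3)] E(4)[OF Y(2,4)] unfolding M.quotient_ops N.quotient_ops by blast
  qed
qed

end

theorem graded_iso_if_matching:
  assumes M: "graded_loc_module {} M" and N: "graded_loc_module {} N" and m: "matching \<sigma> M N \<Gamma>"
  shows "graded_iso \<sigma> (localization \<sigma> M) (localization \<sigma> N)"
proof -
  let ?\<Phi> = "frac_relation \<sigma> M N \<Gamma>"
  note lin = frac_relation_linear[OF M N m]
  note c = matching_converse[OF m]
  have dom: "Domain ?\<Phi> = carrier (localization \<sigma> M)"
    using frac_relation_total[OF M N m] linear_relationD(1)[OF lin] by auto
  have ran: "Range ?\<Phi> = carrier (localization \<sigma> N)"
    using frac_relation_total[OF N M c] linear_relationD(2)[OF lin] by (auto simp: frac_relation_converse[symmetric])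
  obtain f where f: "f \<in> module_hom (loc_ring \<sigma>) (localization \<sigma> M) (localization \<sigma> N)"
    "bij_betw f (carrier (localization \<sigma> M)) (carrier (localization \<sigma> N))" "?\<Phi> = {(X, f X) | X. X \<in> carrier (localization \<sigma> M)}"
    by (rule linear_relation_iso[OF module_localization[OF M] module_localization[OF N] lin dom ran frac_relation_zero[OF M N m]])
  have "f ` component (localization \<sigma> M) d = component (localization \<sigma> N) d" for d
  proof
    show "f ` component (localization \<sigma> M) d \<subseteq> component (localization \<sigma> N) d"
      using frac_relation_component[OF M N m] f(3) by fastforce
    show "component (localization \<sigma> N) d \<subseteq> f ` component (localization \<sigma> M) d"
    proof
      fix Y assume "Y \<in> component (localization \<sigma> N) d"
      from frac_relation_component[OF N M c this] obtain X where "X \<in> component (localization \<sigma> M) d" "(X, Y) \<in> ?\<Phi>"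
        by (auto simp: frac_relation_converse[symmetric])
      then show "Y \<in> f ` component (localization \<sigma> M) d" unfolding f(3) by auto
    qed
  qed
  then show ?thesis unfolding graded_iso_def using f(1,2) by blast
qed

theorem corollary10p6:
  fixes M :: "(int ^ 'm::finite, ('k::field, 'm) laurent, 'a) graded_module"
    and N :: "(int ^ 'm, ('k, 'm) laurent, 'b) graded_module"
  assumes "graded_loc_module {} M" and "finitely_generated {} M"
    and "graded_loc_module {} N" and "finitely_generated {} N"
    and "\<And>a b. 0 \<le> a \<Longrightarrow> a \<le> b \<Longrightarrow> rk M a b = rk N a b"
  shows "(\<forall>i. graded_iso (UNIV - {i}) (localization (UNIV - {i}) M) (localization (UNIV - {i}) N)) \<and>
    graded_iso UNIV (localization UNIV M) (localization UNIV N)"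
proof -
  have matching: "\<exists>\<Gamma>. matching (UNIV - {i}) M N \<Gamma>" for i
    by (rule matching_if_rk_eq[OF assms])
  \<comment> \<open>For \<open>UNIV\<close>, the matching for any direction will do.\<close>
  then obtain \<Gamma> where "matching (UNIV - {undefined}) M N \<Gamma>" by blast
  then have "matching UNIV M N \<Gamma>" by (rule matching_mono[OF assms(1,3)]) simp
  then show ?thesis using matching graded_iso_if_matching[OF assms(1,3)] by blast
qed

end
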